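(* Let $M>0$, let $H\in\mathbb{R}$, let $c_1<-8M^3H$ and $\bar c_1\in\mathbb{R}$, and let $\Sigma^1=\Sigma^1_{H,c_1,\bar c_1}$ be the corresponding SS-CMC hypersurface in region I. Put $k_H(r)=-Hr^3-r^{3/2}(2M-r)^{1/2}$ on $(0,2M)$, let $r_H\in(0,2M)$ be its unique minimum point, and $c_H=k_H(r_H)$ (so $c_H<-8M^3H$). Then there is $\bar c_2\in\mathbb{R}$ such that $\Sigma^1$ connects smoothly with the SS-CMC hypersurface $\Sigma^2=\Sigma^2_{H,c_1,\bar c_2}$ in region II. Moreover: (a) If $c_1<c_H$, then $\Sigma^2$ is defined for $r\in(0,2M)$, and $\Sigma^1\cup\Sigma^2$ forms a complete and smooth SS-CMC hypersurface in the Kruskal extension with two ends. (b) If $c_1=c_H$, then $\Sigma^2$ is defined for $r\in(r_H,2M)$, and $\Sigma^1\cup\Sigma^2$ forms a complete and smooth SS-CMC hypersurface in the Kruskal extension with two ends. (c) If $c_H<c_1<-8M^3H$, then $\Sigma^2$ also connects smoothly with an SS-CMC hypersurface $\Sigma^3=\Sigma^3_{H,c_1,\bar c_3}$ in region I$'$ for some $\bar c_3\in\mathbb{R}$, and $\Sigma^1\cup\Sigma^2\cup\Sigma^3$ forms a complete and smooth SS-CMC hypersurface in the Kruskal extension with two ends.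
   Context: Kruskal extension: for $M>0$ and $h(r)=1-\frac{2M}{r}$, it is the manifold $\{(U,V)\in\mathbb{R}^2: UV>-2M\}\times\mathbb{S}^2$ with metric $\mathrm{d}s^2=\frac{16M^2e^{-r/2M}}{r}\,\mathrm{d}U\,\mathrm{d}V+r^2(\mathrm{d}\theta^2+\sin^2\theta\,\mathrm{d}\phi^2)$, where $r>0$ is determined by $(r-2M)e^{r/2M}=UV$. With $X=\frac{V+U}2$, $T=\frac{V-U}2$ one has $\mathrm{d}U\,\mathrm{d}V=-\mathrm{d}T^2+\mathrm{d}X^2$, and $\partial_T$ is taken to be future directed. Regions: I $=\{U>0,V>0\}$, II $=\{U<0,V>0\}$, I$'=\{U<0,V<0\}$, II$'=\{U>0,V<0\}$. In each region one uses coordinates $(t,r,\theta,\phi)$ with $t=2M\ln|V/U|$; equivalently, with $u=t-(r+2M\ln|r-2M|)$, $v=t+(r+2M\ln|r-2M|)$, one has $|U|=e^{-u/4M}$, $|V|=e^{v/4M}$. In these coordinates $\mathrm{d}s^2=-h\,\mathrm{d}t^2+h^{-1}\mathrm{d}r^2+r^2(\mathrm{d}\theta^2+\sin^2\theta\,\mathrm{d}\phi^2)$; regions I, I$'$ correspond to $r>2M$ and II, II$'$ to $0<r<2M$. The future direction is increasing $t$ in I, decreasing $r$ in II, decreasing $t$ in I$'$, increasing $r$ in II$'$. SS-CMC means spacelike, spherically symmetric, with constant mean curvature. The mean curvature is $H=\frac13\sum_i\langle\nabla_{e_i}N,e_i\rangle$, where $N$ is the future directed unit timelike normal and $\{e_i\}$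 is an orthonormal tangent frame. $\Sigma^1_{H,c,\bar c}$ is the hypersurface $t=f_1(r)$, $r>2M$, in region I with $f_1(r)=\int_{r_1}^r\frac{l_1(x)}{h(x)}\frac{\mathrm{d}x}{\sqrt{1+l_1(x)^2}}+\bar c$, $l_1(r)=\frac1{\sqrt{h(r)}}\left(Hr+\frac{c}{r^2}\right)$, where $r_1>2M$ is fixed. $\Sigma^3_{H,c,\bar c}$ is the hypersurface $t=f_3(r)$, $r>2M$, in region I$'$ with $f_3(r)=\int_{r_3}^r\frac{l_3(x)}{h(x)}\frac{\mathrm{d}x}{\sqrt{1+l_3(x)^2}}+\bar c$, $l_3=-l_1$, where $r_3>2M$ is fixed. In region II, let $l_2(r)=\frac1{\sqrt{-h(r)}}\left(-Hr-\frac{c}{r^2}\right)$ and $f_2^*(r)=\int_{r_2}^r\frac1{-h(x)}\sqrt{\frac{l_2(x)^2}{l_2(x)^2-1}}\,\mathrm{d}x+\bar c$, $f_2^{**}(r)=\int_{r_2'}^r\frac1{h(x)}\sqrt{\frac{l_2(x)^2}{l_2(x)^2-1}}\,\mathrm{d}x+\bar c'$, defined where $l_2>1$ (equivalently $k_H(r)>c$) and also at points with $k_H(r)=c$ at which the integral is finite. For $c<c_H$ the domain is $(0,2M)$; for $c=c_H$ the relevant component of the domain is $(r_H,2M)$; in these two cases $\Sigma^2_{H,c,\bar c}$ is the hypersurface $t=f_2^*(r)$ in region II over that interval. For $c_H<c<-8M^3H$ the relevant component of the domain is $[r'',2M)$ with $k_H(r'')=c$, and $\Sigma^2_{H,c,\bar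 c}$ is the union of the hypersurfaces $t=f_2^*(r)$ and $t=f_2^{**}(r)$ over $[r'',2M)$ with $r_2=r_2'=r''$ and $\bar c'=\bar c$. Two such hypersurfaces in adjacent regions connect smoothly if their union, together with the limiting 2-sphere on the common boundary $r=2M$ of the two regions, is a smooth spacelike hypersurface in the Kruskal extension; unions are understood to include these limiting spheres. A hypersurface is complete if it has no boundary and is a closed subset of the spacetime (ends may approach $r=0$, $r=\infty$, or be asymptotic to a hypersurface $r=\text{const}$). *)

theory Defs
  imports "HOL-Analysis.Analysis"
begin

section \<open>Smooth maps\<close>

text \<open>All uses are on open sets; smoothness means that all iterated directional derivatives
  exist, are differentiable and hence continuous.\<close>

primrec differentiable_upto ::
    "nat \<Rightarrow> 'a::real_normed_vector set \<Rightarrow> ('a \<Rightarrow> 'b::real_normed_vector) \<Rightarrow> bool" where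
  "differentiable_upto 0 S f \<longleftrightarrow> continuous_on S f"
| "differentiable_upto (Suc n) S f \<longleftrightarrow>
     (\<forall>x\<in>S. f differentiable (at x)) \<and>
     (\<forall>v. differentiable_upto n S (\<lambda>x. frechet_derivative f (at x) v))"

definition smooth_on :: "'a::real_normed_vector set \<Rightarrow> ('a \<Rightarrow> 'b::real_normed_vector) \<Rightarrow> bool" where
  "smooth_on S f \<longleftrightarrow> (\<forall>n. differentiable_upto n S f)"


section \<open>Hypersurfaces in a coordinate domain with a Lorentzian metric\<close>

text \<open>Here \<open>g\<close> gives the matrix of metric coefficients at each coordinate point.\<close>

definition metric_inner :: "(real^4 \<Rightarrow> real^4^4) \<Rightarrow> real^4 \<Rightarrow> real^4 \<Rightarrow> real^4 \<Rightarrow> real" where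
  "metric_inner g p v w = v \<bullet> (g p *v w)"

definition partial :: "4 \<Rightarrow> (real^4 \<Rightarrow> real) \<Rightarrow> real^4 \<Rightarrow> real" where
  "partial i f p = frechet_derivative f (at p) (axis i 1)"

definition christoffel :: "(real^4 \<Rightarrow> real^4^4) \<Rightarrow> real^4 \<Rightarrow> 4 \<Rightarrow> 4 \<Rightarrow> 4 \<Rightarrow> real" where
  "christoffel g p k i j =
     (1/2) * (\<Sum>l\<in>UNIV. matrix_inv (g p) $ k $ l *
       (partial i (\<lambda>x. g x $ l $ j) p + partial j (\<lambda>x. g x $ l $ i) p
        - partial l (\<lambda>x. g x $ i $ j) p))"

text \<open>The Levi-Civita derivative of the vector field \<open>N\<close> in direction \<open>v\<close> at \<open>p\<close>.\<close>

definition covariant_derivative ::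
    "(real^4 \<Rightarrow> real^4^4) \<Rightarrow> real^4 \<Rightarrow> real^4 \<Rightarrow> (real^4 \<Rightarrow> real^4) \<Rightarrow> real^4" where
  "covariant_derivative g p v N =
     (\<chi> k. frechet_derivative N (at p) v $ k
          + (\<Sum>i\<in>UNIV. \<Sum>j\<in>UNIV. christoffel g p k i j * v $ i * N p $ j))"

text \<open>Embedded smooth hypersurfaces without boundary: locally, regular level sets.\<close>

definition embedded_hypersurface :: "(real^4) set \<Rightarrow> bool" where
  "embedded_hypersurface S \<longleftrightarrow>
     (\<forall>p\<in>S. \<exists>W (F :: real^4 \<Rightarrow> real). open W \<and> p \<in> W \<and> smooth_on W F \<and>
        S \<inter> W = {x \<in> W. F x = 0} \<and>
        (\<forall>x\<in>S \<inter> W. \<exists>v. frechet_derivative F (at x) v \<noteq> 0))"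

text \<open>Tangent vectors are the velocities of smooth curves in \<open>S\<close>.\<close>

definition tangent_vectors :: "(real^4) set \<Rightarrow> real^4 \<Rightarrow> (real^4) set" where
  "tangent_vectors S p =
     {v. \<exists>\<gamma> \<epsilon>. 0 < (\<epsilon>::real) \<and> smooth_on {-\<epsilon><..<\<epsilon>} \<gamma> \<and> \<gamma> ` {-\<epsilon><..<\<epsilon>} \<subseteq> S \<and>
         \<gamma> 0 = p \<and> (\<gamma> has_vector_derivative v) (at 0)}"

definition spacelike :: "(real^4 \<Rightarrow> real^4^4) \<Rightarrow> (real^4) set \<Rightarrow> bool" where
  "spacelike g S \<longleftrightarrow> (\<forall>p\<in>S. \<forall>v\<in>tangent_vectors S p. v \<noteq> 0 \<longrightarrow> metric_inner g p v v > 0)"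

text \<open>The vector \<open>\<tau>\<close> is timelike and fixes the time orientation; with signature
  \<open>(-,+,+,+)\<close> a timelike vector is future directed iff its product with \<open>\<tau>\<close> is negative.\<close>

definition future_unit_normal ::
    "(real^4 \<Rightarrow> real^4^4) \<Rightarrow> real^4 \<Rightarrow> (real^4) set \<Rightarrow> real^4 \<Rightarrow> real^4 \<Rightarrow> bool" where
  "future_unit_normal g \<tau> S p n \<longleftrightarrow>
     (\<forall>v\<in>tangent_vectors S p. metric_inner g p n v = 0) \<and>
     metric_inner g p n n = -1 \<and> metric_inner g p n \<tau> < 0"

definition orthonormal_tangent_frame ::
    "(real^4 \<Rightarrow> real^4^4) \<Rightarrow> (real^4) set \<Rightarrow> real^4 \<Rightarrow> (3 \<Rightarrow> real^4) \<Rightarrow> bool" where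
  "orthonormal_tangent_frame g S p e \<longleftrightarrow>
     (\<forall>i. e i \<in> tangent_vectors S p) \<and>
     (\<forall>i j. metric_inner g p (e i) (e j) = (if i = j then 1 else 0))"

text \<open>The unit normal is extended smoothly off \<open>S\<close> near \<open>p\<close>; only derivatives in directions
  tangent to \<open>S\<close> enter, so the choice of extension does not matter.  Used for spacelike
  hypersurfaces, where orthonormal frames exist.\<close>

definition has_mean_curvature ::
    "(real^4 \<Rightarrow> real^4^4) \<Rightarrow> real^4 \<Rightarrow> (real^4) set \<Rightarrow> real^4 \<Rightarrow> real \<Rightarrow> bool" where
  "has_mean_curvature g \<tau> S p H \<longleftrightarrow>
     (\<exists>W N. open W \<and> p \<in> W \<and> smooth_on W N \<and>
        (\<forall>x\<in>S \<inter> W. future_unit_normal g \<tau> S x (N x)) \<and>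
        (\<forall>e. orthonormal_tangent_frame g S p e \<longrightarrow>
           (1/3) * (\<Sum>i\<in>UNIV. metric_inner g p (covariant_derivative g p (e i) N) (e i)) = H))"


section \<open>The Kruskal extension\<close>

type_synonym event = "(real \<times> real) \<times> (real^3)"

definition kruskal :: "real \<Rightarrow> event set" where
  "kruskal M = {(U, V). U * V > - 2 * M} \<times> sphere 0 1"

definition area_radius :: "real \<Rightarrow> real \<Rightarrow> real \<Rightarrow> real" where
  "area_radius M U V = (THE r. r > 0 \<and> (r - 2 * M) * exp (r / (2 * M)) = U * V)"

definition killing_time :: "real \<Rightarrow> real \<Rightarrow> real \<Rightarrow> real" where
  "killing_time M U V = 2 * M * ln \<bar>V / U\<bar>"

text \<open>Coordinates are \<open>(U, V, \<theta>, \<phi>)\<close>.  Spherical coordinates are taken relative to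
  an arbitrary rotated frame \<open>R\<close>, so that the charts together cover the poles;
  as \<open>\<phi>\<close> is not restricted, each chart is a local diffeomorphism onto its image.
  By rotational symmetry the metric has the same coefficients in all these charts.\<close>

definition chart_domain :: "real \<Rightarrow> (real^4) set" where
  "chart_domain M = {x. x$1 * x$2 > - 2 * M \<and> 0 < x$3 \<and> x$3 < pi}"

definition chart :: "real^3^3 \<Rightarrow> real^4 \<Rightarrow> event" where
  "chart R x = ((x$1, x$2),
     R *v vector [sin (x$3) * cos (x$4), sin (x$3) * sin (x$4), cos (x$3)])"

definition in_chart :: "real \<Rightarrow> real^3^3 \<Rightarrow> event set \<Rightarrow> (real^4) set" where
  "in_chart M R S = {x \<in> chart_domain M. chart R x \<in> S}"

text \<open>The line element contains the symmetric product \<open>dU dV\<close>, whence the coefficient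
  \<open>g\<^sub>U\<^sub>V = g\<^sub>V\<^sub>U\<close> is half of \<open>16 M\<^sup>2 exp (- r / 2 M) / r\<close>.\<close>

definition kruskal_metric :: "real \<Rightarrow> real^4 \<Rightarrow> real^4^4" where
  "kruskal_metric M x =
     (let r = area_radius M (x$1) (x$2); a = 8 * M^2 * exp (- r / (2 * M)) / r
      in vector [vector [0, a, 0, 0],
                 vector [a, 0, 0, 0],
                 vector [0, 0, r^2, 0],
                 vector [0, 0, 0, r^2 * (sin (x$3))^2]])"

text \<open>\<open>\<partial>\<^sub>T = \<partial>\<^sub>V - \<partial>\<^sub>U\<close>, since \<open>U = X - T\<close> and \<open>V = X + T\<close>.\<close>

definition future_dir :: "real^4" where
  "future_dir = vector [-1, 1, 0, 0]"


section \<open>Spherically symmetric CMC hypersurfaces\<close>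

definition smooth_spacelike_hypersurface :: "real \<Rightarrow> event set \<Rightarrow> bool" where
  "smooth_spacelike_hypersurface M S \<longleftrightarrow> S \<subseteq> kruskal M \<and>
     (\<forall>R. rotation_matrix R \<longrightarrow>
        embedded_hypersurface (in_chart M R S) \<and> spacelike (kruskal_metric M) (in_chart M R S))"

definition spherically_symmetric :: "event set \<Rightarrow> bool" where
  "spherically_symmetric S \<longleftrightarrow>
     (\<forall>R. rotation_matrix R \<longrightarrow> (\<forall>x \<omega>. (x, \<omega>) \<in> S \<longrightarrow> (x, R *v \<omega>) \<in> S))"

definition ss_cmc :: "real \<Rightarrow> real \<Rightarrow> event set \<Rightarrow> bool" where
  "ss_cmc M H S \<longleftrightarrow> smooth_spacelike_hypersurface M S \<and> spherically_symmetric S \<and>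
     (\<forall>R. rotation_matrix R \<longrightarrow>
        (\<forall>p\<in>in_chart M R S.
           has_mean_curvature (kruskal_metric M) future_dir (in_chart M R S) p H))"

text \<open>Smooth hypersurfaces in the above sense have no boundary, so completeness only adds
  closedness in the spacetime.\<close>

definition complete_hypersurface :: "real \<Rightarrow> event set \<Rightarrow> bool" where
  "complete_hypersurface M S \<longleftrightarrow>
     smooth_spacelike_hypersurface M S \<and> closedin (top_of_set (kruskal M)) S"

text \<open>The number of ends is the maximal number of components with non-compact closure
  (relative to \<open>S\<close>) of the complement of a compact subset.\<close>

definition unbounded_components :: "'a::topological_space set \<Rightarrow> 'a set \<Rightarrow> 'a set set" where
  "unbounded_components S K = {C \<in> components (S - K). \<not> compact (S \<inter> closure C)}"

definition has_ends :: "'a::topological_space set \<Rightarrow> nat \<Rightarrow> bool" where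
  "has_ends S n \<longleftrightarrow>
     (\<forall>K. compact K \<and> K \<subseteq> S \<longrightarrow>
        finite (unbounded_components S K) \<and> card (unbounded_components S K) \<le> n) \<and>
     (\<exists>K. compact K \<and> K \<subseteq> S \<and> card (unbounded_components S K) = n)"


section \<open>Smooth connection across the horizon\<close>

definition horizon :: "real \<Rightarrow> event set" where
  "horizon M = {((U, V), \<omega>) \<in> kruskal M. area_radius M U V = 2 * M}"

definition limiting_set :: "real \<Rightarrow> event set \<Rightarrow> event set \<Rightarrow> event set" where
  "limiting_set M A B = horizon M \<inter> closure A \<inter> closure B"

definition join :: "real \<Rightarrow> event set \<Rightarrow> event set \<Rightarrow> event set" where
  "join M A B = A \<union> B \<union> limiting_set M A B"

definition connects_smoothly :: "real \<Rightarrow> event set \<Rightarrow> event set \<Rightarrow> bool" where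
  "connects_smoothly M A B \<longleftrightarrow>
     (\<exists>x. limiting_set M A B = {x} \<times> sphere 0 1) \<and>
     smooth_spacelike_hypersurface M (join M A B)"


section \<open>The hypersurfaces in the individual regions\<close>

definition region_I :: "(real \<times> real) set" where "region_I = {(U, V). U > 0 \<and> V > 0}"
definition region_II :: "(real \<times> real) set" where "region_II = {(U, V). U < 0 \<and> V > 0}"
definition region_I' :: "(real \<times> real) set" where "region_I' = {(U, V). U < 0 \<and> V < 0}"

text \<open>The hypersurface \<open>t = f r\<close>, \<open>r \<in> D\<close>, in the region \<open>Q\<close>.\<close>

definition graph_in ::
    "real \<Rightarrow> (real \<times> real) set \<Rightarrow> real set \<Rightarrow> (real \<Rightarrow> real) \<Rightarrow> event set" where
  "graph_in M Q D f =
     {((U, V), \<omega>) \<in> kruskal M. (U, V) \<in> Q \<and> area_radius M U V \<in> D \<and>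
        killing_time M U V = f (area_radius M U V)}"

definition schw_h :: "real \<Rightarrow> real \<Rightarrow> real" where
  "schw_h M r = 1 - 2 * M / r"

definition l1 :: "real \<Rightarrow> real \<Rightarrow> real \<Rightarrow> real \<Rightarrow> real" where
  "l1 M H c r = 1 / sqrt (schw_h M r) * (H * r + c / r^2)"

definition l2 :: "real \<Rightarrow> real \<Rightarrow> real \<Rightarrow> real \<Rightarrow> real" where
  "l2 M H c r = 1 / sqrt (- schw_h M r) * (- H * r - c / r^2)"

definition l3 :: "real \<Rightarrow> real \<Rightarrow> real \<Rightarrow> real \<Rightarrow> real" where
  "l3 M H c r = - l1 M H c r"

definition f1 :: "real \<Rightarrow> real \<Rightarrow> real \<Rightarrow> real \<Rightarrow> real \<Rightarrow> real \<Rightarrow> real" where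
  "f1 M H r1 c cb r =
     (LBINT x=r1..r. l1 M H c x / schw_h M x * (1 / sqrt (1 + (l1 M H c x)^2))) + cb"

definition f3 :: "real \<Rightarrow> real \<Rightarrow> real \<Rightarrow> real \<Rightarrow> real \<Rightarrow> real \<Rightarrow> real" where
  "f3 M H r3 c cb r =
     (LBINT x=r3..r. l3 M H c x / schw_h M x * (1 / sqrt (1 + (l3 M H c x)^2))) + cb"

definition f2_integrand :: "real \<Rightarrow> real \<Rightarrow> real \<Rightarrow> real \<Rightarrow> real" where
  "f2_integrand M H c x =
     1 / (- schw_h M x) * sqrt ((l2 M H c x)^2 / ((l2 M H c x)^2 - 1))"

definition f2s :: "real \<Rightarrow> real \<Rightarrow> real \<Rightarrow> real \<Rightarrow> real \<Rightarrow> real \<Rightarrow> real" where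
  "f2s M H r2 c cb r = (LBINT x=r2..r. f2_integrand M H c x) + cb"

definition f2ss :: "real \<Rightarrow> real \<Rightarrow> real \<Rightarrow> real \<Rightarrow> real \<Rightarrow> real \<Rightarrow> real" where
  "f2ss M H r2' c cb' r =
     (LBINT x=r2'..r. 1 / schw_h M x * sqrt ((l2 M H c x)^2 / ((l2 M H c x)^2 - 1))) + cb'"

definition k_fun :: "real \<Rightarrow> real \<Rightarrow> real \<Rightarrow> real" where
  "k_fun M H r = - H * r^3 - r powr (3/2) * (2 * M - r) powr (1/2)"

definition r_min :: "real \<Rightarrow> real \<Rightarrow> real" where
  "r_min M H = (THE r. is_arg_min (k_fun M H) (\<lambda>x. x \<in> {0<..<2 * M}) r)"

definition c_min :: "real \<Rightarrow> real \<Rightarrow> real" where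
  "c_min M H = k_fun M H (r_min M H)"

text \<open>The radii at which the integrals defining \<open>f2s\<close> and \<open>f2ss\<close> make sense: those with
  \<open>l2 > 1\<close>, and those with \<open>k_fun = c\<close> up to which, starting from such radii, the integral is
  finite.\<close>

definition f2_domain :: "real \<Rightarrow> real \<Rightarrow> real \<Rightarrow> real set" where
  "f2_domain M H c =
     {r \<in> {0<..<2 * M}. l2 M H c r > 1 \<or>
        (k_fun M H r = c \<and>
          (\<exists>y\<in>{0<..<2 * M}. y \<noteq> r \<and> (\<forall>x\<in>open_segment y r. l2 M H c x > 1) \<and>
             interval_lebesgue_integrable lborel (ereal y) (ereal r) (f2_integrand M H c)))}"

text \<open>The relevant component is the one that reaches up to the horizon \<open>r = 2 M\<close>.\<close>

definition f2_component :: "real \<Rightarrow> real \<Rightarrow> real \<Rightarrow> real set" where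
  "f2_component M H c = {r \<in> f2_domain M H c. {r..<2 * M} \<subseteq> f2_domain M H c}"

definition r_turn :: "real \<Rightarrow> real \<Rightarrow> real \<Rightarrow> real" where
  "r_turn M H c = (THE r. k_fun M H r = c \<and> f2_component M H c = {r..<2 * M})"

definition Sigma1 :: "real \<Rightarrow> real \<Rightarrow> real \<Rightarrow> real \<Rightarrow> real \<Rightarrow> event set" where
  "Sigma1 M H r1 c cb = graph_in M region_I {2 * M<..} (f1 M H r1 c cb)"

text \<open>The base point \<open>r2\<close> only matters for \<open>c \<le> c_min M H\<close>.\<close>

definition Sigma2 :: "real \<Rightarrow> real \<Rightarrow> real \<Rightarrow> real \<Rightarrow> real \<Rightarrow> event set" where
  "Sigma2 M H r2 c cb =
     (if c \<le> c_min M H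
      then graph_in M region_II (f2_component M H c) (f2s M H r2 c cb)
      else graph_in M region_II (f2_component M H c) (f2s M H (r_turn M H c) c cb) \<union>
           graph_in M region_II (f2_component M H c) (f2ss M H (r_turn M H c) c cb))"

definition Sigma3 :: "real \<Rightarrow> real \<Rightarrow> real \<Rightarrow> real \<Rightarrow> real \<Rightarrow> event set" where
  "Sigma3 M H r3 c cb = graph_in M region_I' {2 * M<..} (f3 M H r3 c cb)"

end

theory Submission
  imports Defs
begin

text \<open>Parametrise a profile curve in the \<open>U\<close>-\<open>V\<close>-plane by proper length and let \<open>w\<close> be the derivative of the
  radius along it.  With \<open>a = H r + c / r\<^sup>2\<close> the equation of \<open>\<Sigma>\<close> becomes \<open>w\<^sup>2 = h + a\<^sup>2\<close>, the unit
  tangent \<open>(p, q)\<close> satisfies \<open>p V = 2 M (w - a) / g\<^sub>U\<^sub>V\<close> and \<open>q U = 2 M (w + a) / g\<^sub>U\<^sub>V\<close>, the unit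
  normal is \<open>(- p, q)\<close>, and the principal curvatures are \<open>H - 2 c / r\<^sup>3\<close> once and \<open>H + c / r\<^sup>3\<close>
  twice.  Since \<open>w - a > 0\<close> stays regular where \<open>U\<close> vanishes, and \<open>w + a < 0\<close> where \<open>V\<close> vanishes,
  the curve crosses the horizons smoothly.  Both \<open>U\<close> and \<open>V\<close> increase along the curve, so the whole
  hypersurface is a graph \<open>U = \<phi> V\<close>, \<open>V\<close> in an open interval, times the sphere.\<close>

section \<open>Smooth maps\<close>

text \<open>The heights \<open>f1\<close> and \<open>f2s\<close> cannot be matched directly: both
  blow up at the horizon, where the drift \<open>a\<close> is negative, which is what
  \<open>c < - 8 * M^3 * H\<close> says. So the curve is built first. Along proper length
  \<open>ln V\<close> has derivative \<open>1 / (4 * M * (w - a))\<close>, regular at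
  \<open>r = 2 * M\<close>, and one antiderivative serves both sides. Its constant is fixed by
  \<open>Sigma1\<close>; the heights are then recognised as the Killing time along the curve, whose
  values give the constants of \<open>Sigma2\<close> and \<open>Sigma3\<close>. The cases differ in
  the first zero of \<open>h + a^2\<close> met inwards from the horizon. For
  \<open>c < c_min\<close> there is none and the radius runs down to 0. For \<open>c = c_min\<close>
  the zero is at least double: \<open>w\<close> contains a factor \<open>r - r_H\<close>, the
  Killing time diverges logarithmically, and no limit point arises in the spacetime. For
  \<open>c > c_min\<close> it is simple: the height integral converges, \<open>w\<close> changes
  sign, and the curve runs outwards into region I'. Near this turning sphere the radius is no
  parameter, whence a second construction.\<close>

lemma differentiable_upto_cong:
  assumes "open S" "\<And>x. x \<in> S \<Longrightarrow> f x = g x" "differentiable_upto n S f"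
  shows "differentiable_upto n S g"
  using assms(2,3)
proof (induction n arbitrary: f g)
  case 0
  then show ?case by (simp cong: continuous_on_cong)
next
  case (Suc n)
  have *: "(g has_derivative frechet_derivative f (at x)) (at x)" if "x \<in> S" for x
    using has_derivative_transform_within_open[OF _ assms(1) that Suc.prems(1)]
      Suc.prems(2) that by (auto simp: frechet_derivative_works)
  have eq: "frechet_derivative g (at x) = frechet_derivative f (at x)" if "x \<in> S" for x
    using frechet_derivative_at[OF *[OF that]] by simp
  show ?case
    using * eq Suc.IH[of "\<lambda>x. frechet_derivative f (at x) v" "\<lambda>x. frechet_derivative g (at x) v" for v]
      Suc.prems(2) by (auto simp: differentiable_def)
qed

lemma smooth_on_cong:
  assumes "open S" "\<And>x. x \<in> S \<Longrightarrow> f x = g x" "smooth_on S f"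
  shows "smooth_on S g"
  using assms differentiable_upto_cong unfolding smooth_on_def by metis

lemma smooth_on_subset:
  assumes "smooth_on S f" "T \<subseteq> S"
  shows "smooth_on T f"
proof -
  have "differentiable_upto n S f \<Longrightarrow> differentiable_upto n T f" for n
    by (induction n arbitrary: f) (use assms(2) continuous_on_subset in auto)
  then show ?thesis
    using assms(1) by (auto simp: smooth_on_def)
qed

lemma smooth_on_const: "smooth_on S (\<lambda>_. c)"
proof -
  have "differentiable_upto n S (\<lambda>_. c)" for n
    by (induction n arbitrary: c) auto
  then show ?thesis
    by (auto simp: smooth_on_def)
qed

lemma smooth_on_bounded_linear:
  assumes "bounded_linear L"
  shows "smooth_on S L"
proof -
  have eq: "frechet_derivative L (at x) = L" for x
    using frechet_derivative_at[OF bounded_linear_imp_has_derivative[OF assms]] by simp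
  have "differentiable_upto n S L" for n
  proof (cases n)
    case 0
    then show ?thesis
      by (simp add: assms linear_continuous_on)
  next
    case (Suc m)
    then show ?thesis
      using smooth_on_const[of S] bounded_linear_imp_differentiable[OF assms]
      by (auto simp: eq smooth_on_def)
  qed
  then show ?thesis
    by (auto simp: smooth_on_def)
qed

lemma smooth_on_add:
  assumes "open S" "smooth_on S f" "smooth_on S g"
  shows "smooth_on S (\<lambda>x. f x + g x)"
proof -
  have "differentiable_upto n S f \<Longrightarrow> differentiable_upto n S g \<Longrightarrow>
      differentiable_upto n S (\<lambda>x. f x + g x)" for n
  proof (induction n arbitrary: f g)
    case 0
    then show ?case by (simp add: continuous_on_add)
  next
    case (Suc n)
    have *: "((\<lambda>x. f x + g x) has_derivative
        (\<lambda>v. frechet_derivative f (at x) v + frechet_derivative g (at x) v)) (at x)"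
      if "x \<in> S" for x
      using Suc.prems that has_derivative_add frechet_derivative_works
      by (metis differentiable_upto.simps(2))
    have eq: "frechet_derivative f (at x) v + frechet_derivative g (at x) v =
        frechet_derivative (\<lambda>x. f x + g x) (at x) v" if "x \<in> S" for x v
      by (rule fun_cong[OF frechet_derivative_at[OF *[OF that]]])
    have "differentiable_upto n S (\<lambda>x. frechet_derivative (\<lambda>x. f x + g x) (at x) v)" for v
    proof (rule differentiable_upto_cong[OF assms(1)])
      show "frechet_derivative f (at x) v + frechet_derivative g (at x) v =
          frechet_derivative (\<lambda>x. f x + g x) (at x) v" if "x \<in> S" for x
        by (rule eq[OF that])
      show "differentiable_upto n S
          (\<lambda>x. frechet_derivative f (at x) v + frechet_derivative g (at x) v)"
        by (rule Suc.IH) (use Suc.prems in simp_all)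
    qed
    then show ?case
      using Suc.prems by auto
  qed
  then show ?thesis
    using assms by (auto simp: smooth_on_def)
qed

lemma smooth_on_linear_compose:
  assumes "open S" "bounded_linear L" "smooth_on S f"
  shows "smooth_on S (\<lambda>x. L (f x))"
proof -
  have "differentiable_upto n S f \<Longrightarrow> differentiable_upto n S (\<lambda>x. L (f x))" for n
  proof (induction n arbitrary: f)
    case 0
    then show ?case by (simp add: assms(2) bounded_linear.continuous_on)
  next
    case (Suc n)
    have *: "((\<lambda>x. L (f x)) has_derivative (\<lambda>v. L (frechet_derivative f (at x) v))) (at x)"
      if "x \<in> S" for x
      using Suc.prems that bounded_linear.has_derivative[OF assms(2)]
      by (auto simp: frechet_derivative_works)
    have eq: "frechet_derivative (\<lambda>x. L (f x)) (at x) v = L (frechet_derivative f (at x) v)"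
      if "x \<in> S" for x v
      using frechet_derivative_at[OF *[OF that]] by (metis)
    have "differentiable_upto n S (\<lambda>x. frechet_derivative (\<lambda>x. L (f x)) (at x) v)" for v
      by (rule differentiable_upto_cong[OF assms(1) _ Suc.IH[of "\<lambda>x. frechet_derivative f (at x) v"]])
         (use eq Suc.prems in auto)
    then show ?case
      using * by (auto simp: differentiable_def)
  qed
  then show ?thesis
    using assms by (auto simp: smooth_on_def)
qed

text \<open>The derivative of \<open>f (L x)\<close> in direction \<open>v\<close> is that of
  \<open>f\<close> in the fixed direction \<open>L v\<close>, so the induction stays within one
  shape. Here \<open>L\<close> is a coordinate projection, lifting functions of \<open>V\<close> to
  the chart.\<close>

lemma smooth_on_compose_linear:
  assumes "open S" "bounded_linear L" "smooth_on S f"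
  shows "smooth_on (L -` S) (\<lambda>x. f (L x))"
proof -
  have cont: "continuous_on UNIV L"
    by (simp add: assms(2) linear_continuous_on)
  then have op: "open (L -` S)"
    using assms(1) by (simp add: open_vimage)
  have "differentiable_upto n S f \<Longrightarrow> differentiable_upto n (L -` S) (\<lambda>x. f (L x))" for n
  proof (induction n arbitrary: f)
    case 0
    then show ?case
      by (auto intro!: continuous_on_compose2[of S f "L -` S" L] continuous_on_subset[OF cont])
  next
    case (Suc n)
    have *: "((\<lambda>x. f (L x)) has_derivative (\<lambda>v. frechet_derivative f (at (L x)) (L v))) (at x)"
      if "L x \<in> S" for x
    proof (rule has_derivative_compose[OF bounded_linear_imp_has_derivative[OF assms(2)]])
      show "(f has_derivative frechet_derivative f (at (L x))) (at (L x))"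
        using Suc.prems that frechet_derivative_works by auto
    qed
    have eq: "frechet_derivative (\<lambda>x. f (L x)) (at x) v = frechet_derivative f (at (L x)) (L v)"
      if "L x \<in> S" for x v
      using frechet_derivative_at[OF *[OF that]] by metis
    have "differentiable_upto n (L -` S) (\<lambda>x. frechet_derivative (\<lambda>x. f (L x)) (at x) v)" for v
      by (rule differentiable_upto_cong[OF op _ Suc.IH[of "\<lambda>x. frechet_derivative f (at x) (L v)"]])
         (use eq Suc.prems in auto)
    then show ?case
      using * by (auto simp: differentiable_def)
  qed
  then show ?thesis
    using assms by (auto simp: smooth_on_def)
qed

text \<open>The algebra of functions generated by \<open>X\<close>. There is no division:
  reciprocals enter as generators of their own, since the derivative of \<open>1 / r\<close> is
  again a polynomial in \<open>1 / r\<close> and the derivative of \<open>r\<close>.\<close>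

inductive_set polys :: "(real \<Rightarrow> real) set \<Rightarrow> (real \<Rightarrow> real) set" for X where
  gen: "f \<in> X \<Longrightarrow> f \<in> polys X"
| const: "(\<lambda>_. c) \<in> polys X"
| add: "f \<in> polys X \<Longrightarrow> g \<in> polys X \<Longrightarrow> (\<lambda>x. f x + g x) \<in> polys X"
| mult: "f \<in> polys X \<Longrightarrow> g \<in> polys X \<Longrightarrow> (\<lambda>x. f x * g x) \<in> polys X"

lemma polys_uminus: "f \<in> polys X \<Longrightarrow> (\<lambda>x. - f x) \<in> polys X"
  using polys.mult[OF polys.const[of "-1"], of f] by simp

lemma polys_diff: "f \<in> polys X \<Longrightarrow> g \<in> polys X \<Longrightarrow> (\<lambda>x. f x - g x) \<in> polys X"
  using polys.add[of f X "\<lambda>x. - g x"] by (simp add: polys_uminus)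

lemma polys_power: "f \<in> polys X \<Longrightarrow> (\<lambda>x. f x ^ n) \<in> polys X"
  by (induction n) (auto intro: polys.intros)

lemmas polys_rules = polys.const polys.add polys.mult polys_uminus polys_diff polys_power

text \<open>Replaces the smooth dependence of solutions of ordinary differential equations: the
  functions on the hypersurface solve a polynomial autonomous system.\<close>

lemma smooth_on_polys:
  assumes I: "open I"
    and X: "\<And>f. f \<in> X \<Longrightarrow> \<exists>g\<in>polys X. \<forall>v\<in>I. (f has_real_derivative g v) (at v)"
    and f: "f \<in> polys X"
  shows "smooth_on I f"
proof -
  have D: "\<exists>g\<in>polys X. \<forall>v\<in>I. (f has_real_derivative g v) (at v)" if "f \<in> polys X" for f
    using that
  proof induction
    case (gen f)
    then show ?case by (rule X)
  next
    case (const c)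
    then show ?case
      by (rule bexI[of _ "\<lambda>_. 0"]) (auto intro: polys.const)
  next
    case (add f g)
    then obtain f' g' where "f' \<in> polys X" "g' \<in> polys X"
      "\<forall>v\<in>I. (f has_real_derivative f' v) (at v)" "\<forall>v\<in>I. (g has_real_derivative g' v) (at v)"
      by blast
    then show ?case
      by (intro bexI[of _ "\<lambda>x. f' x + g' x"]) (auto intro!: polys.add DERIV_add)
  next
    case (mult f g)
    then obtain f' g' where "f' \<in> polys X" "g' \<in> polys X"
      "\<forall>v\<in>I. (f has_real_derivative f' v) (at v)" "\<forall>v\<in>I. (g has_real_derivative g' v) (at v)"
      by blast
    then show ?case
      using mult
      by (intro bexI[of _ "\<lambda>x. f' x * g x + g' x * f x"])
         (auto intro!: polys.add polys.mult DERIV_mult)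
  qed
  have "differentiable_upto n I f" if "f \<in> polys X" for n f
    using that
  proof (induction n arbitrary: f)
    case 0
    then show ?case
      using D by (metis DERIV_isCont continuous_at_imp_continuous_on differentiable_upto.simps(1))
  next
    case (Suc n)
    obtain g where g: "g \<in> polys X" "\<And>v. v \<in> I \<Longrightarrow> (f has_real_derivative g v) (at v)"
      using D Suc.prems by blast
    have eq: "g v * u = frechet_derivative f (at v) u" if "v \<in> I" for u v
      using frechet_derivative_at[OF g(2)[OF that, unfolded has_field_derivative_def]] by metis
    \<comment> \<open>In a fixed direction \<open>u\<close> the derivative is
      \<open>g v * u\<close>, again a member of the algebra, so the induction hypothesis applies to
      it.\<close>
    have "differentiable_upto n I (\<lambda>v. frechet_derivative f (at v) u)" for u
      by (rule differentiable_upto_cong[OF I eq Suc.IH])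
         (auto intro: polys.mult polys.const g)
    moreover have "f differentiable at v" if "v \<in> I" for v
      using g(2)[OF that] unfolding has_field_derivative_def differentiable_def by blast
    ultimately show ?case
      by simp
  qed
  then show ?thesis
    using f by (simp add: smooth_on_def)
qed

section \<open>The area radius\<close>

definition psi :: "real \<Rightarrow> real \<Rightarrow> real" where
  "psi M r = (r - 2 * M) * exp (r / (2 * M))"

text \<open>The coefficient \<open>g\<^sub>U\<^sub>V\<close> of the metric.\<close>

definition conf :: "real \<Rightarrow> real \<Rightarrow> real" where
  "conf M r = 8 * M^2 * exp (- r / (2 * M)) / r"

lemma conf_pos: "M > 0 \<Longrightarrow> r > 0 \<Longrightarrow> conf M r > 0"
  by (simp add: conf_def)

lemma conf_nonzero: "M > 0 \<Longrightarrow> r > 0 \<Longrightarrow> conf M r \<noteq> 0"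
  by (simp add: conf_def)

text \<open>Links the metric coefficient to \<open>h\<close> and removes the exponentials: on a
  point of radius \<open>r\<close> it reads \<open>g_UV * U * V = 8 * M^2 * h\<close>.\<close>

lemma conf_psi: "M > 0 \<Longrightarrow> r > 0 \<Longrightarrow> conf M r * psi M r = 8 * M^2 * schw_h M r"
  by (simp add: conf_def psi_def schw_h_def exp_minus field_simps)

lemma conf_deriv:
  assumes "M > 0" "r > 0"
  shows "(conf M has_real_derivative - (1 / (2 * M) + 1 / r) * conf M r) (at r)"
  unfolding conf_def
  by (rule derivative_eq_intros refl | use assms in \<open>simp; fail\<close>)+
     (use assms in \<open>simp add: field_simps power2_eq_square\<close>)

lemma psi_deriv:
  assumes "M > 0" "r > 0"
  shows "(psi M has_real_derivative 4 * M / conf M r) (at r)"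
  unfolding psi_def conf_def
  by (rule derivative_eq_intros refl | use assms in \<open>simp; fail\<close>)+
     (use assms in \<open>simp add: exp_minus field_simps power2_eq_square\<close>)

lemma psi_continuous: "continuous_on S (psi M)"
  unfolding psi_def by (cases "M = 0") (auto intro!: continuous_intros)

text \<open>The derivative is known to be positive only inside the interval, so that
  \<open>r = 0\<close> is allowed; the value \<open>psi M 0 = - 2 * M\<close> then gives the bound
  defining the Kruskal domain.\<close>

lemma psi_strict_mono:
  assumes "M > 0" "0 \<le> r" "r < s"
  shows "psi M r < psi M s"
proof (rule DERIV_pos_imp_increasing_open[OF assms(3)])
  show "\<exists>y. (psi M has_real_derivative y) (at x) \<and> y > 0" if "r < x" "x < s" for x
    using psi_deriv[of M x] conf_pos[of M x] assms that by force
qed (rule psi_continuous)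

lemma psi_bound: "M > 0 \<Longrightarrow> r > 0 \<Longrightarrow> psi M r > - 2 * M"
  using psi_strict_mono[of M 0 r] by (simp add: psi_def)

lemma area_radius_unique:
  assumes "M > 0" "r > 0" "psi M r = U * V"
  shows "area_radius M U V = r"
  unfolding area_radius_def
proof (rule the_equality)
  fix s assume s: "s > 0 \<and> (s - 2 * M) * exp (s / (2 * M)) = U * V"
  then have "psi M s = psi M r"
    using assms by (simp add: psi_def)
  then show "s = r"
    using psi_strict_mono[of M r s] psi_strict_mono[of M s r] assms s
    by (metis less_imp_le linorder_neqE_linordered_idom order_less_irrefl)
qed (use assms in \<open>auto simp: psi_def\<close>)

lemma psi_surj:
  assumes "M > 0" "t > - 2 * M"
  obtains r where "r > 0" "psi M r = t"
proof -
  \<comment> \<open>At this radius the first factor of \<open>psi\<close> is the absolute value of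
    \<open>t\<close> and the exponential is at least 1, which makes it an upper end for the
    intermediate value theorem.\<close>
  define s where "s = 2 * M + \<bar>t\<bar>"
  have "1 \<le> exp (s / (2 * M))"
    using assms by (simp add: s_def)
  then have "\<bar>t\<bar> * 1 \<le> psi M s"
    unfolding psi_def s_def by (intro mult_mono) auto
  then have "t \<le> psi M s"
    by simp
  moreover have "psi M 0 \<le> t"
    using assms by (simp add: psi_def)
  moreover have "0 \<le> s"
    using assms by (simp add: s_def)
  ultimately obtain r where "0 \<le> r" "r \<le> s" "psi M r = t"
    using IVT'[of "psi M" 0 t s] psi_continuous by blast
  moreover have "r \<noteq> 0"
    using \<open>psi M r = t\<close> assms by (auto simp: psi_def)
  ultimately show thesis
    using that[of r] by simp
qed

lemma area_radius:
  assumes "M > 0" "U * V > - 2 * M"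
  shows area_radius_pos: "area_radius M U V > 0"
    and psi_area_radius: "psi M (area_radius M U V) = U * V"
  using psi_surj[OF assms] area_radius_unique[OF assms(1)] by metis+

text \<open>Only the product \<open>U * V\<close> matters. Putting \<open>V = 1\<close> makes the
  area radius the inverse function of \<open>psi M\<close>, whose derivative is the reciprocal of
  \<open>4 * M / conf\<close>.\<close>

lemma area_radius_deriv:
  assumes "M > 0" "t > - 2 * M"
  shows "((\<lambda>t. area_radius M t 1) has_real_derivative
    conf M (area_radius M t 1) / (4 * M)) (at t)"
proof -
  define r where "r = area_radius M t 1"
  have r: "r > 0" "psi M r = t"
    using area_radius[of M t 1] assms by (auto simp: r_def)
  have c: "conf M r \<noteq> 0"
    using conf_nonzero assms r by blast
  have "((\<lambda>t. area_radius M t 1) has_derivative (*) (conf M r / (4 * M))) (at (psi M r))"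
  proof (rule has_derivative_inverse_strong[where S = "{0<..}" and f = "psi M" and f' = "(*) (4 * M / conf M r)"])
    show "(psi M has_derivative (*) (4 * M / conf M r)) (at r)"
      using psi_deriv[of M r] assms r by (simp add: has_field_derivative_def)
    show "(*) (4 * M / conf M r) \<circ> (*) (conf M r / (4 * M)) = id"
      using c assms by auto
    show "area_radius M (psi M x) 1 = x" if "x \<in> {0<..}" for x
      using area_radius_unique[of M x "psi M x" 1] that assms by simp
  qed (use r psi_continuous in auto)
  then show ?thesis
    using r by (simp add: has_field_derivative_def r_def)
qed

lemma area_radius_conv: "area_radius M U V = area_radius M (U * V) 1"
  by (simp add: area_radius_def)

section \<open>Mean curvature of rotationally symmetric graphs\<close>

lemma vector_4:
  "(vector [a, b, c, d] :: 'a::zero^4) $ 1 = a"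
  "(vector [a, b, c, d] :: 'a::zero^4) $ 2 = b"
  "(vector [a, b, c, d] :: 'a::zero^4) $ 3 = c"
  "(vector [a, b, c, d] :: 'a::zero^4) $ 4 = d"
  unfolding vector_def by simp_all

lemma kruskal_metric_nth:
  fixes x :: "real^4" and M :: real
  defines "r \<equiv> area_radius M (x $ 1) (x $ 2)"
  shows "kruskal_metric M x $ 1 $ 1 = 0" "kruskal_metric M x $ 1 $ 2 = conf M r"
    "kruskal_metric M x $ 1 $ 3 = 0" "kruskal_metric M x $ 1 $ 4 = 0"
    "kruskal_metric M x $ 2 $ 1 = conf M r" "kruskal_metric M x $ 2 $ 2 = 0"
    "kruskal_metric M x $ 2 $ 3 = 0" "kruskal_metric M x $ 2 $ 4 = 0"
    "kruskal_metric M x $ 3 $ 1 = 0" "kruskal_metric M x $ 3 $ 2 = 0"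
    "kruskal_metric M x $ 3 $ 3 = r^2" "kruskal_metric M x $ 3 $ 4 = 0"
    "kruskal_metric M x $ 4 $ 1 = 0" "kruskal_metric M x $ 4 $ 2 = 0"
    "kruskal_metric M x $ 4 $ 3 = 0" "kruskal_metric M x $ 4 $ 4 = r^2 * (sin (x $ 3))^2"
  by (simp_all add: kruskal_metric_def Let_def vector_4 conf_def r_def)

lemma metric_inner_kruskal:
  "metric_inner (kruskal_metric M) x v w =
    conf M (area_radius M (x $ 1) (x $ 2)) * (v $ 1 * w $ 2 + v $ 2 * w $ 1) +
    (area_radius M (x $ 1) (x $ 2))^2 * (v $ 3 * w $ 3 + (sin (x $ 3))^2 * (v $ 4 * w $ 4))"
  by (simp add: metric_inner_def inner_vec_def matrix_vector_mult_def sum_4 kruskal_metric_nth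
      algebra_simps)

lemma invertible_kruskal_metric:
  assumes "M > 0" "x \<in> chart_domain M"
  shows "invertible (kruskal_metric M x)"
proof -
  define r where "r = area_radius M (x $ 1) (x $ 2)"
  have "r > 0"
    using assms area_radius_pos by (auto simp: r_def chart_domain_def)
  moreover from this have "conf M r \<noteq> 0"
    using assms(1) conf_nonzero by blast
  moreover have "sin (x $ 3) \<noteq> 0"
    using assms(2) sin_gt_zero[of "x $ 3"] by (auto simp: chart_domain_def)
  ultimately have nz: "r \<noteq> 0" "conf M r \<noteq> 0" "sin (x $ 3) \<noteq> 0"
    by auto
  define B :: "real^4^4" where "B = vector [vector [0, 1 / conf M r, 0, 0],
    vector [1 / conf M r, 0, 0, 0], vector [0, 0, 1 / r^2, 0],
    vector [0, 0, 0, 1 / (r^2 * (sin (x $ 3))^2)]]"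
  have "kruskal_metric M x ** B = mat 1"
    using nz by (simp add: vec_eq_iff forall_4 matrix_matrix_mult_def sum_4 kruskal_metric_nth
        B_def vector_4 mat_def flip: r_def)
  then show ?thesis
    using invertible_right_inverse by blast
qed

text \<open>Contracting with the same vector on both sides, the antisymmetric part of the Christoffel
  symbols of the first kind drops out.\<close>

lemma metric_inner_covariant_derivative:
  fixes g :: "real^4 \<Rightarrow> real^4^4"
  assumes sym: "\<And>i j. g p $ i $ j = g p $ j $ i" and inv: "invertible (g p)"
  shows "metric_inner g p (covariant_derivative g p v N) v =
    metric_inner g p (frechet_derivative N (at p) v) v +
    (1/2) * (\<Sum>j\<in>UNIV. \<Sum>l\<in>UNIV. \<Sum>i\<in>UNIV.
      partial j (\<lambda>x. g x $ l $ i) p * v $ l * v $ i * N p $ j)"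
proof -
  define D where "D i l j = partial i (\<lambda>x. g x $ l $ j) p" for i l j
  define T where "T l i j = D i l j + D j l i - D l i j" for l i j
  define n where "n = N p"
  have "matrix_inv (g p) ** g p = mat 1 \<and> g p ** matrix_inv (g p) = mat 1"
    using inv unfolding invertible_def matrix_inv_def by (metis (mono_tags, lifting) someI_ex)
  then have gi: "(\<Sum>k\<in>UNIV. g p $ l $ k * matrix_inv (g p) $ k $ m) = (if l = m then 1 else 0)" for l m
    unfolding matrix_matrix_mult_def vec_eq_iff mat_def by auto
  \<comment> \<open>Lowering the index cancels \<open>matrix_inv\<close> against the metric and
    leaves the Christoffel symbols of the first kind.\<close>
  have low: "(\<Sum>k\<in>UNIV. g p $ l $ k * christoffel g p k i j) = T l i j / 2" for l i j
  proof -
    have "(\<Sum>k\<in>UNIV. g p $ l $ k * christoffel g p k i j) =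
        (\<Sum>k\<in>UNIV. \<Sum>m\<in>UNIV. (g p $ l $ k * matrix_inv (g p) $ k $ m) * (T m i j / 2))"
      unfolding christoffel_def T_def D_def by (simp add: sum_distrib_left sum_distrib_right sum_divide_distrib mult.assoc)
    also have "\<dots> = (\<Sum>m\<in>UNIV. (\<Sum>k\<in>UNIV. g p $ l $ k * matrix_inv (g p) $ k $ m) * (T m i j / 2))"
      by (subst sum.swap) (simp only: sum_distrib_right)
    also have "\<dots> = T l i j / 2"
      unfolding gi by (simp only: mult_if_delta) simp
    finally show ?thesis .
  qed
  have mi: "metric_inner g p X v = (\<Sum>l\<in>UNIV. v $ l * (\<Sum>k\<in>UNIV. g p $ l $ k * X $ k))" for X
  proof -
    have "metric_inner g p X v = (\<Sum>k\<in>UNIV. \<Sum>l\<in>UNIV. v $ l * (g p $ l $ k * X $ k))"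
      unfolding metric_inner_def inner_vec_def matrix_vector_mult_def
      using sym by (simp add: sum_distrib_left mult_ac)
    also have "\<dots> = (\<Sum>l\<in>UNIV. v $ l * (\<Sum>k\<in>UNIV. g p $ l $ k * X $ k))"
      by (subst sum.swap) (simp add: sum_distrib_left)
    finally show ?thesis .
  qed
  define G where "G = (\<chi> k. \<Sum>i\<in>UNIV. \<Sum>j\<in>UNIV. christoffel g p k i j * v $ i * n $ j)"
  have "covariant_derivative g p v N = frechet_derivative N (at p) v + G"
    by (simp add: covariant_derivative_def G_def n_def vec_eq_iff)
  then have split: "metric_inner g p (covariant_derivative g p v N) v =
      metric_inner g p (frechet_derivative N (at p) v) v + metric_inner g p G v"
    by (simp add: metric_inner_def inner_add_left)
  have "(\<Sum>k\<in>UNIV. g p $ l $ k * G $ k) = (\<Sum>i\<in>UNIV. \<Sum>j\<in>UNIV. T l i j / 2 * v $ i * n $ j)" for l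
  proof -
    have "(\<Sum>k\<in>UNIV. g p $ l $ k * G $ k) =
        (\<Sum>k\<in>UNIV. \<Sum>i\<in>UNIV. \<Sum>j\<in>UNIV. g p $ l $ k * christoffel g p k i j * v $ i * n $ j)"
      by (simp add: G_def sum_distrib_left mult_ac)
    also have "\<dots> = (\<Sum>i\<in>UNIV. \<Sum>j\<in>UNIV. \<Sum>k\<in>UNIV. g p $ l $ k * christoffel g p k i j * v $ i * n $ j)"
      by (subst sum.swap, rule sum.cong[OF refl], subst sum.swap, rule refl)
    also have "\<dots> = (\<Sum>i\<in>UNIV. \<Sum>j\<in>UNIV. T l i j / 2 * v $ i * n $ j)"
      unfolding low[symmetric] by (simp add: sum_distrib_right)
    finally show ?thesis .
  qed
  then have "metric_inner g p G v =
      (\<Sum>l\<in>UNIV. \<Sum>i\<in>UNIV. \<Sum>j\<in>UNIV. T l i j / 2 * v $ l * v $ i * n $ j)"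
    unfolding mi by (simp add: sum_distrib_left mult_ac)
  also have "\<dots> = (1/2) * ((\<Sum>l\<in>UNIV. \<Sum>i\<in>UNIV. \<Sum>j\<in>UNIV. D i l j * v $ l * v $ i * n $ j)
      + (\<Sum>l\<in>UNIV. \<Sum>i\<in>UNIV. \<Sum>j\<in>UNIV. D j l i * v $ l * v $ i * n $ j)
      - (\<Sum>l\<in>UNIV. \<Sum>i\<in>UNIV. \<Sum>j\<in>UNIV. D l i j * v $ l * v $ i * n $ j))"
    unfolding sum.distrib[symmetric] sum_subtractf[symmetric] sum_distrib_left
    by (intro sum.cong refl) (simp add: T_def field_simps)
  \<comment> \<open>Exchanging \<open>l\<close> and \<open>i\<close>, which both carry
    \<open>v\<close>, identifies the first sum with the third, so only the derivatives along
    \<open>n\<close> survive.\<close>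
  also have "(\<Sum>l\<in>UNIV. \<Sum>i\<in>UNIV. \<Sum>j\<in>UNIV. D i l j * v $ l * v $ i * n $ j) =
      (\<Sum>l\<in>UNIV. \<Sum>i\<in>UNIV. \<Sum>j\<in>UNIV. D l i j * v $ l * v $ i * n $ j)"
    by (subst sum.swap) (simp add: mult_ac)
  also have "(\<Sum>l\<in>UNIV. \<Sum>i\<in>UNIV. \<Sum>j\<in>UNIV. D j l i * v $ l * v $ i * n $ j) =
      (\<Sum>j\<in>UNIV. \<Sum>l\<in>UNIV. \<Sum>i\<in>UNIV. D j l i * v $ l * v $ i * n $ j)"
  proof -
    have "(\<Sum>l\<in>UNIV. \<Sum>i\<in>UNIV. \<Sum>j\<in>UNIV. D j l i * v $ l * v $ i * n $ j) =
        (\<Sum>l\<in>UNIV. \<Sum>j\<in>UNIV. \<Sum>i\<in>UNIV. D j l i * v $ l * v $ i * n $ j)"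
      by (rule sum.cong[OF refl], rule sum.swap)
    also have "\<dots> = (\<Sum>j\<in>UNIV. \<Sum>l\<in>UNIV. \<Sum>i\<in>UNIV. D j l i * v $ l * v $ i * n $ j)"
      by (rule sum.swap)
    finally show ?thesis .
  qed
  finally show ?thesis
    unfolding split by (simp add: n_def D_def)
qed

lemma has_derivative_nth: "((\<lambda>x::real^4. x $ i) has_derivative (\<lambda>v. v $ i)) (at p)"
  by (rule bounded_linear_imp_has_derivative[OF bounded_linear_vec_nth])

lemma partial_eq: "(f has_derivative f') (at p) \<Longrightarrow> partial i f p = f' (axis i 1)"
  unfolding partial_def using frechet_derivative_at by metis

lemma partial_const: "partial i (\<lambda>x. k) p = 0"
  using partial_eq[OF has_derivative_const] .

lemma area_radius_has_derivative:
  fixes p :: "real^4"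
  assumes "M > 0" "p $ 1 * p $ 2 > - 2 * M"
  defines "r \<equiv> area_radius M (p $ 1) (p $ 2)"
  shows "((\<lambda>x. area_radius M (x $ 1) (x $ 2)) has_derivative
    (\<lambda>v. conf M r / (4 * M) * (p $ 1 * v $ 2 + p $ 2 * v $ 1))) (at p)"
proof -
  have "((\<lambda>x. x $ 1 * x $ 2) has_derivative (\<lambda>v. p $ 1 * v $ 2 + v $ 1 * p $ 2)) (at p)"
    by (rule has_derivative_mult[OF has_derivative_nth has_derivative_nth])
  from DERIV_compose_FDERIV[OF area_radius_deriv[OF assms(1,2)] this]
  show ?thesis
    unfolding r_def area_radius_conv[of M "_ $ 1"] by (simp add: mult.commute)
qed

text \<open>The sum is the derivative along \<open>n\<close> of
  \<open>2 * conf * v1 * v2 + r^2 * (...)\<close> with the components of \<open>v\<close> frozen. As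
  \<open>n\<close> has no angular part, the derivative of the sine drops out and everything depends
  on \<open>dr\<close>, the derivative of the radius along \<open>n\<close>.\<close>

lemma kruskal_metric_derivative_term:
  fixes p v n :: "real^4" and M :: real
  defines "r \<equiv> area_radius M (p $ 1) (p $ 2)"
  defines "dr \<equiv> conf M r / (4 * M) * (p $ 1 * n $ 2 + p $ 2 * n $ 1)"
  assumes M: "M > 0" and p: "p \<in> chart_domain M" and n: "n $ 3 = 0" "n $ 4 = 0"
  shows "(\<Sum>j\<in>UNIV. \<Sum>l\<in>UNIV. \<Sum>i\<in>UNIV.
      partial j (\<lambda>x. kruskal_metric M x $ l $ i) p * v $ l * v $ i * n $ j) =
    - 2 * (1 / (2 * M) + 1 / r) * conf M r * dr * v $ 1 * v $ 2 +
    2 * r * dr * ((v $ 3)^2 + (sin (p $ 3))^2 * (v $ 4)^2)"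
proof -
  define R where "R x = area_radius M (x $ 1) (x $ 2)" for x :: "real^4"
  have UV: "p $ 1 * p $ 2 > - 2 * M"
    using p by (simp add: chart_domain_def)
  have r: "r > 0" "R p = r"
    using area_radius_pos[OF M UV] by (auto simp: r_def R_def)
  define D where "D v = conf M r / (4 * M) * (p $ 1 * v $ 2 + p $ 2 * v $ 1)" for v :: "real^4"
  have dR: "(R has_derivative D) (at p)"
    unfolding R_def D_def r_def by (rule area_radius_has_derivative[OF M UV])
  have "((\<lambda>x. conf M (R x)) has_derivative (\<lambda>v. D v * (- (1 / (2 * M) + 1 / r) * conf M r))) (at p)"
    using DERIV_compose_FDERIV[OF _ dR] conf_deriv[OF M r(1)] r(2) by metis
  then have c: "partial j (\<lambda>x. conf M (R x)) p = D (axis j 1) * (- (1 / (2 * M) + 1 / r) * conf M r)" for j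
    by (rule partial_eq)
  have dR2: "((\<lambda>x. (R x)^2) has_derivative (\<lambda>v. 2 * r * D v)) (at p)"
    by (rule derivative_eq_intros dR refl)+ (simp add: r mult_ac)
  then have c2: "partial j (\<lambda>x. (R x)^2) p = 2 * r * D (axis j 1)" for j
    by (rule partial_eq)
  have "((\<lambda>x. (R x)^2 * (sin (x $ 3))^2) has_derivative
      (\<lambda>v. r^2 * (2 * sin (p $ 3) * (v $ 3 * cos (p $ 3))) + 2 * r * D v * (sin (p $ 3))^2)) (at p)"
    by (rule derivative_eq_intros dR2 has_derivative_nth refl)+ (simp add: r mult_ac)
  then have c3: "partial j (\<lambda>x. (R x)^2 * (sin (x $ 3))^2) p =
      r^2 * (2 * sin (p $ 3) * (axis j 1 $ 3 * cos (p $ 3))) + 2 * r * D (axis j 1) * (sin (p $ 3))^2" for j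
    by (rule partial_eq)
  have D: "D (axis 1 1) = conf M r / (4 * M) * p $ 2" "D (axis 2 1) = conf M r / (4 * M) * p $ 1"
    by (simp_all add: D_def axis_def)
  have ax: "axis 1 (1::real) $ (3::4) = 0" "axis 2 (1::real) $ (3::4) = 0"
    by (simp_all add: axis_def)
  have dr: "dr = D (axis 1 1) * n $ 1 + D (axis 2 1) * n $ 2"
    unfolding D dr_def by (simp add: algebra_simps)
  show ?thesis
    unfolding sum_4 kruskal_metric_nth partial_const R_def[symmetric] c c2 c3 n ax dr
    by (simp add: algebra_simps power2_eq_square)
qed

lemma norm_rotation_matrix_mult:
  fixes R :: "real^'n^'n"
  assumes "rotation_matrix R"
  shows "norm (R *v x) = norm x"
proof -
  have "orthogonal_transformation ((*v) R)"
    using assms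
    by (simp add: rotation_matrix_def orthogonal_transformation_matrix)
  then show ?thesis
    by (simp add: orthogonal_transformation)
qed

text \<open>A right inverse of a square matrix is also a left inverse. Summing over a frame
  therefore gives traces that do not depend on the frame.\<close>

lemma orthonormal_rows_columns:
  fixes E :: "real^3^3"
  assumes "\<And>i j. (\<Sum>k\<in>UNIV. E $ i $ k * E $ j $ k) = (if i = j then 1 else 0)"
  shows "(\<Sum>i\<in>UNIV. E $ i $ k * E $ i $ l) = (if k = l then 1 else 0)"
proof -
  have "E ** transpose E = mat 1"
    using assms by (simp add: vec_eq_iff matrix_matrix_mult_def transpose_def mat_def)
  then have "transpose E ** E = mat 1"
    using matrix_left_right_inverse by blast
  then show ?thesis
    by (simp add: vec_eq_iff matrix_matrix_mult_def transpose_def mat_def)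
qed

definition tube :: "(real \<Rightarrow> real) \<Rightarrow> real set \<Rightarrow> event set" where
  "tube \<phi> I = {((\<phi> v, v), \<omega>) |v \<omega>. v \<in> I \<and> \<omega> \<in> sphere 0 1}"

text \<open>The hypersurface \<open>U = \<phi> V\<close> with unit tangent \<open>(p, q)\<close> in the \<open>U\<close>-\<open>V\<close>-plane, hence unit
  normal \<open>(- p, q)\<close>.  The last two assumptions say that the normal derivative of \<open>r\<close> is
  \<open>H r + c / r\<^sup>2\<close> and that the curvature of the profile curve is the derivative of this.\<close>

locale profile =
  fixes M H c :: real and I :: "real set" and \<phi> p q r :: "real \<Rightarrow> real"
  assumes M: "M > 0" and I: "open I"
    and r_pos: "v \<in> I \<Longrightarrow> r v > 0"
    and UV: "v \<in> I \<Longrightarrow> \<phi> v * v = psi M (r v)"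
    and p_pos: "v \<in> I \<Longrightarrow> p v > 0" and q_pos: "v \<in> I \<Longrightarrow> q v > 0"
    and unit: "v \<in> I \<Longrightarrow> 2 * conf M (r v) * p v * q v = 1"
    and d\<phi>: "v \<in> I \<Longrightarrow> (\<phi> has_real_derivative p v / q v) (at v)"
    and dr: "v \<in> I \<Longrightarrow> (r has_real_derivative
      conf M (r v) / (4 * M) * (p v * v + q v * \<phi> v) / q v) (at v)"
    and normal_r: "v \<in> I \<Longrightarrow>
      conf M (r v) / (4 * M) * (q v * \<phi> v - p v * v) = H * r v + c / (r v)^2"
    and dq: "v \<in> I \<Longrightarrow> (q has_real_derivative H - 2 * c / (r v)^3 +
      (1 / (2 * M) + 1 / r v) * (conf M (r v) / (4 * M)) * \<phi> v * q v) (at v)"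
begin

lemma profile_subset: "open J \<Longrightarrow> J \<subseteq> I \<Longrightarrow> profile M H c J \<phi> p q r"
  using r_pos UV p_pos q_pos unit d\<phi> dr normal_r dq M by unfold_locales blast+

lemma p_eq: "v \<in> I \<Longrightarrow> p v = 1 / (2 * conf M (r v) * q v)"
  using unit[of v] q_pos[of v] conf_pos[OF M r_pos[of v]] by (simp add: field_simps)

lemma dA:
  assumes "v \<in> I"
  shows "((\<lambda>v. conf M (r v)) has_real_derivative - (1 / (2 * M) + 1 / r v) * conf M (r v) *
    (conf M (r v) / (4 * M) * (p v * v + q v * \<phi> v) / q v)) (at v)"
  by (rule DERIV_chain2[OF conf_deriv[OF M r_pos[OF assms]] dr[OF assms]])

text \<open>The normalisation \<open>unit\<close> determines \<open>p\<close> by \<open>r\<close>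
  and \<open>q\<close>, so its derivative comes from \<open>dr\<close> and
  \<open>dq\<close>.\<close>

lemma dp:
  assumes "v \<in> I"
  shows "(p has_real_derivative p v * ((1 / (2 * M) + 1 / r v) *
    (conf M (r v) / (4 * M) * (p v * v + q v * \<phi> v) / q v) -
    (H - 2 * c / (r v)^3 + (1 / (2 * M) + 1 / r v) * (conf M (r v) / (4 * M)) * \<phi> v * q v) / q v)) (at v)"
    (is "(p has_real_derivative p v * (?Z * ?R - ?Q / q v)) (at v)")
proof -
  have nz: "conf M (r v) \<noteq> 0" "q v \<noteq> 0"
    using conf_nonzero[OF M r_pos[OF assms]] q_pos[OF assms] by auto
  have "((\<lambda>v. 1 / (2 * conf M (r v) * q v)) has_real_derivative
      (0 * (2 * conf M (r v) * q v) - 1 * (2 * (- ?Z * conf M (r v) * ?R) * q v + ?Q * (2 * conf M (r v)))) /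
      ((2 * conf M (r v) * q v) * (2 * conf M (r v) * q v))) (at v)"
    using nz by (intro DERIV_divide DERIV_mult DERIV_cmult DERIV_const dA dq assms) auto
  also have "(0 * (2 * conf M (r v) * q v) - 1 * (2 * (- ?Z * conf M (r v) * ?R) * q v + ?Q * (2 * conf M (r v)))) /
      ((2 * conf M (r v) * q v) * (2 * conf M (r v) * q v)) = p v * (?Z * ?R - ?Q / q v)"
    using nz unfolding p_eq[OF assms] by (simp add: divide_simps) (simp add: algebra_simps)
  finally show ?thesis
    by (rule has_field_derivative_transform_within_open[OF _ I assms]) (simp add: p_eq)
qed

lemma smooth: "smooth_on I \<phi>" "smooth_on I p" "smooth_on I q"
proof -
  define z where "z v = 1 / r v" for v
  define k where "k v = 1 / q v" for v
  define A where "A v = conf M (r v)" for v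
  \<comment> \<open>With \<open>1 / r\<close>, \<open>1 / q\<close> and the metric coefficient
    added, all derivatives are polynomials in the generators.\<close>
  define X where "X = {\<lambda>v. v, \<phi>, p, q, r, z, k, A}"
  have gens: "(\<lambda>v. v) \<in> polys X" "\<phi> \<in> polys X" "p \<in> polys X" "q \<in> polys X" "r \<in> polys X"
    "z \<in> polys X" "k \<in> polys X" "A \<in> polys X"
    by (auto intro!: polys.gen simp: X_def)
  define rr where "rr v = A v * (1 / (4 * M)) * (p v * v + q v * \<phi> v) * k v" for v
  define qq where "qq v = H - 2 * c * (z v)^3 + (1 / (2 * M) + z v) * (A v * (1 / (4 * M))) * \<phi> v * q v" for v
  define Z where "Z v = 1 / (2 * M) + z v" for v
  have mem: "rr \<in> polys X" "qq \<in> polys X" "Z \<in> polys X"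
    unfolding rr_def qq_def Z_def by (intro polys_rules gens[unfolded eta_contract_eq] | rule gens)+
  have drr: "(r has_real_derivative rr v) (at v)" if "v \<in> I" for v
    using dr[OF that] by (simp add: rr_def A_def k_def)
  have dqq: "(q has_real_derivative qq v) (at v)" if "v \<in> I" for v
    using dq[OF that] by (simp add: qq_def A_def z_def field_simps)
  have witness: "\<exists>g\<in>polys X. \<forall>v\<in>I. (f has_real_derivative g v) (at v)"
    if "g \<in> polys X" "\<And>v. v \<in> I \<Longrightarrow> (f has_real_derivative g v) (at v)" for f g
    using that by blast
  have ex: "\<exists>g\<in>polys X. \<forall>v\<in>I. (f has_real_derivative g v) (at v)" if "f \<in> X" for f
  proof -
    consider "f = (\<lambda>v. v)" | "f = \<phi>" | "f = p" | "f = q" | "f = r" | "f = z" | "f = k" | "f = A"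
      using \<open>f \<in> X\<close> by (auto simp: X_def)
    then show ?thesis
    proof cases
      case 1
      then show ?thesis
        by (intro bexI[of _ "\<lambda>_. 1"]) (auto intro: polys.const)
    next
      case 2
      have "(\<lambda>v. p v * k v) \<in> polys X"
        by (intro polys_rules gens)
      then show ?thesis
        using d\<phi> 2 by (intro bexI[of _ "\<lambda>v. p v * k v"]) (auto simp: k_def)
    next
      case 3
      have "(\<lambda>v. p v * (Z v * rr v - qq v * k v)) \<in> polys X"
        by (intro polys_rules gens mem)
      moreover have "(p has_real_derivative p v * (Z v * rr v - qq v * k v)) (at v)" if "v \<in> I" for v
        using dp[OF that] by (simp add: Z_def rr_def qq_def k_def z_def A_def power_one_over)
      ultimately show ?thesis
        unfolding 3 by (rule witness)
    next
      case 4
      show ?thesis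
        unfolding 4 using mem(2) dqq by (rule witness)
    next
      case 5
      show ?thesis
        unfolding 5 using mem(1) drr by (rule witness)
    next
      case 6
      have "(\<lambda>v. - (z v * z v * rr v)) \<in> polys X"
        by (intro polys_rules gens mem)
      moreover have "(z has_real_derivative - (z v * z v * rr v)) (at v)" if "v \<in> I" for v
        unfolding z_def using r_pos[OF that]
        by (auto intro!: derivative_eq_intros drr that simp: field_simps power2_eq_square)
      ultimately show ?thesis
        unfolding 6 by (rule witness)
    next
      case 7
      have "(\<lambda>v. - (k v * k v * qq v)) \<in> polys X"
        by (intro polys_rules gens mem)
      moreover have "(k has_real_derivative - (k v * k v * qq v)) (at v)" if "v \<in> I" for v
        unfolding k_def using q_pos[OF that]
        by (auto intro!: derivative_eq_intros dqq that simp: field_simps power2_eq_square)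
      ultimately show ?thesis
        unfolding 7 by (rule witness)
    next
      case 8
      have "(\<lambda>v. - (Z v * A v * rr v)) \<in> polys X"
        by (intro polys_rules gens mem)
      moreover have "(A has_real_derivative - (Z v * A v * rr v)) (at v)" if "v \<in> I" for v
        unfolding A_def Z_def rr_def k_def z_def
        by (rule DERIV_cong[OF dA[OF that]]) (simp only: mult_minus_left, simp add: mult.assoc)
      ultimately show ?thesis
        unfolding 8 by (rule witness)
    qed
  qed
  show "smooth_on I \<phi>" "smooth_on I p" "smooth_on I q"
    using smooth_on_polys[OF I ex gens(2)] smooth_on_polys[OF I ex gens(3)]
      smooth_on_polys[OF I ex gens(4)] by simp_all
qed

lemma tube_subset_kruskal: "tube \<phi> I \<subseteq> kruskal M"
  using UV psi_bound[OF M r_pos] by (force simp: tube_def kruskal_def)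

lemma area_radius_tube: "v \<in> I \<Longrightarrow> area_radius M (\<phi> v) v = r v"
  using area_radius_unique[OF M r_pos] UV by metis

lemma in_chart_tube:
  assumes "rotation_matrix R"
  shows "in_chart M R (tube \<phi> I) = {x \<in> chart_domain M. x $ 2 \<in> I \<and> x $ 1 = \<phi> (x $ 2)}"
proof -
  have "norm (R *v (vector [sin a * cos b, sin a * sin b, cos a] :: real^3)) = 1" for a b
  proof -
    have "norm (R *v (vector [sin a * cos b, sin a * sin b, cos a] :: real^3)) =
        norm (vector [sin a * cos b, sin a * sin b, cos a] :: real^3)"
      by (rule norm_rotation_matrix_mult[OF assms])
    also have "\<dots> = 1"
    proof -
      have "sin a * cos b * (sin a * cos b) + sin a * sin b * (sin a * sin b) + cos a * cos a =
          (sin a)^2 * ((cos b)^2 + (sin b)^2) + (cos a)^2"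
        by (simp only: power2_eq_square) algebra
      then show ?thesis
        by (simp add: norm_eq_sqrt_inner inner_vec_def sum_3 vector_3)
    qed
    finally show ?thesis .
  qed
  then show ?thesis
    by (auto simp: in_chart_def tube_def chart_def)
qed

lemma open_chart_strip: "open {x \<in> chart_domain M. x $ 2 \<in> I}"
proof -
  have "open {x::real^4. x $ 1 * x $ 2 > - 2 * M \<and> 0 < x $ 3 \<and> x $ 3 < pi}"
    by (intro open_Collect_conj open_Collect_less continuous_intros)
  moreover have "open ((\<lambda>x::real^4. x $ 2) -` I)"
    by (intro open_vimage I) (simp add: continuous_on_component continuous_on_id)
  moreover have "{x \<in> chart_domain M. x $ 2 \<in> I} =
      {x. x $ 1 * x $ 2 > - 2 * M \<and> 0 < x $ 3 \<and> x $ 3 < pi} \<inter> ((\<lambda>x. x $ 2) -` I)"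
    by (auto simp: chart_domain_def)
  ultimately show ?thesis
    by (simp only: open_Int)
qed

lemma embedded_tube:
  assumes "rotation_matrix R"
  shows "embedded_hypersurface (in_chart M R (tube \<phi> I))"
proof -
  let ?W = "{x \<in> chart_domain M. x $ 2 \<in> I}"
  define F :: "real^4 \<Rightarrow> real" where "F x = x $ 1 + - \<phi> (x $ 2)" for x
  have "smooth_on ?W (\<lambda>x. \<phi> (x $ 2))"
    using smooth_on_compose_linear[OF I bounded_linear_vec_nth smooth(1)]
    by (rule smooth_on_subset) auto
  then have "smooth_on ?W (\<lambda>x. - \<phi> (x $ 2))"
    using smooth_on_linear_compose[OF open_chart_strip bounded_linear_minus[OF bounded_linear_ident]]
    by fast
  then have "smooth_on ?W F"
    unfolding F_def
    by (rule smooth_on_add[OF open_chart_strip smooth_on_bounded_linear[OF bounded_linear_vec_nth]])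
  moreover have "\<exists>v. frechet_derivative F (at x) v \<noteq> 0" if "x \<in> ?W" for x
  proof -
    have "(F has_derivative (\<lambda>v. v $ 1 + - (v $ 2 * (p (x $ 2) / q (x $ 2))))) (at x)"
      unfolding F_def using that
      by (intro has_derivative_add has_derivative_minus has_derivative_nth
          DERIV_compose_FDERIV[OF d\<phi>]) auto
    from fun_cong[OF frechet_derivative_at[OF this], of "axis 1 1"]
    have "frechet_derivative F (at x) (axis 1 1) \<noteq> 0"
      by (simp add: axis_def)
    then show ?thesis
      by blast
  qed
  ultimately show ?thesis
    unfolding embedded_hypersurface_def in_chart_tube[OF assms]
    using open_chart_strip
    by (intro ballI exI[of _ ?W] exI[of _ F]) (auto simp: F_def)
qed

text \<open>Differentiating \<open>U = \<phi> V\<close> along a curve in the hypersurface gives the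
  linear condition on \<open>v\<close>. Later arguments always start from a vector given as
  tangent.\<close>

lemma tangent_vector_tube:
  assumes R: "rotation_matrix R" and v: "v \<in> tangent_vectors (in_chart M R (tube \<phi> I)) x"
  shows "x \<in> chart_domain M" "x $ 2 \<in> I" "x $ 1 = \<phi> (x $ 2)" "v $ 1 = p (x $ 2) / q (x $ 2) * v $ 2"
proof -
  obtain \<gamma> \<epsilon> where e: "0 < (\<epsilon>::real)" and sub: "\<gamma> ` {-\<epsilon><..<\<epsilon>} \<subseteq> in_chart M R (tube \<phi> I)"
    and x: "\<gamma> 0 = x" and d: "(\<gamma> has_vector_derivative v) (at 0)"
    using v unfolding tangent_vectors_def by blast
  have in_S: "\<gamma> t \<in> chart_domain M \<and> \<gamma> t $ 2 \<in> I \<and> \<gamma> t $ 1 = \<phi> (\<gamma> t $ 2)" if "t \<in> {-\<epsilon><..<\<epsilon>}" for t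
    using sub that unfolding in_chart_tube[OF R] by blast
  then show *: "x \<in> chart_domain M" "x $ 2 \<in> I" "x $ 1 = \<phi> (x $ 2)"
    using e x by force+
  have d': "((\<lambda>t. \<gamma> t $ i) has_real_derivative v $ i) (at 0)" for i
    using bounded_linear.has_vector_derivative[OF bounded_linear_vec_nth d]
    by (simp add: has_real_derivative_iff_has_vector_derivative)
  have "((\<lambda>t. \<phi> (\<gamma> t $ 2)) has_real_derivative p (x $ 2) / q (x $ 2) * v $ 2) (at 0)"
    by (rule DERIV_chain2[OF _ d']) (use d\<phi> * x in auto)
  then have "((\<lambda>t. \<gamma> t $ 1) has_real_derivative p (x $ 2) / q (x $ 2) * v $ 2) (at 0)"
    by (rule has_field_derivative_transform_within_open[of _ _ _ "{-\<epsilon><..<\<epsilon>}"])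
       (use in_S e in auto)
  then show "v $ 1 = p (x $ 2) / q (x $ 2) * v $ 2"
    using d' DERIV_unique by blast
qed

lemma sin_pos_chart: "x \<in> chart_domain M \<Longrightarrow> sin (x $ 3) > 0"
  by (auto simp: chart_domain_def sin_gt_zero)

text \<open>By the normalisation, \<open>2 * conf * p / q = 1 / q^2\<close>, so the induced metric
  is diagonal and \<open>a $ 2 / q\<close> is the proper-length component along the profile.\<close>

lemma metric_inner_tangent:
  assumes "v \<in> I" "x $ 2 = v" "x $ 1 = \<phi> v" "a $ 1 = p v / q v * a $ 2" "b $ 1 = p v / q v * b $ 2"
  shows "metric_inner (kruskal_metric M) x a b =
    a $ 2 * b $ 2 / (q v)^2 + (r v)^2 * (a $ 3 * b $ 3 + (sin (x $ 3))^2 * (a $ 4 * b $ 4))"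
proof -
  have "conf M (r v) * p v = 1 / (2 * q v)"
    using unit[OF assms(1)] q_pos[OF assms(1)] by (simp add: field_simps)
  then have "conf M (r v) * (p v / q v * a $ 2 * b $ 2 + a $ 2 * (p v / q v * b $ 2)) = a $ 2 * b $ 2 / (q v)^2"
    using q_pos[OF assms(1)] by (simp add: field_simps power2_eq_square)
  then show ?thesis
    unfolding metric_inner_kruskal assms(2-5) area_radius_tube[OF assms(1)] by simp
qed

lemma spacelike_tube:
  assumes R: "rotation_matrix R"
  shows "spacelike (kruskal_metric M) (in_chart M R (tube \<phi> I))"
  unfolding spacelike_def
proof (intro ballI impI)
  fix x v assume "v \<in> tangent_vectors (in_chart M R (tube \<phi> I)) x" "v \<noteq> 0"
  note t = tangent_vector_tube[OF R this(1)]
  have q: "q (x $ 2) > 0" and r: "r (x $ 2) > 0" and s: "sin (x $ 3) > 0"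
    using q_pos r_pos t sin_pos_chart by auto
  have "metric_inner (kruskal_metric M) x v v = (v $ 2 / q (x $ 2))^2 +
      (r (x $ 2))^2 * ((v $ 3)^2 + (sin (x $ 3) * v $ 4)^2)"
    using metric_inner_tangent[OF t(2) refl t(3,4,4)]
    by (simp add: power2_eq_square power_mult_distrib algebra_simps)
  moreover have "v $ 2 \<noteq> 0 \<or> v $ 3 \<noteq> 0 \<or> v $ 4 \<noteq> 0"
    using \<open>v \<noteq> 0\<close> t(4) by (auto simp: vec_eq_iff forall_4)
  ultimately show "metric_inner (kruskal_metric M) x v v > 0"
    using q r s by (auto simp: add_pos_nonneg add_nonneg_pos sum_power2_gt_zero_iff)
qed

lemma tube_hypersurface: "smooth_spacelike_hypersurface M (tube \<phi> I)"
  using embedded_tube spacelike_tube tube_subset_kruskal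
  by (auto simp: smooth_spacelike_hypersurface_def)

lemma spherically_symmetric_tube: "spherically_symmetric (tube \<phi> I)"
  by (auto simp: spherically_symmetric_def tube_def norm_rotation_matrix_mult)

text \<open>\<open>has_mean_curvature\<close> asks for a field on an open set; this extension off
  the hypersurface does not depend on \<open>U\<close> or the angles.\<close>

definition normal :: "real^4 \<Rightarrow> real^4" where
  "normal x = - p (x $ 2) *\<^sub>R axis 1 1 + q (x $ 2) *\<^sub>R axis 2 1"

lemma normal_nth: "normal x $ 1 = - p (x $ 2)" "normal x $ 2 = q (x $ 2)" "normal x $ 3 = 0" "normal x $ 4 = 0"
  by (simp_all add: normal_def axis_def)

lemma smooth_normal: "smooth_on {x \<in> chart_domain M. x $ 2 \<in> I} normal"
proof -
  have *: "smooth_on {x \<in> chart_domain M. x $ 2 \<in> I} (\<lambda>x. f (x $ 2))" if "smooth_on I f" for f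
    using smooth_on_compose_linear[OF I bounded_linear_vec_nth that]
    by (rule smooth_on_subset) auto
  have "smooth_on {x \<in> chart_domain M. x $ 2 \<in> I} (\<lambda>x. p (x $ 2) *\<^sub>R axis 1 (-1))"
    by (rule smooth_on_linear_compose[OF open_chart_strip bounded_linear_scaleR_left *[OF smooth(2)]])
  moreover have "smooth_on {x \<in> chart_domain M. x $ 2 \<in> I} (\<lambda>x. q (x $ 2) *\<^sub>R axis 2 1)"
    by (rule smooth_on_linear_compose[OF open_chart_strip bounded_linear_scaleR_left *[OF smooth(3)]])
  ultimately have "smooth_on {x \<in> chart_domain M. x $ 2 \<in> I}
      (\<lambda>x. p (x $ 2) *\<^sub>R axis 1 (-1) + q (x $ 2) *\<^sub>R axis 2 1)"
    by (rule smooth_on_add[OF open_chart_strip])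
  then show ?thesis
    by (rule smooth_on_cong[OF open_chart_strip, rotated])
       (simp add: vec_eq_iff forall_4 normal_nth axis_def)
qed

lemma future_unit_normal_tube:
  assumes R: "rotation_matrix R" and x: "x \<in> in_chart M R (tube \<phi> I)"
  shows "future_unit_normal (kruskal_metric M) future_dir (in_chart M R (tube \<phi> I)) x (normal x)"
proof -
  have t: "x \<in> chart_domain M" "x $ 2 \<in> I" "x $ 1 = \<phi> (x $ 2)"
    using x in_chart_tube[OF R] by auto
  note pos = p_pos[OF t(2)] q_pos[OF t(2)] conf_pos[OF M r_pos[OF t(2)]]
  have ar: "area_radius M (x $ 1) (x $ 2) = r (x $ 2)"
    using area_radius_tube t by simp
  have "metric_inner (kruskal_metric M) x (normal x) v = 0"
    if "v \<in> tangent_vectors (in_chart M R (tube \<phi> I)) x" for v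
    using tangent_vector_tube(4)[OF R that] pos
    by (simp add: metric_inner_kruskal normal_nth)
  moreover have "metric_inner (kruskal_metric M) x (normal x) (normal x) = - 1"
    using unit[OF t(2)] by (simp add: metric_inner_kruskal normal_nth ar algebra_simps)
  moreover have "metric_inner (kruskal_metric M) x (normal x) future_dir < 0"
  proof -
    have "metric_inner (kruskal_metric M) x (normal x) future_dir =
        - (conf M (r (x $ 2)) * (p (x $ 2) + q (x $ 2)))"
      by (simp add: metric_inner_kruskal normal_nth ar future_dir_def vector_4 algebra_simps)
    then show ?thesis
      using pos by simp
  qed
  ultimately show ?thesis
    by (simp add: future_unit_normal_def)
qed

text \<open>In the sphere directions \<open>normal\<close> is constant, so only the change of
  \<open>r^2\<close> along the normal counts, giving drift divided by \<open>r\<close>. Along the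
  profile the change of \<open>conf\<close> cancels the part of \<open>dq\<close> with
  \<open>\<phi>\<close>, and the derivative of the drift is left.\<close>

lemma shape_operator_tube:
  assumes R: "rotation_matrix R" and v: "v \<in> tangent_vectors (in_chart M R (tube \<phi> I)) x"
  shows "metric_inner (kruskal_metric M) x (covariant_derivative (kruskal_metric M) x v normal) v =
    (H - 2 * c / (r (x $ 2))^3) * (v $ 2 / q (x $ 2))^2 +
    (H + c / (r (x $ 2))^3) * (r (x $ 2))^2 * ((v $ 3)^2 + (sin (x $ 3) * v $ 4)^2)"
proof -
  note t = tangent_vector_tube[OF R v]
  define y where "y = x $ 2"
  define A where "A = conf M (r y)"
  define Z where "Z = 1 / (2 * M) + 1 / r y"
  define rd where "rd = A / (4 * M) * (p y * y + q y * \<phi> y) / q y"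
  define qd where "qd = H - 2 * c / (r y)^3 + Z * (A / (4 * M)) * \<phi> y * q y"
  define pd where "pd = p y * (Z * rd - qd / q y)"
  have y: "y \<in> I" "x $ 1 = \<phi> y"
    using t by (auto simp: y_def)
  note pos = p_pos[OF y(1)] q_pos[OF y(1)] conf_pos[OF M r_pos[OF y(1)]] r_pos[OF y(1)]
  have ar: "area_radius M (x $ 1) (x $ 2) = r y"
    using area_radius_tube y by (simp add: y_def)
  have "(normal has_derivative (\<lambda>w. - (w $ 2 * pd) *\<^sub>R axis 1 1 + (w $ 2 * qd) *\<^sub>R axis 2 1)) (at x)"
    unfolding normal_def
    by (intro has_derivative_add has_derivative_scaleR_left has_derivative_minus
        DERIV_compose_FDERIV has_derivative_nth)
       (use dp[OF y(1)] dq[OF y(1)] in \<open>auto simp: y_def[symmetric] pd_def qd_def rd_def Z_def A_def\<close>)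
  from fun_cong[OF frechet_derivative_at[OF this], of v]
  have D: "frechet_derivative normal (at x) v = - (v $ 2 * pd) *\<^sub>R axis 1 1 + (v $ 2 * qd) *\<^sub>R axis 2 1"
    by simp
  have v1: "v $ 1 = p y / q y * v $ 2"
    using t by (simp add: y_def)
  have nr: "A / (4 * M) * (x $ 1 * normal x $ 2 + x $ 2 * normal x $ 1) = H * r y + c / (r y)^2"
    using normal_r[OF y(1)] by (simp add: normal_nth y(2) A_def algebra_simps flip: y_def)
  have ga: "kruskal_metric M x $ i $ j = kruskal_metric M x $ j $ i" for i j
    using exhaust_4[of i] exhaust_4[of j] by (auto simp: kruskal_metric_nth)
  have "metric_inner (kruskal_metric M) x (covariant_derivative (kruskal_metric M) x v normal) v =
      A * (- (v $ 2 * pd) * v $ 2 + v $ 2 * qd * v $ 1) + (1/2) *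
      (- 2 * Z * A * (H * r y + c / (r y)^2) * v $ 1 * v $ 2 +
      2 * r y * (H * r y + c / (r y)^2) * ((v $ 3)^2 + (sin (x $ 3))^2 * (v $ 4)^2))"
    unfolding metric_inner_covariant_derivative[of "kruskal_metric M" x, OF ga invertible_kruskal_metric[OF M t(1)]]
      kruskal_metric_derivative_term[OF M t(1) normal_nth(3,4)] D
    unfolding metric_inner_kruskal ar
    unfolding A_def[symmetric] nr Z_def[symmetric]
    by (simp add: axis_def)
  also have "\<dots> = (H - 2 * c / (r y)^3) * (v $ 2 / q y)^2 +
      (H + c / (r y)^3) * (r y)^2 * ((v $ 3)^2 + (sin (x $ 3) * v $ 4)^2)"
  proof -
    have Ap: "A * p y = 1 / (2 * q y)"
      using unit[OF y(1)] pos by (simp add: A_def field_simps)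
    have "A * (- (v $ 2 * pd) * v $ 2 + v $ 2 * qd * v $ 1) - Z * A * (H * r y + c / (r y)^2) * v $ 1 * v $ 2 =
        (v $ 2)^2 * ((A * p y) * (2 * qd / q y - Z * rd - Z * (H * r y + c / (r y)^2) / q y))"
      unfolding v1 pd_def by (simp add: power2_eq_square algebra_simps add_divide_distrib)
    also have "\<dots> = (v $ 2)^2 * ((1 / (2 * q y)) * (2 * qd / q y - Z * (rd + (H * r y + c / (r y)^2) / q y)))"
      unfolding Ap by (simp add: algebra_simps)
    \<comment> \<open>The tangential derivative of the radius contains \<open>p * V + q * U\<close>,
      the normal one \<open>q * U - p * V\<close>; in the sum the terms with \<open>p\<close>
      cancel.\<close>
    also have "rd + (H * r y + c / (r y)^2) / q y = 2 * (A / (4 * M)) * \<phi> y"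
      using pos M unfolding normal_r[OF y(1), symmetric] rd_def A_def by (simp add: field_simps)
    also have "(1 / (2 * q y)) * (2 * qd / q y - Z * (2 * (A / (4 * M)) * \<phi> y)) = (H - 2 * c / (r y)^3) / (q y)^2"
      using pos unfolding qd_def by (simp add: divide_simps) (simp add: algebra_simps power2_eq_square)
    finally have 1: "A * (- (v $ 2 * pd) * v $ 2 + v $ 2 * qd * v $ 1) - Z * A * (H * r y + c / (r y)^2) * v $ 1 * v $ 2 =
        (H - 2 * c / (r y)^3) * (v $ 2 / q y)^2"
      by (simp add: power_divide)
    have 2: "r y * (H * r y + c / (r y)^2) = (H + c / (r y)^3) * (r y)^2"
      using pos by (simp add: field_simps power2_eq_square power3_eq_cube)
    show ?thesis
      unfolding 1[symmetric] 2[symmetric] by (simp add: algebra_simps power_mult_distrib)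
  qed
  finally show ?thesis
    by (simp add: y_def)
qed

lemma mean_curvature_tube:
  assumes R: "rotation_matrix R" and x: "x \<in> in_chart M R (tube \<phi> I)"
  shows "has_mean_curvature (kruskal_metric M) future_dir (in_chart M R (tube \<phi> I)) x H"
proof -
  let ?S = "in_chart M R (tube \<phi> I)" and ?W = "{x \<in> chart_domain M. x $ 2 \<in> I}"
  have "(1/3) * (\<Sum>i\<in>UNIV. metric_inner (kruskal_metric M) x
      (covariant_derivative (kruskal_metric M) x (e i) normal) (e i)) = H"
    if e: "orthonormal_tangent_frame (kruskal_metric M) ?S x e" for e
  proof -
    have et: "e i \<in> tangent_vectors ?S x" for i
      using e by (simp add: orthonormal_tangent_frame_def)
    define y where "y = x $ 2"
    have y: "y \<in> I" "x $ 2 = y" "x $ 1 = \<phi> y"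
      using tangent_vector_tube[OF R et] by (auto simp: y_def)
    have e1: "e i $ 1 = p y / q y * e i $ 2" for i
      using tangent_vector_tube(4)[OF R et] by (simp add: y_def)
    \<comment> \<open>Row \<open>i\<close> holds the components of \<open>e i\<close> in the
      orthonormal basis of the profile direction and two sphere directions, which diagonalises the
      shape operator.\<close>
    define E :: "real^3^3" where
      "E = (\<chi> i. vector [e i $ 2 / q y, r y * e i $ 3, r y * (sin (x $ 3) * e i $ 4)])"
    have "(\<Sum>k\<in>UNIV. E $ i $ k * E $ j $ k) = metric_inner (kruskal_metric M) x (e i) (e j)" for i j
      unfolding metric_inner_tangent[OF y e1 e1]
      by (simp add: E_def sum_3 vector_3 power2_eq_square algebra_simps)
    then have "(\<Sum>k\<in>UNIV. E $ i $ k * E $ j $ k) = (if i = j then 1 else 0)" for i j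
      using e by (simp add: orthonormal_tangent_frame_def)
    from orthonormal_rows_columns[OF this]
    have col: "(\<Sum>i\<in>UNIV. (E $ i $ k)^2) = 1" for k
      by (simp add: power2_eq_square)
    have "(\<Sum>i\<in>UNIV. metric_inner (kruskal_metric M) x
        (covariant_derivative (kruskal_metric M) x (e i) normal) (e i)) =
        (\<Sum>i\<in>UNIV. (H - 2 * c / (r y)^3) * (E $ i $ 1)^2 +
          (H + c / (r y)^3) * ((E $ i $ 2)^2 + (E $ i $ 3)^2))"
      unfolding shape_operator_tube[OF R et] y(2)
      by (intro sum.cong refl) (simp add: E_def vector_3 power_mult_distrib algebra_simps)
    \<comment> \<open>Each column of \<open>E\<close> has length 1, so the trace is the sum of the
      principal curvatures; the terms with \<open>c\<close> cancel and \<open>3 * H\<close>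
      remains.\<close>
    also have "\<dots> = (H - 2 * c / (r y)^3) * 1 + (H + c / (r y)^3) * (1 + 1)"
      unfolding sum.distrib sum_distrib_left[symmetric] col ..
    finally show ?thesis
      by simp
  qed
  moreover have "\<forall>z\<in>?S \<inter> ?W. future_unit_normal (kruskal_metric M) future_dir ?S z (normal z)"
    using future_unit_normal_tube[OF R] by blast
  moreover have "x \<in> ?W"
    using x in_chart_tube[OF R] by auto
  ultimately show ?thesis
    unfolding has_mean_curvature_def
    using open_chart_strip smooth_normal by blast
qed

theorem ss_cmc_tube: "ss_cmc M H (tube \<phi> I)"
  unfolding ss_cmc_def
  using tube_hypersurface spherically_symmetric_tube mean_curvature_tube by blast

end

section \<open>Topology of rotationally symmetric graphs\<close>

lemma tube_mono: "J \<subseteq> I \<Longrightarrow> tube \<phi> J \<subseteq> tube \<phi> I"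
  by (auto simp: tube_def)

lemma tube_Un: "tube \<phi> (I \<union> J) = tube \<phi> I \<union> tube \<phi> J"
  by (auto simp: tube_def)

lemma tube_singleton: "tube \<phi> {v} = {(\<phi> v, v)} \<times> sphere 0 1"
  by (auto simp: tube_def)

lemma tube_image: "tube \<phi> I = (\<lambda>(v, \<omega>). ((\<phi> v, v), \<omega>)) ` (I \<times> sphere 0 1)"
  by (auto simp: tube_def)

lemma snd_fst_tube: "(\<lambda>x. snd (fst x)) ` tube \<phi> I = I"
proof -
  have "snd (fst ((\<phi> v, v), axis 1 1)) = v \<and> ((\<phi> v, v), axis 1 1) \<in> tube \<phi> I" if "v \<in> I" for v
    using that by (simp add: tube_def norm_axis_1)
  then have "I \<subseteq> (\<lambda>x. snd (fst x)) ` tube \<phi> I"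
    by (metis image_eqI subsetI)
  moreover have "(\<lambda>x. snd (fst x)) ` tube \<phi> I \<subseteq> I"
    by (auto simp: tube_def)
  ultimately show ?thesis
    by blast
qed

lemma tube_nonempty: "I \<noteq> {} \<Longrightarrow> tube \<phi> I \<noteq> {}"
  using snd_fst_tube[of \<phi> I] by auto

lemma continuous_on_snd_fst: "continuous_on S (\<lambda>x::event. snd (fst x))"
  by (intro continuous_intros)

lemma continuous_on_tube_param:
  assumes "continuous_on I \<phi>"
  shows "continuous_on (I \<times> T) (\<lambda>(v, \<omega>). ((\<phi> v, v), \<omega>))"
  unfolding case_prod_beta
  by (intro continuous_intros continuous_on_compose2[OF assms]) auto

lemma connected_tube:
  assumes "continuous_on I \<phi>" "connected I"
  shows "connected (tube \<phi> I)"
  unfolding tube_image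
  by (intro connected_continuous_image continuous_on_tube_param connected_Times connected_sphere assms)
     auto

lemma compact_tube:
  assumes "continuous_on I \<phi>" "compact I"
  shows "compact (tube \<phi> I)"
  unfolding tube_image
  by (intro compact_continuous_image continuous_on_tube_param compact_Times compact_sphere assms)

text \<open>Projection to \<open>V\<close> gives one inclusion; for the other, a sequence of
  parameters is lifted by continuity of \<open>\<phi>\<close> with the sphere point held
  fixed.\<close>

lemma closure_tube:
  assumes cont: "continuous_on I \<phi>" and J: "J \<subseteq> I"
  shows "closure (tube \<phi> J) \<inter> tube \<phi> I = tube \<phi> (closure J \<inter> I)"
proof (intro equalityI subsetI)
  fix x assume x: "x \<in> closure (tube \<phi> J) \<inter> tube \<phi> I"
  have "snd (fst x) \<in> closure J"
    using image_closure_subset[of "tube \<phi> J" "\<lambda>x. snd (fst x)" "closure J"] x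
      continuous_on_snd_fst closure_subset[of J] snd_fst_tube[of \<phi> J] by auto
  then show "x \<in> tube \<phi> (closure J \<inter> I)"
    using x by (auto simp: tube_def)
next
  fix x assume "x \<in> tube \<phi> (closure J \<inter> I)"
  then obtain v \<omega> where v: "v \<in> closure J" "v \<in> I" and w: "\<omega> \<in> sphere 0 1" and x: "x = ((\<phi> v, v), \<omega>)"
    by (auto simp: tube_def)
  obtain s where s: "\<And>n. s n \<in> J" "s \<longlonglongrightarrow> v"
    using v(1) closure_sequential by blast
  have "(\<lambda>n. \<phi> (s n)) \<longlonglongrightarrow> \<phi> v"
    by (rule continuous_on_tendsto_compose[OF cont s(2) v(2)]) (use s(1) J in \<open>auto intro!: always_eventually\<close>)
  then have "(\<lambda>n. ((\<phi> (s n), s n), \<omega>)) \<longlonglongrightarrow> x"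
    unfolding x by (intro tendsto_intros s)
  moreover have "((\<phi> (s n), s n), \<omega>) \<in> tube \<phi> J" for n
    using s w by (auto simp: tube_def)
  ultimately have "x \<in> closure (tube \<phi> J)"
    unfolding closure_sequential by (intro exI[of _ "\<lambda>n. ((\<phi> (s n), s n), \<omega>)"]) blast
  then show "x \<in> closure (tube \<phi> J) \<inter> tube \<phi> I"
    using v w x by (auto simp: tube_def)
qed

text \<open>A connected set meets only one component. It is applied with \<open>D\<close> a
  neighbourhood of an end, so each end accounts for at most one component.\<close>

lemma components_unique:
  assumes "C \<in> components S" "D \<subseteq> S" "connected D" "C \<inter> D \<noteq> {}" "z \<in> D"
  shows "C = connected_component_set S z"
proof -
  have "z \<in> S" using assms by blast
  then have "connected_component_set S z \<in> components S"
    by (auto simp: components_def)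
  moreover have "D \<subseteq> connected_component_set S z"
    using assms by (simp add: connected_component_maximal)
  ultimately show ?thesis
    using assms(1,4) components_nonoverlap[of C S "connected_component_set S z"] by blast
qed

lemma real_interval_left_of:
  fixes D :: "real set"
  assumes "connected D" "c \<notin> D" "a \<in> D" "a < c" "b \<in> D"
  shows "b < c"
  using assms connectedD_interval[of D a b c] by (metis linorder_not_le order.order_iff_strict)

lemma real_interval_right_of:
  fixes D :: "real set"
  assumes "connected D" "c \<notin> D" "a \<in> D" "c < a" "b \<in> D"
  shows "c < b"
  using assms connectedD_interval[of D b a c] by (metis linorder_not_le order.order_iff_strict)

text \<open>The tube is an open interval times a connected compact sphere. A compact set lies over a
  compact interval of parameters, which leaves two connected outer parts; removing a single sphere
  shows that both are unbounded.\<close>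

lemma has_ends_tube:
  assumes cont: "continuous_on I \<phi>" and I: "open I" "connected I" "I \<noteq> {}"
  shows "has_ends (tube \<phi> I) 2"
proof -
  let ?S = "tube \<phi> I"
  let ?\<pi> = "\<lambda>x::event. snd (fst x)"
  have seg: "{a..b} \<subseteq> I" if "a \<in> I" "b \<in> I" for a b
    using that I(2) by (metis connected_contains_Icc)
  have sub: "continuous_on J \<phi>" if "J \<subseteq> I" for J
    using that cont continuous_on_subset by blast
  have left: "\<exists>b. b \<in> I \<and> b < a" if "a \<in> I" for a
  proof -
    obtain e where "e > 0" "ball a e \<subseteq> I"
      using I(1) \<open>a \<in> I\<close> open_contains_ball by blast
    then have "a - e / 2 \<in> I" "a - e / 2 < a"
      by (auto simp: subset_iff dist_real_def)
    then show ?thesis by blast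
  qed
  have right: "\<exists>b. b \<in> I \<and> b > a" if "a \<in> I" for a
  proof -
    obtain e where "e > 0" "ball a e \<subseteq> I"
      using I(1) \<open>a \<in> I\<close> open_contains_ball by blast
    then have "a + e / 2 \<in> I" "a + e / 2 > a"
      by (auto simp: subset_iff dist_real_def)
    then show ?thesis by blast
  qed
  have Lconn: "connected (tube \<phi> {v \<in> I. v < a})" and Rconn: "connected (tube \<phi> {v \<in> I. a < v})" for a
  proof -
    have "{v \<in> I. v < a} = I \<inter> {..<a}" "{v \<in> I. a < v} = I \<inter> {a<..}"
      by auto
    moreover have "connected (I \<inter> {..<a})" "connected (I \<inter> {a<..})"
      using I(2) by (auto simp: is_interval_connected_1[symmetric] is_interval_1)
    ultimately show "connected (tube \<phi> {v \<in> I. v < a})" "connected (tube \<phi> {v \<in> I. a < v})"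
      by (auto intro!: connected_tube sub)
  qed
  have bound: "finite (unbounded_components ?S K) \<and> card (unbounded_components ?S K) \<le> 2"
    if K: "compact K" "K \<subseteq> ?S" for K
  proof -
    have "\<exists>a b. a \<in> I \<and> b \<in> I \<and> ?\<pi> ` K \<subseteq> {a..b}"
    proof (cases "K = {}")
      case True
      then show ?thesis using I(3) by auto
    next
      case False
      have c: "compact (?\<pi> ` K)"
        using K(1) continuous_on_snd_fst compact_continuous_image by blast
      have "?\<pi> ` K \<subseteq> I"
        using K(2) snd_fst_tube[of \<phi> I] by blast
      then show ?thesis
        using compact_attains_inf[OF c] compact_attains_sup[OF c] False
        by (metis (no_types, lifting) atLeastAtMost_iff image_is_empty subset_iff)
    qed
    then obtain a b where ab: "a \<in> I" "b \<in> I" "?\<pi> ` K \<subseteq> {a..b}"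
      by blast
    define L where "L = tube \<phi> {v \<in> I. v < a}"
    define R where "R = tube \<phi> {v \<in> I. b < v}"
    have LR: "L \<subseteq> ?S - K" "R \<subseteq> ?S - K"
      using ab(3) by (fastforce simp: L_def R_def tube_def image_iff subset_iff)+
    have "L \<noteq> {}" "R \<noteq> {}"
      unfolding L_def R_def using left[OF ab(1)] right[OF ab(2)] by (auto intro!: tube_nonempty)
    then obtain l \<rho> where l: "l \<in> L" and \<rho>: "\<rho> \<in> R"
      by blast
    have "unbounded_components ?S K \<subseteq>
        {connected_component_set (?S - K) l, connected_component_set (?S - K) \<rho>}"
    proof
      fix C assume "C \<in> unbounded_components ?S K"
      then have C: "C \<in> components (?S - K)" "\<not> compact (?S \<inter> closure C)"
        by (auto simp: unbounded_components_def)
      \<comment> \<open>A component avoiding both outer parts lies over \<open>{a..b}\<close>, and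
        its closure is then compact.\<close>
      have "C \<inter> L \<noteq> {} \<or> C \<inter> R \<noteq> {}"
      proof (rule ccontr)
        assume "\<not> ?thesis"
        moreover have "C \<subseteq> ?S"
          using C(1) in_components_subset by blast
        ultimately have sub': "C \<subseteq> tube \<phi> {a..b}"
          by (fastforce simp: L_def R_def tube_def)
        have comp: "compact (tube \<phi> {a..b})"
          by (intro compact_tube sub seg ab) auto
        then have "closure C \<subseteq> tube \<phi> {a..b}"
          using sub' by (simp add: closure_minimal compact_imp_closed)
        moreover have "tube \<phi> {a..b} \<subseteq> ?S"
          by (intro tube_mono seg ab)
        ultimately have "?S \<inter> closure C = closure C \<inter> tube \<phi> {a..b}"
          by blast
        then show False
          using C(2) comp by (metis closed_Int_compact closed_closure)
      qed
      then show "C \<in> {connected_component_set (?S - K) l, connected_component_set (?S - K) \<rho>}"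
        using components_unique[OF C(1) LR(1) _ _ l] components_unique[OF C(1) LR(2) _ _ \<rho>]
          Lconn Rconn by (auto simp: L_def R_def)
    qed
    then have "finite (unbounded_components ?S K)" "card (unbounded_components ?S K) \<le>
        card {connected_component_set (?S - K) l, connected_component_set (?S - K) \<rho>}"
      by (auto intro: finite_subset card_mono)
    moreover have "card {x, y} \<le> 2" for x y :: "event set"
      by (simp add: card_insert_if)
    ultimately show ?thesis
      using order_trans by blast
  qed
  obtain a where a: "a \<in> I"
    using I(3) by blast
  define L where "L = tube \<phi> {v \<in> I. v < a}"
  define R where "R = tube \<phi> {v \<in> I. a < v}"
  let ?K = "tube \<phi> {a}"
  have K: "compact ?K" "?K \<subseteq> ?S"
    using a by (auto intro!: compact_tube tube_mono)
  have ne: "{v \<in> I. v < a} \<noteq> {}" "{v \<in> I. a < v} \<noteq> {}"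
    using left[OF a] right[OF a] by auto
  then have LRne: "L \<noteq> {}" "R \<noteq> {}"
    by (simp_all add: L_def R_def tube_nonempty)
  \<comment> \<open>Common argument for the two sides of \<open>a\<close>. The premise
    \<open>maximal\<close> says, in terms of parameters only, that a connected set missing
    \<open>a\<close> cannot leave \<open>J\<close>.\<close>
  have half: "tube \<phi> J \<in> unbounded_components ?S ?K"
    if J: "J \<noteq> {}" "J \<subseteq> I - {a}" and conn: "connected (tube \<phi> J)"
      and maximal: "\<And>D x y. connected D \<Longrightarrow> a \<notin> D \<Longrightarrow> D \<subseteq> I \<Longrightarrow> x \<in> D \<Longrightarrow> x \<in> J \<Longrightarrow> y \<in> D \<Longrightarrow> y \<in> J"
      and noncompact: "\<not> compact (closure J \<inter> I)" for J
  proof -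
    have sub_S: "tube \<phi> J \<subseteq> ?S - ?K"
      using J(2) by (auto simp: tube_def)
    have "D = tube \<phi> J" if D: "tube \<phi> J \<subseteq> D" "D \<subseteq> ?S - ?K" "connected D" for D
    proof -
      have \<pi>D: "connected (?\<pi> ` D)" "a \<notin> ?\<pi> ` D" "?\<pi> ` D \<subseteq> I"
        using D(2) connected_continuous_image[OF continuous_on_snd_fst D(3)] by (fastforce simp: tube_def)+
      obtain z where "z \<in> J"
        using J(1) by blast
      then have z: "z \<in> J" "z \<in> ?\<pi> ` D"
        using image_mono[OF D(1), of ?\<pi>] snd_fst_tube[of \<phi> J] by auto
      have "x \<in> tube \<phi> J" if "x \<in> D" for x
      proof -
        have "?\<pi> x \<in> J"
          using maximal[OF \<pi>D z(2,1)] that by blast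
        then show ?thesis
          using D(2) that by (auto simp: tube_def)
      qed
      then show ?thesis
        using D(1) by blast
    qed
    then have "tube \<phi> J \<in> components (?S - ?K)"
      unfolding in_components_maximal using sub_S conn tube_nonempty[OF J(1)] by blast
    moreover have "\<not> compact (?S \<inter> closure (tube \<phi> J))"
    proof
      assume "compact (?S \<inter> closure (tube \<phi> J))"
      then have "compact (?\<pi> ` (?S \<inter> closure (tube \<phi> J)))"
        by (rule compact_continuous_image[OF continuous_on_snd_fst])
      moreover have "?\<pi> ` (?S \<inter> closure (tube \<phi> J)) = closure J \<inter> I"
        using closure_tube[OF cont, of J] J(2) snd_fst_tube by (metis Diff_subset inf_commute subset_trans)
      ultimately show False
        using noncompact by simp
    qed
    ultimately show ?thesis
      by (simp add: unbounded_components_def)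
  qed
  have "L \<in> unbounded_components ?S ?K"
    unfolding L_def
  proof (rule half[OF ne(1) _ Lconn])
    show "y \<in> {v \<in> I. v < a}" if "connected D" "a \<notin> D" "D \<subseteq> I" "x \<in> D" "x \<in> {v \<in> I. v < a}" "y \<in> D" for D x y
      using real_interval_left_of[OF that(1,2,4) _ that(6)] that by auto
    \<comment> \<open>Compactness would give a least parameter in \<open>I\<close>, but the open set
      \<open>I\<close> always continues further to the left.\<close>
    show "\<not> compact (closure {v \<in> I. v < a} \<inter> I)"
    proof
      assume c: "compact (closure {v \<in> I. v < a} \<inter> I)"
      have in_c: "v \<in> closure {v \<in> I. v < a} \<inter> I" if "v \<in> I" "v < a" for v
        using that closure_subset[of "{v \<in> I. v < a}"] by blast
      have "closure {v \<in> I. v < a} \<subseteq> {..a}"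
        by (intro closure_minimal) auto
      moreover obtain m where m: "m \<in> closure {v \<in> I. v < a} \<inter> I" "\<And>v. v \<in> closure {v \<in> I. v < a} \<inter> I \<Longrightarrow> m \<le> v"
        using compact_attains_inf[OF c] in_c ne by blast
      ultimately have "m \<le> a" "m \<in> I"
        by auto
      then show False
        using left[of m] m(2) in_c by (metis linorder_not_le order_less_le_trans)
    qed
  qed auto
  moreover have "R \<in> unbounded_components ?S ?K"
    unfolding R_def
  proof (rule half[OF ne(2) _ Rconn])
    show "y \<in> {v \<in> I. a < v}" if "connected D" "a \<notin> D" "D \<subseteq> I" "x \<in> D" "x \<in> {v \<in> I. a < v}" "y \<in> D" for D x y
      using real_interval_right_of[OF that(1,2,4) _ that(6)] that by auto
    show "\<not> compact (closure {v \<in> I. a < v} \<inter> I)"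
    proof
      assume c: "compact (closure {v \<in> I. a < v} \<inter> I)"
      have in_c: "v \<in> closure {v \<in> I. a < v} \<inter> I" if "v \<in> I" "a < v" for v
        using that closure_subset[of "{v \<in> I. a < v}"] by blast
      have "closure {v \<in> I. a < v} \<subseteq> {a..}"
        by (intro closure_minimal) auto
      moreover obtain m where m: "m \<in> closure {v \<in> I. a < v} \<inter> I" "\<And>v. v \<in> closure {v \<in> I. a < v} \<inter> I \<Longrightarrow> v \<le> m"
        using compact_attains_sup[OF c] in_c ne by blast
      ultimately have "a \<le> m" "m \<in> I"
        by auto
      then show False
        using right[of m] m(2) in_c by (metis linorder_not_le order_le_less_trans)
    qed
  qed auto
  ultimately have "{L, R} \<subseteq> unbounded_components ?S ?K"
    by simp
  moreover have "L \<noteq> R"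
  proof
    assume "L = R"
    moreover have "L \<inter> R = {}"
      by (auto simp: L_def R_def tube_def)
    ultimately show False
      using LRne(1) by simp
  qed
  ultimately have "2 \<le> card (unbounded_components ?S ?K)"
    using card_mono[of "unbounded_components ?S ?K" "{L, R}"] bound[OF K] by simp
  then have "card (unbounded_components ?S ?K) = 2"
    using bound[OF K] by simp
  then show ?thesis
    unfolding has_ends_def using bound K by blast
qed

section \<open>Gluing two pieces of a tube along a horizon sphere\<close>

context profile
begin

lemma continuous_on_profile: "continuous_on I \<phi>"
  using DERIV_isCont[OF d\<phi>] by (simp add: continuous_on_eq_continuous_at[OF I])

text \<open>Since the whole tube is closed in the spacetime, closures of its pieces can be computed
  in the parameter \<open>V\<close>. The condition \<open>\<phi> a * a = 0\<close> puts the common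
  end point on the horizon.\<close>

lemma limiting_set_tube:
  assumes closed: "closedin (top_of_set (kruskal M)) (tube \<phi> I)"
    and AB: "A \<subseteq> I" "B \<subseteq> I" "closure A \<inter> closure B \<inter> I = {a}" and a: "\<phi> a * a = 0"
  shows "limiting_set M (tube \<phi> A) (tube \<phi> B) = {(\<phi> a, a)} \<times> sphere 0 1"
proof -
  have clos: "closure (tube \<phi> J) \<inter> kruskal M = tube \<phi> (closure J \<inter> I)" if "J \<subseteq> I" for J
  proof -
    obtain T where T: "closed T" "tube \<phi> I = kruskal M \<inter> T"
      using closed by (auto simp: closedin_closed)
    then have "closure (tube \<phi> J) \<subseteq> T"
      using tube_mono[OF that, of \<phi>] by (intro closure_minimal) auto
    then have "closure (tube \<phi> J) \<inter> kruskal M = closure (tube \<phi> J) \<inter> tube \<phi> I"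
      using T by blast
    then show ?thesis
      using closure_tube[OF continuous_on_profile that] by simp
  qed
  have hor: "horizon M \<subseteq> kruskal M"
    by (auto simp: horizon_def)
  have aI: "a \<in> I"
    using AB by blast
  have "psi M (r a) = psi M (2 * M)"
    using UV[OF aI] a by (simp add: psi_def)
  then have "r a = 2 * M"
    using psi_strict_mono[OF M, of "r a" "2 * M"] psi_strict_mono[OF M, of "2 * M" "r a"]
      r_pos[OF aI] M by linarith
  then have ah: "{(\<phi> a, a)} \<times> sphere 0 1 \<subseteq> horizon M"
    using area_radius_tube[OF aI] tube_subset_kruskal aI
    by (auto simp: horizon_def tube_def)
  have "limiting_set M (tube \<phi> A) (tube \<phi> B) =
      horizon M \<inter> (closure (tube \<phi> A) \<inter> kruskal M) \<inter> (closure (tube \<phi> B) \<inter> kruskal M)"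
    using hor by (auto simp: limiting_set_def)
  also have "\<dots> = horizon M \<inter> tube \<phi> (closure A \<inter> closure B \<inter> I)"
    unfolding clos[OF AB(1)] clos[OF AB(2)] by (auto simp: tube_def)
  also have "\<dots> = {(\<phi> a, a)} \<times> sphere 0 1"
    unfolding AB(3) tube_singleton using ah by blast
  finally show ?thesis .
qed

lemma join_tube:
  assumes "closedin (top_of_set (kruskal M)) (tube \<phi> I)"
    and "A \<subseteq> I" "B \<subseteq> I" "closure A \<inter> closure B \<inter> I = {a}" and "\<phi> a * a = 0"
  shows "join M (tube \<phi> A) (tube \<phi> B) = tube \<phi> (A \<union> B \<union> {a})"
  unfolding join_def limiting_set_tube[OF assms] by (simp only: tube_Un tube_singleton)

lemma connects_tube:
  assumes "closedin (top_of_set (kruskal M)) (tube \<phi> I)"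
    and "A \<subseteq> I" "B \<subseteq> I" "closure A \<inter> closure B \<inter> I = {a}" and "\<phi> a * a = 0"
    and op: "open (A \<union> B \<union> {a})"
  shows "connects_smoothly M (tube \<phi> A) (tube \<phi> B)"
proof -
  have "A \<union> B \<union> {a} \<subseteq> I"
    using assms by blast
  from profile.tube_hypersurface[OF profile_subset[OF op this]] show ?thesis
    unfolding connects_smoothly_def limiting_set_tube[OF assms(1-5)] join_tube[OF assms(1-5)] by blast
qed

end

section \<open>Profile curves\<close>

definition drift :: "real \<Rightarrow> real \<Rightarrow> real \<Rightarrow> real" where
  "drift H c r = H * r + c / r^2"

lemma drift_deriv:
  assumes "r \<noteq> 0"
  shows "(drift H c has_real_derivative H - 2 * c / r^3) (at r)"
  unfolding drift_def
  by (rule derivative_eq_intros refl | use assms in \<open>simp; fail\<close>)+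
     (use assms in \<open>simp add: field_simps power2_eq_square power3_eq_cube\<close>)

lemma schw_h_deriv:
  assumes "r \<noteq> 0"
  shows "(schw_h M has_real_derivative 2 * M / r^2) (at r)"
  unfolding schw_h_def
  by (rule derivative_eq_intros refl | use assms in \<open>simp; fail\<close>)+
     (use assms in \<open>simp add: field_simps power2_eq_square\<close>)

lemma schw_h_pos_iff: "M > 0 \<Longrightarrow> r > 0 \<Longrightarrow> schw_h M r > 0 \<longleftrightarrow> r > 2 * M"
  and schw_h_neg_iff: "M > 0 \<Longrightarrow> r > 0 \<Longrightarrow> schw_h M r < 0 \<longleftrightarrow> r < 2 * M"
  and schw_h_zero_iff: "M > 0 \<Longrightarrow> r > 0 \<Longrightarrow> schw_h M r = 0 \<longleftrightarrow> r = 2 * M"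
  by (auto simp: schw_h_def field_simps)

lemma closure_meet:
  fixes A B I :: "real set"
  assumes "a \<in> I" "A \<subseteq> {a<..}" "B \<subseteq> {..<a}"
    and "e > 0" "{a<..<a + e} \<subseteq> A" "{a - e<..<a} \<subseteq> B"
  shows "closure A \<inter> closure B \<inter> I = {a}"
proof -
  have "closure A \<subseteq> {a..}" "closure B \<subseteq> {..a}"
    using assms(2,3) by (intro closure_minimal; fastforce)+
  moreover have "a \<in> closure {a<..<a + e}" "a \<in> closure {a - e<..<a}"
    using assms(4) by simp_all
  then have "a \<in> closure A" "a \<in> closure B"
    using assms closure_mono by blast+
  ultimately show ?thesis
    using assms(1) by (auto simp: subset_iff intro: order_antisym)
qed

text \<open>The logarithm of a square replaces that of an absolute value, so both signs of
  \<open>f\<close> are treated at once.\<close>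

lemma ln_square_deriv:
  fixes f :: "real \<Rightarrow> real"
  assumes "(f has_real_derivative D) (at x)" "f x \<noteq> 0"
  shows "((\<lambda>x. k * ln ((f x)^2)) has_real_derivative k * (1 / (f x)^2 * (2 * f x * D))) (at x)"
  by (rule derivative_eq_intros assms(1) refl | use assms(2) in \<open>simp; fail\<close>)+

text \<open>A curve in the \<open>U\<close>-\<open>V\<close>-plane with radius \<open>\<rho>\<close>, where \<open>m\<close> is the ratio of proper length and
  parameter and \<open>w\<close> the derivative of the radius with respect to proper length.  On
  \<open>V > 0\<close> the curve is determined by \<open>V\<close>, on \<open>U < 0\<close> by \<open>U\<close>; this avoids the zeros of the
  other coordinate on the horizon.\<close>

locale radial_curve =
  fixes M H c :: real and J :: "real set" and \<rho> w m U V :: "real \<Rightarrow> real"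
  assumes M: "M > 0" and J: "open J" "connected J" "J \<noteq> {}"
    and \<rho>_pos: "y \<in> J \<Longrightarrow> \<rho> y > 0" and m_pos: "y \<in> J \<Longrightarrow> m y > 0"
    and w2: "y \<in> J \<Longrightarrow> (w y)^2 = schw_h M (\<rho> y) + (drift H c (\<rho> y))^2"
    and d\<rho>: "y \<in> J \<Longrightarrow> (\<rho> has_real_derivative m y * w y) (at y)"
    and dw: "y \<in> J \<Longrightarrow> (w has_real_derivative
      m y * (M / (\<rho> y)^2 + drift H c (\<rho> y) * (H - 2 * c / (\<rho> y)^3))) (at y)"
    and UV: "y \<in> J \<Longrightarrow> U y * V y = psi M (\<rho> y)"
    and branch: "y \<in> J \<Longrightarrow>
      (V y > 0 \<and> w y - drift H c (\<rho> y) > 0 \<and>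
        (V has_real_derivative m y * V y / (4 * M * (w y - drift H c (\<rho> y)))) (at y)) \<or>
      (U y < 0 \<and> w y + drift H c (\<rho> y) < 0 \<and>
        (U has_real_derivative m y * U y / (4 * M * (w y + drift H c (\<rho> y)))) (at y))"
begin

abbreviation "a y \<equiv> drift H c (\<rho> y)"
abbreviation "A y \<equiv> conf M (\<rho> y)"

text \<open>Solves the two equations of the unit tangent. The first form is regular where
  \<open>U\<close> vanishes, the second where \<open>V\<close> vanishes.\<close>

definition q :: "real \<Rightarrow> real" where
  "q y = (if V y > 0 then V y / (4 * M * (w y - a y)) else 2 * M * (w y + a y) / (A y * U y))"

definition p :: "real \<Rightarrow> real" where
  "p y = 1 / (2 * A y * q y)"

text \<open>Collects what both branches have to deliver, so that the later development no longer
  distinguishes them.\<close>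

definition tangent_at :: "real \<Rightarrow> bool" where
  "tangent_at y \<longleftrightarrow>
    q y > 0 \<and> (V has_real_derivative m y * q y) (at y) \<and> (U has_real_derivative m y * p y) (at y) \<and>
    p y * V y = 2 * M * (w y - a y) / A y \<and> q y * U y = 2 * M * (w y + a y) / A y \<and>
    (q has_real_derivative m y * q y * (H - 2 * c / (\<rho> y)^3 +
      (1 / (2 * M) + 1 / \<rho> y) * (A y / (4 * M)) * U y * q y)) (at y)"

lemma A_pos: "y \<in> J \<Longrightarrow> A y > 0"
  using conf_pos[OF M \<rho>_pos] .

lemma A_UV: "y \<in> J \<Longrightarrow> A y * (U y * V y) = 8 * M^2 * ((w y - a y) * (w y + a y))"
proof -
  assume y: "y \<in> J"
  have "(w y - a y) * (w y + a y) = schw_h M (\<rho> y)"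
    using w2[OF y] by (simp add: power2_eq_square algebra_simps)
  then show ?thesis
    using UV[OF y] conf_psi[OF M \<rho>_pos[OF y]] by simp
qed

lemma q_V: "V y > 0 \<Longrightarrow> q y = V y / (4 * M * (w y - a y))"
  by (simp add: q_def)

text \<open>On the overlap \<open>U < 0 < V\<close> the two forms of \<open>q\<close> agree because
  \<open>A * U * V = 8 * M^2 * (w - a) * (w + a)\<close>.\<close>

lemma q_U:
  assumes "y \<in> J" "U y < 0"
  shows "q y = 2 * M * (w y + a y) / (A y * U y)"
proof (cases "V y > 0")
  case True
  then have nz: "A y * (U y * V y) \<noteq> 0"
    using A_pos[OF assms(1)] assms by simp
  then have "w y - a y \<noteq> 0" "A y * U y \<noteq> 0"
    using A_UV[OF assms(1)] by auto
  moreover have "V y * (A y * U y) = 2 * M * (w y + a y) * (4 * M * (w y - a y))"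
    using A_UV[OF assms(1)] by (simp add: power2_eq_square algebra_simps)
  ultimately show ?thesis
    using M by (simp add: q_V[OF True] frac_eq_eq)
qed (simp add: q_def)

text \<open>Only the equation for \<open>V\<close> is given. The equation for \<open>U\<close>
  follows from \<open>U = psi / V\<close> near \<open>y\<close>, and that for \<open>q\<close> from
  the quotient rule.\<close>

lemma V_tangent:
  assumes y: "y \<in> J" and V: "V y > 0" "w y - a y > 0"
    and dV: "(V has_real_derivative m y * V y / (4 * M * (w y - a y))) (at y)"
  shows "tangent_at y"
proof -
  define s where "s = w y - a y"
  have s: "s > 0"
    using V s_def by simp
  note Ap = A_pos[OF y] and rp = \<rho>_pos[OF y]
  have q: "q y = V y / (4 * M * s)" "q y > 0"
    using q_V[OF V(1)] V s M by (auto simp: s_def)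
  have dV': "(V has_real_derivative m y * q y) (at y)"
    using dV by (simp add: q s_def)
  have AUV: "A y * (U y * V y) = 8 * M^2 * (s * (w y + a y))"
    using A_UV[OF y] by (simp add: s_def)
  have pV: "p y * V y = 2 * M * s / A y"
    using V s M Ap by (simp add: p_def q field_simps)
  have qU: "q y * U y = 2 * M * (w y + a y) / A y"
  proof -
    have "q y * U y * (A y * (4 * M * s)) = A y * (U y * V y)"
      using s M by (simp add: q)
    also have "\<dots> = 2 * M * (w y + a y) * (4 * M * s)"
      unfolding AUV by (simp add: power2_eq_square)
    finally have "(q y * U y * A y) * (4 * M * s) = (2 * M * (w y + a y)) * (4 * M * s)"
      by (simp only: mult.assoc)
    then have "q y * U y * A y = 2 * M * (w y + a y)"
      using s M by (subst (asm) mult_cancel_right) auto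
    then show ?thesis
      using Ap by (simp add: field_simps)
  qed
  have cV: "isCont V y"
    using dV DERIV_isCont by blast
  have evV: "\<forall>\<^sub>F z in nhds y. V z > 0"
    using order_tendstoD(1)[OF cV[unfolded isCont_def] V(1)] V(1)
    by (auto simp: eventually_at_filter elim!: eventually_mono)
  have evJ: "\<forall>\<^sub>F z in nhds y. z \<in> J"
    using J(1) y eventually_nhds_in_open by blast
  have dpsi: "((\<lambda>z. psi M (\<rho> z)) has_real_derivative 4 * M / A y * (m y * w y)) (at y)"
    by (rule DERIV_chain2[OF psi_deriv[OF M rp] d\<rho>[OF y]])
  have "((\<lambda>z. psi M (\<rho> z) / V z) has_real_derivative m y * p y) (at y)"
  proof (rule DERIV_cong[OF DERIV_divide[OF dpsi dV']])
    have wa: "w y + a y = 2 * w y - s"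
      by (simp add: s_def)
    have "A y * psi M (\<rho> y) = 8 * M^2 * (s * (2 * w y - s))"
      using AUV unfolding wa UV[OF y] .
    then have psi: "psi M (\<rho> y) = 8 * M^2 * (s * (2 * w y - s)) / A y"
      using Ap by (simp add: field_simps)
    show "(4 * M / A y * (m y * w y) * V y - psi M (\<rho> y) * (m y * q y)) / (V y * V y) = m y * p y"
      unfolding psi p_def q(1) using V(1) s M Ap
      by (simp add: divide_simps) (simp add: algebra_simps power2_eq_square)
  qed (use V in simp)
  moreover have "\<forall>\<^sub>F z in nhds y. psi M (\<rho> z) / V z = U z"
    using evV evJ by eventually_elim (auto simp: UV[symmetric])
  ultimately have dU: "(U has_real_derivative m y * p y) (at y)"
    by (rule iffD1[OF DERIV_cong_ev[OF refl _ refl], rotated])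
  have ds: "((\<lambda>z. w z - a z) has_real_derivative m y * (M / (\<rho> y)^2 + (H - 2 * c / (\<rho> y)^3) * (a y - w y))) (at y)"
  proof (rule DERIV_cong[OF DERIV_diff[OF dw[OF y] DERIV_chain2[OF drift_deriv d\<rho>[OF y]]]])
  qed (use rp in \<open>auto simp: algebra_simps add_divide_distrib diff_divide_distrib\<close>)
  define Z where "Z = 1 / (2 * M) + 1 / \<rho> y"
  define a' where "a' = H - 2 * c / (\<rho> y)^3"
  have "((\<lambda>z. V z / (4 * M * (w z - a z))) has_real_derivative m y * q y * (a' + Z * (A y / (4 * M)) * U y * q y)) (at y)"
  proof (rule DERIV_cong[OF DERIV_divide[OF dV' DERIV_cmult[OF ds, of "4 * M"]]])
    have sw: "s * (w y + a y) = 1 - 2 * M / \<rho> y"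
      using w2[OF y] unfolding schw_h_def s_def by (simp add: power2_eq_square algebra_simps)
    \<comment> \<open>In \<open>(1 / (2 * M) + 1 / r) * (1 - 2 * M / r)\<close> the terms of order
      \<open>1 / r\<close> cancel. This matches the connection term with what the quotient rule for
      \<open>q\<close> produces.\<close>
    have "Z * (s * (w y + a y)) = 1 / (2 * M) - 2 * M / (\<rho> y)^2"
      unfolding sw Z_def using M rp by (simp add: field_simps power2_eq_square)
    then have Zs: "Z * (w y + a y) / 2 = (1 / (4 * M) - M / (\<rho> y)^2) / s"
      using s M rp by (simp add: field_simps)
    have "Z * (A y / (4 * M)) * U y * q y = Z * (A y / (4 * M)) * (q y * U y)"
      by simp
    also have "\<dots> = Z * (w y + a y) / 2"
      unfolding qU using M Ap by (simp add: field_simps)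
    finally have 1: "Z * (A y / (4 * M)) * U y * q y = (1 / (4 * M) - M / (\<rho> y)^2) / s"
      unfolding Zs .
    have aw: "a y - w y = - s"
      by (simp add: s_def)
    show "(m y * q y * (4 * M * (w y - a y)) - V y * (4 * M * (m y * (M / (\<rho> y)^2 + (H - 2 * c / (\<rho> y)^3) * (a y - w y))))) /
        (4 * M * (w y - a y) * (4 * M * (w y - a y))) = m y * q y * (a' + Z * (A y / (4 * M)) * U y * q y)"
      unfolding 1 aw s_def[symmetric] a'_def[symmetric] unfolding q(1) using s M rp
      by (simp add: divide_simps) (simp add: algebra_simps power2_eq_square)
  qed (use s M in \<open>auto simp: s_def\<close>)
  moreover have "\<forall>\<^sub>F z in nhds y. V z / (4 * M * (w z - a z)) = q z"
    using evV by eventually_elim (simp add: q_V)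
  ultimately have "(q has_real_derivative m y * q y * (a' + Z * (A y / (4 * M)) * U y * q y)) (at y)"
    by (rule iffD1[OF DERIV_cong_ev[OF refl _ refl], rotated])
  then show ?thesis
    using q dV' dU pV qU by (simp add: tangent_at_def s_def Z_def a'_def)
qed

lemma U_tangent:
  assumes y: "y \<in> J" and U: "U y < 0" "w y + a y < 0"
    and dU: "(U has_real_derivative m y * U y / (4 * M * (w y + a y))) (at y)"
  shows "tangent_at y"
proof -
  define s where "s = w y + a y"
  have s: "s < 0"
    using U s_def by simp
  note Ap = A_pos[OF y] and rp = \<rho>_pos[OF y]
  have q: "q y = 2 * M * s / (A y * U y)" "q y > 0"
    using q_U[OF y U(1)] U s M Ap by (auto simp: s_def zero_less_divide_iff mult_less_0_iff mult_pos_neg)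
  have p: "p y = U y / (4 * M * s)"
    using U s M Ap by (simp add: p_def q field_simps)
  have dU': "(U has_real_derivative m y * p y) (at y)"
    using dU by (simp add: p s_def)
  have AUV: "A y * (U y * V y) = 8 * M^2 * (s * (w y - a y))"
    using A_UV[OF y] by (simp add: s_def mult.commute)
  have qU: "q y * U y = 2 * M * s / A y"
    using U s M Ap by (simp add: q field_simps)
  have pV: "p y * V y = 2 * M * (w y - a y) / A y"
  proof -
    have "p y * V y * (A y * (4 * M * s)) = A y * (U y * V y)"
      using s M by (simp add: p)
    also have "\<dots> = 2 * M * (w y - a y) * (4 * M * s)"
      unfolding AUV by (simp add: power2_eq_square)
    finally have "(p y * V y * A y) * (4 * M * s) = (2 * M * (w y - a y)) * (4 * M * s)"
      by (simp only: mult.assoc)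
    then have "p y * V y * A y = 2 * M * (w y - a y)"
      using s M by (subst (asm) mult_cancel_right) auto
    then show ?thesis
      using Ap by (simp add: field_simps)
  qed
  have cU: "isCont U y"
    using dU DERIV_isCont by blast
  have evU: "\<forall>\<^sub>F z in nhds y. U z < 0"
    using order_tendstoD(2)[OF cU[unfolded isCont_def] U(1)] U(1)
    by (auto simp: eventually_at_filter elim!: eventually_mono)
  have evJ: "\<forall>\<^sub>F z in nhds y. z \<in> J"
    using J(1) y eventually_nhds_in_open by blast
  have dpsi: "((\<lambda>z. psi M (\<rho> z)) has_real_derivative 4 * M / A y * (m y * w y)) (at y)"
    by (rule DERIV_chain2[OF psi_deriv[OF M rp] d\<rho>[OF y]])
  have "((\<lambda>z. psi M (\<rho> z) / U z) has_real_derivative m y * q y) (at y)"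
  proof (rule DERIV_cong[OF DERIV_divide[OF dpsi dU']])
    have wa: "w y - a y = 2 * w y - s"
      by (simp add: s_def)
    have "A y * psi M (\<rho> y) = 8 * M^2 * (s * (2 * w y - s))"
      using AUV unfolding wa UV[OF y] .
    then have psi: "psi M (\<rho> y) = 8 * M^2 * (s * (2 * w y - s)) / A y"
      using Ap by (simp add: field_simps)
    show "(4 * M / A y * (m y * w y) * U y - psi M (\<rho> y) * (m y * p y)) / (U y * U y) = m y * q y"
      unfolding psi p q(1) using U(1) s M Ap
      by (simp add: divide_simps) (simp add: algebra_simps power2_eq_square)
  qed (use U in simp)
  moreover have "\<forall>\<^sub>F z in nhds y. psi M (\<rho> z) / U z = V z"
    using evU evJ by eventually_elim (auto simp: UV[symmetric])
  ultimately have dV: "(V has_real_derivative m y * q y) (at y)"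
    by (rule iffD1[OF DERIV_cong_ev[OF refl _ refl], rotated])
  define Z where "Z = 1 / (2 * M) + 1 / \<rho> y"
  define a' where "a' = H - 2 * c / (\<rho> y)^3"
  have ds: "((\<lambda>z. w z + a z) has_real_derivative m y * (M / (\<rho> y)^2 + a' * s)) (at y)"
  proof (rule DERIV_cong[OF DERIV_add[OF dw[OF y] DERIV_chain2[OF drift_deriv d\<rho>[OF y]]]])
  qed (use rp in \<open>auto simp: algebra_simps add_divide_distrib a'_def s_def\<close>)
  have dA: "((\<lambda>z. A z) has_real_derivative - Z * A y * (m y * w y)) (at y)"
    using DERIV_chain2[OF conf_deriv[OF M rp] d\<rho>[OF y]] by (simp add: Z_def)
  have "((\<lambda>z. (2 * M * (w z + a z)) / (A z * U z)) has_real_derivative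
      m y * q y * (a' + Z * (A y / (4 * M)) * U y * q y)) (at y)"
  proof (rule DERIV_cong[OF DERIV_divide[OF DERIV_cmult[OF ds, of "2 * M"] DERIV_mult[OF dA dU']]])
    have sw: "s * (w y - a y) = 1 - 2 * M / \<rho> y"
      using w2[OF y] unfolding schw_h_def s_def by (simp add: power2_eq_square algebra_simps)
    have "Z * (s * (w y - a y)) = 1 / (2 * M) - 2 * M / (\<rho> y)^2"
      unfolding sw Z_def using M rp by (simp add: field_simps power2_eq_square)
    then have "M / (\<rho> y)^2 = 1 / (4 * M) - Z * (s * (w y - a y)) / 2"
      using M rp by (simp add: field_simps)
    also have "w y - a y = 2 * w y - s"
      by (simp add: s_def)
    finally have Zs: "M / (\<rho> y)^2 = 1 / (4 * M) - Z * (s * (2 * w y - s)) / 2" .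
    have "Z * (A y / (4 * M)) * U y * q y = Z * (A y / (4 * M)) * (q y * U y)"
      by simp
    also have "\<dots> = Z * s / 2"
      unfolding qU using M Ap by (simp add: field_simps)
    finally have 1: "Z * (A y / (4 * M)) * U y * q y = Z * s / 2" .
    show "(2 * M * (m y * (M / (\<rho> y)^2 + a' * s)) * (A y * U y) -
        2 * M * (w y + a y) * (- Z * A y * (m y * w y) * U y + m y * p y * A y)) / (A y * U y * (A y * U y)) =
        m y * q y * (a' + Z * (A y / (4 * M)) * U y * q y)"
      unfolding 1 Zs s_def[symmetric] unfolding q(1) p using s M Ap U(1)
      by (simp add: divide_simps) (simp add: algebra_simps power2_eq_square)
  qed (use Ap U in auto)
  moreover have "\<forall>\<^sub>F z in nhds y. (2 * M * (w z + a z)) / (A z * U z) = q z"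
    using evU evJ by eventually_elim (simp add: q_U)
  ultimately have "(q has_real_derivative m y * q y * (a' + Z * (A y / (4 * M)) * U y * q y)) (at y)"
    by (rule iffD1[OF DERIV_cong_ev[OF refl _ refl], rotated])
  then show ?thesis
    using q dV dU' pV qU by (simp add: tangent_at_def s_def Z_def a'_def)
qed

lemma curve:
  assumes "y \<in> J"
  shows q_pos: "q y > 0" and dV: "(V has_real_derivative m y * q y) (at y)"
    and dU: "(U has_real_derivative m y * p y) (at y)"
    and pV: "p y * V y = 2 * M * (w y - a y) / A y" and qU: "q y * U y = 2 * M * (w y + a y) / A y"
    and dq: "(q has_real_derivative m y * q y * (H - 2 * c / (\<rho> y)^3 +
      (1 / (2 * M) + 1 / \<rho> y) * (A y / (4 * M)) * U y * q y)) (at y)"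
  using branch[OF assms] V_tangent[OF assms] U_tangent[OF assms]
  unfolding tangent_at_def by blast+

lemma V_strict_mono:
  assumes "x \<in> J" "y \<in> J" "x < y"
  shows "V x < V y"
proof (rule DERIV_pos_imp_increasing[OF assms(3)])
  fix z assume "x \<le> z" "z \<le> y"
  then have "z \<in> J"
    using J(2) assms by (metis atLeastAtMost_iff connected_contains_Icc subsetD)
  then show "\<exists>d. (V has_real_derivative d) (at z) \<and> 0 < d"
    using dV m_pos q_pos by (meson mult_pos_pos)
qed

lemma inj_V: "inj_on V J"
  using V_strict_mono by (metis inj_onI linorder_neqE_linordered_idom order_less_irrefl)

lemma continuous_V: "continuous_on J V"
  using DERIV_isCont[OF dV] by (simp add: continuous_on_eq_continuous_at[OF J(1)])

lemma open_V_image: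
  assumes "open B" "B \<subseteq> J"
  shows "open (V ` B)"
  using injective_eq_1d_open_map_UNIV[OF continuous_V] J(2) inj_V assms is_interval_connected_1 by blast

definition \<sigma> :: "real \<Rightarrow> real" where "\<sigma> = inv_into J V"

lemma \<sigma>_V: "y \<in> J \<Longrightarrow> \<sigma> (V y) = y"
  by (simp add: \<sigma>_def inj_V)

lemma d\<sigma>:
  assumes "y \<in> J"
  shows "(\<sigma> has_real_derivative 1 / (m y * q y)) (at (V y))"
  unfolding has_field_derivative_def
proof (rule has_derivative_inverse_strong[OF J(1) assms continuous_V \<sigma>_V])
  show "(V has_derivative (*) (m y * q y)) (at y)"
    using dV[OF assms] by (simp add: has_field_derivative_def)
  show "(*) (m y * q y) \<circ> (*) (1 / (m y * q y)) = id"
    using m_pos[OF assms] q_pos[OF assms] by auto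
qed

definition \<phi> :: "real \<Rightarrow> real" where "\<phi> v = U (\<sigma> v)"

lemma \<phi>_V: "y \<in> J \<Longrightarrow> \<phi> (V y) = U y"
  by (simp add: \<phi>_def \<sigma>_V)

text \<open>As \<open>V\<close> increases with rate \<open>m * q\<close>, it serves as parameter.
  The sum of the equations for \<open>p * V\<close> and \<open>q * U\<close> gives the derivative
  \<open>w\<close> of the radius, their difference the normal derivative, the drift.\<close>

lemma profile_curve: "profile M H c (V ` J) \<phi> (\<lambda>v. p (\<sigma> v)) (\<lambda>v. q (\<sigma> v)) (\<lambda>v. \<rho> (\<sigma> v))"
proof
  show "open (V ` J)"
    using open_V_image J by blast
  fix v assume "v \<in> V ` J"
  then obtain y where y: "y \<in> J" "v = V y"
    by blast
  have \<sigma>: "\<sigma> v = y"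
    using \<sigma>_V y by simp
  have d\<sigma>': "(\<sigma> has_real_derivative 1 / (m y * q y)) (at v)"
    using d\<sigma> y by simp
  have chain: "((\<lambda>v. f (\<sigma> v)) has_real_derivative D * (1 / (m y * q y))) (at v)"
    if "(f has_real_derivative D) (at y)" for f D
    by (rule DERIV_chain2[OF _ d\<sigma>']) (use that \<sigma> in simp)
  note pos = m_pos[OF y(1)] q_pos[OF y(1)] A_pos[OF y(1)] \<rho>_pos[OF y(1)]
  note pV = pV[OF y(1)] and qU = qU[OF y(1)]
  show "\<rho> (\<sigma> v) > 0" "q (\<sigma> v) > 0" "p (\<sigma> v) > 0" "2 * conf M (\<rho> (\<sigma> v)) * p (\<sigma> v) * q (\<sigma> v) = 1"
    using pos by (simp_all add: \<sigma> p_def)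
  show "\<phi> v * v = psi M (\<rho> (\<sigma> v))"
    using UV y by (simp add: \<phi>_def \<sigma>_V)
  have pv: "p (\<sigma> v) * v = 2 * M * (w y - a y) / A y"
    unfolding \<sigma> unfolding y(2) by (rule pV)
  have qu: "q (\<sigma> v) * \<phi> v = 2 * M * (w y + a y) / A y"
    unfolding \<sigma> \<phi>_def by (rule qU)
  have sum: "conf M (\<rho> (\<sigma> v)) / (4 * M) * (p (\<sigma> v) * v + q (\<sigma> v) * \<phi> v) = w y"
    unfolding pv qu unfolding \<sigma> using pos M by (simp add: field_simps)
  show "(\<phi> has_real_derivative p (\<sigma> v) / q (\<sigma> v)) (at v)"
    unfolding \<phi>_def by (rule DERIV_cong[OF chain[OF dU[OF y(1)]]]) (use pos in \<open>simp add: \<sigma>\<close>)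
  show "((\<lambda>v. \<rho> (\<sigma> v)) has_real_derivative
      conf M (\<rho> (\<sigma> v)) / (4 * M) * (p (\<sigma> v) * v + q (\<sigma> v) * \<phi> v) / q (\<sigma> v)) (at v)"
    unfolding sum by (rule DERIV_cong[OF chain[OF d\<rho>[OF y(1)]]]) (use pos in \<open>simp add: \<sigma>\<close>)
  show "conf M (\<rho> (\<sigma> v)) / (4 * M) * (q (\<sigma> v) * \<phi> v - p (\<sigma> v) * v) = H * \<rho> (\<sigma> v) + c / (\<rho> (\<sigma> v))^2"
    unfolding pv qu unfolding \<sigma> drift_def[symmetric] using pos M by (simp add: field_simps)
  show "((\<lambda>v. q (\<sigma> v)) has_real_derivative H - 2 * c / (\<rho> (\<sigma> v))^3 +
      (1 / (2 * M) + 1 / \<rho> (\<sigma> v)) * (conf M (\<rho> (\<sigma> v)) / (4 * M)) * \<phi> v * q (\<sigma> v)) (at v)"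
    by (rule DERIV_cong[OF chain[OF dq[OF y(1)]]]) (use pos in \<open>simp add: \<sigma> \<phi>_def\<close>)
qed (rule M)

sublocale prof: profile M H c "V ` J" \<phi> "\<lambda>v. p (\<sigma> v)" "\<lambda>v. q (\<sigma> v)" "\<lambda>v. \<rho> (\<sigma> v)"
  by (rule profile_curve)

section \<open>Pieces of the hypersurface over sets of parameters\<close>

definition sheet :: "real set \<Rightarrow> event set" where "sheet B = tube \<phi> (V ` B)"

lemma sheet_eq: "B \<subseteq> J \<Longrightarrow> sheet B = {((U y, V y), \<omega>) |y \<omega>. y \<in> B \<and> \<omega> \<in> sphere 0 1}"
  by (force simp: sheet_def tube_def \<phi>_V)

lemma sheet_Un: "sheet (C \<union> B) = sheet C \<union> sheet B"
  by (simp add: sheet_def image_Un tube_Un)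

lemma ss_cmc_sheet:
  assumes "open B" "B \<subseteq> J"
  shows "ss_cmc M H (sheet B)"
  unfolding sheet_def
  by (rule profile.ss_cmc_tube[OF prof.profile_subset]) (use assms open_V_image in auto)

lemma has_ends_sheet: "has_ends (sheet J) 2"
  unfolding sheet_def
  by (intro has_ends_tube prof.continuous_on_profile open_V_image connected_continuous_image continuous_V)
     (use J in auto)

lemma continuous_U: "y \<in> J \<Longrightarrow> isCont U y"
  using DERIV_isCont[OF dU] .

text \<open>The area radius is continuous and positive on the spacetime, so a limit point there
  brings a convergent sequence of radii with positive limit. What remains is a compactness question
  about the parameters.\<close>

lemma closed_sheet:
  assumes lim: "\<And>s r0 U0 V0. (\<And>n. s n \<in> J) \<Longrightarrow> r0 > 0 \<Longrightarrow> (\<lambda>n. \<rho> (s n)) \<longlonglongrightarrow> r0 \<Longrightarrow>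
      (\<lambda>n. U (s n)) \<longlonglongrightarrow> U0 \<Longrightarrow> (\<lambda>n. V (s n)) \<longlonglongrightarrow> V0 \<Longrightarrow> U0 * V0 = psi M r0 \<Longrightarrow>
      \<exists>y\<in>J. \<exists>k. strict_mono k \<and> (\<lambda>n. s (k n)) \<longlonglongrightarrow> y"
  shows "closedin (top_of_set (kruskal M)) (sheet J)"
  unfolding closedin_limpt
proof (intro conjI allI impI)
  show "sheet J \<subseteq> kruskal M"
    unfolding sheet_def by (rule prof.tube_subset_kruskal)
  fix x assume x: "x islimpt sheet J \<and> x \<in> kruskal M"
  then obtain X where X: "\<And>n. X n \<in> sheet J" "X \<longlonglongrightarrow> x"
    unfolding islimpt_sequential by blast
  have "\<exists>y. y \<in> J \<and> fst (X n) = (U y, V y)" for n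
    using X(1)[of n] unfolding sheet_eq[OF order_refl] by auto
  then obtain s where s: "\<And>n. s n \<in> J" "\<And>n. fst (X n) = (U (s n), V (s n))"
    by metis
  obtain U0 V0 \<omega> where x_eq: "x = ((U0, V0), \<omega>)"
    by (metis surj_pair)
  have UVx: "U0 * V0 > - 2 * M" "\<omega> \<in> sphere 0 1"
    using x by (auto simp: x_eq kruskal_def)
  have lims: "(\<lambda>n. U (s n)) \<longlonglongrightarrow> U0" "(\<lambda>n. V (s n)) \<longlonglongrightarrow> V0"
    using tendsto_fst[OF tendsto_fst[OF X(2)]] tendsto_snd[OF tendsto_fst[OF X(2)]]
    by (simp_all add: s x_eq)
  define r0 where "r0 = area_radius M (U0 * V0) 1"
  have r0: "r0 > 0" "psi M r0 = U0 * V0"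
    using area_radius[OF M, of "U0 * V0" 1] UVx by (auto simp: r0_def)
  have "\<rho> (s n) = area_radius M (U (s n) * V (s n)) 1" for n
    using area_radius_unique[OF M \<rho>_pos[OF s(1)], of n "U (s n) * V (s n)" 1] UV[OF s(1)] by simp
  moreover have "isCont (\<lambda>t. area_radius M t 1) (U0 * V0)"
    using area_radius_deriv[OF M UVx(1)] DERIV_isCont by blast
  then have "(\<lambda>n. area_radius M (U (s n) * V (s n)) 1) \<longlonglongrightarrow> r0"
    unfolding r0_def by (rule isCont_tendsto_compose) (intro tendsto_mult lims)
  ultimately have "(\<lambda>n. \<rho> (s n)) \<longlonglongrightarrow> r0"
    by simp
  then obtain y k where y: "y \<in> J" and k: "strict_mono k" "(\<lambda>n. s (k n)) \<longlonglongrightarrow> y"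
    using lim[OF s(1) r0(1) _ lims] r0(2) by metis
  have "(\<lambda>n. U (s (k n))) \<longlonglongrightarrow> U y" "(\<lambda>n. V (s (k n))) \<longlonglongrightarrow> V y"
    using isCont_tendsto_compose[OF continuous_U[OF y] k(2)]
      isCont_tendsto_compose[OF DERIV_isCont[OF dV[OF y]] k(2)] by auto
  moreover have "(\<lambda>n. U (s (k n))) \<longlonglongrightarrow> U0" "(\<lambda>n. V (s (k n))) \<longlonglongrightarrow> V0"
    using LIMSEQ_subseq_LIMSEQ[OF lims(1) k(1)] LIMSEQ_subseq_LIMSEQ[OF lims(2) k(1)]
    by (simp_all add: comp_def)
  ultimately have "U0 = U y" "V0 = V y"
    using LIMSEQ_unique by blast+
  then show "x \<in> sheet J"
    unfolding sheet_eq[OF order_refl] x_eq using y UVx by blast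
qed

lemma V_image_greater: "b \<in> J \<Longrightarrow> V ` {y \<in> J. b < y} \<subseteq> {V b<..}"
  and V_image_less: "b \<in> J \<Longrightarrow> V ` {y \<in> J. y < b} \<subseteq> {..<V b}"
  using V_strict_mono by auto

text \<open>\<open>V\<close> is increasing and open, so openness of the union with \<open>b\<close>
  forces \<open>C\<close> and \<open>B\<close> to fill both sides of \<open>V b\<close> near that
  point.\<close>

lemma sheets_meet:
  assumes b: "b \<in> J" and C: "C \<subseteq> {y \<in> J. b < y}" and B: "B \<subseteq> {y \<in> J. y < b}"
    and op: "open (C \<union> B \<union> {b})"
  shows "closure (V ` C) \<inter> closure (V ` B) \<inter> (V ` J) = {V b}"
proof -
  have sub: "C \<union> B \<union> {b} \<subseteq> J"
    using assms by auto
  obtain e where e: "e > 0" "ball (V b) e \<subseteq> V ` (C \<union> B \<union> {b})"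
    using open_V_image[OF op sub] open_contains_ball by blast
  have in_ball: "z \<in> V ` (C \<union> B \<union> {b})" if "V b < z \<and> z < V b + e \<or> V b - e < z \<and> z < V b" for z
  proof -
    have "z \<in> ball (V b) e"
      using that e(1) by (auto simp: dist_real_def)
    then show ?thesis
      using e(2) by blast
  qed
  have 1: "{V b<..<V b + e} \<subseteq> V ` C"
  proof
    fix z assume z: "z \<in> {V b<..<V b + e}"
    then obtain y where "y \<in> C \<union> B \<union> {b}" "z = V y"
      using in_ball[of z] by auto
    moreover have "y \<notin> B"
      using V_image_less[OF b] B z \<open>z = V y\<close> by fastforce
    ultimately show "z \<in> V ` C"
      using z by auto
  qed
  have 2: "{V b - e<..<V b} \<subseteq> V ` B"
  proof
    fix z assume z: "z \<in> {V b - e<..<V b}"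
    then obtain y where "y \<in> C \<union> B \<union> {b}" "z = V y"
      using in_ball[of z] by auto
    moreover have "y \<notin> C"
      using V_image_greater[OF b] C z \<open>z = V y\<close> by fastforce
    ultimately show "z \<in> V ` B"
      using z by auto
  qed
  show ?thesis
    using closure_meet[OF _ _ _ e(1) 1 2, of "V ` J"] b C B
      V_image_less[OF b] V_image_greater[OF b] by blast
qed

lemma join_sheets:
  assumes closed: "closedin (top_of_set (kruskal M)) (sheet J)"
    and b: "b \<in> J" and C: "C \<subseteq> {y \<in> J. b < y}" and B: "B \<subseteq> {y \<in> J. y < b}"
    and op: "open (C \<union> B \<union> {b})" and r: "\<rho> b = 2 * M"
  shows "join M (sheet C) (sheet B) = sheet (C \<union> B \<union> {b})"
    and "connects_smoothly M (sheet C) (sheet B)"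
proof -
  have UV0: "\<phi> (V b) * V b = 0"
    using UV[OF b] r by (simp add: \<phi>_V[OF b] psi_def)
  have sub: "V ` C \<subseteq> V ` J" "V ` B \<subseteq> V ` J" "C \<union> B \<union> {b} \<subseteq> J"
    using assms by auto
  have un: "V ` C \<union> V ` B \<union> {V b} = V ` (C \<union> B \<union> {b})"
    by auto
  have op': "open (V ` C \<union> V ` B \<union> {V b})"
    unfolding un by (rule open_V_image[OF op sub(3)])
  note meet = sheets_meet[OF b C B op]
  show "join M (sheet C) (sheet B) = sheet (C \<union> B \<union> {b})"
    using prof.join_tube[OF closed[unfolded sheet_def] sub(1,2) meet UV0] by (simp only: sheet_def un)
  show "connects_smoothly M (sheet C) (sheet B)"
    using prof.connects_tube[OF closed[unfolded sheet_def] sub(1,2) meet UV0 op'] by (simp only: sheet_def)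
qed

section \<open>Killing time along the curve\<close>

definition \<tau> :: "real \<Rightarrow> real" where "\<tau> y = killing_time M (U y) (V y)"

text \<open>The derivative is \<open>2 * M * m * (q / V - p / U)\<close>; the two quotients are
  \<open>w + a\<close> and \<open>w - a\<close> over \<open>4 * M * h\<close>, so \<open>w\<close>
  cancels.\<close>

lemma d\<tau>:
  assumes y: "y \<in> J" and r: "\<rho> y \<noteq> 2 * M"
  shows "(\<tau> has_real_derivative m y * a y / schw_h M (\<rho> y)) (at y)"
proof -
  note Ap = A_pos[OF y] and rp = \<rho>_pos[OF y]
  have h: "schw_h M (\<rho> y) \<noteq> 0"
    using schw_h_zero_iff[OF M rp] r by simp
  then have "psi M (\<rho> y) \<noteq> 0"
    using conf_psi[OF M rp] M by auto
  then have nz: "U y \<noteq> 0" "V y \<noteq> 0"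
    using UV[OF y] by auto
  have hh: "(w y - a y) * (w y + a y) = schw_h M (\<rho> y)"
    using w2[OF y] by (simp add: power2_eq_square algebra_simps)
  have AUV: "A y * (U y * V y) = 8 * M^2 * schw_h M (\<rho> y)"
    using A_UV[OF y] hh by simp
  have q: "q y / V y = (w y + a y) / (4 * M * schw_h M (\<rho> y))"
  proof -
    have "q y / V y = (q y * U y) * A y / (A y * (U y * V y))"
      using nz Ap by simp
    also have "\<dots> = (w y + a y) / (4 * M * schw_h M (\<rho> y))"
      unfolding AUV qU[OF y] using Ap M h by (simp add: field_simps power2_eq_square)
    finally show ?thesis .
  qed
  have p: "p y / U y = (w y - a y) / (4 * M * schw_h M (\<rho> y))"
  proof -
    have "p y / U y = (p y * V y) * A y / (A y * (U y * V y))"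
      using nz Ap by simp
    also have "\<dots> = (w y - a y) / (4 * M * schw_h M (\<rho> y))"
      unfolding AUV pV[OF y] using Ap M h by (simp add: field_simps power2_eq_square)
    finally show ?thesis .
  qed
  \<comment> \<open>This holds even where \<open>U\<close> or \<open>V\<close> vanishes, because
    both division by 0 and \<open>ln 0\<close> have the value 0.\<close>
  have \<tau>_eq: "\<tau> = (\<lambda>y. M * ln ((V y / U y)^2))"
  proof
    fix z
    have "ln ((V z / U z)^2) = 2 * ln \<bar>V z / U z\<bar>"
      by (metis ln_realpow abs_ge_zero power2_abs of_nat_numeral order_le_less ln_0 mult_zero_right power_zero_numeral)
    then show "\<tau> z = M * ln ((V z / U z)^2)"
      by (simp add: \<tau>_def killing_time_def)
  qed
  have "((\<lambda>y. V y / U y) has_real_derivative (m y * q y * U y - V y * (m y * p y)) / (U y * U y)) (at y)"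
    by (rule DERIV_divide[OF dV[OF y] dU[OF y] nz(1)])
  then have "(\<tau> has_real_derivative M * (1 / (V y / U y)^2 *
      (2 * (V y / U y) * ((m y * q y * U y - V y * (m y * p y)) / (U y * U y))))) (at y)"
    unfolding \<tau>_eq by (rule ln_square_deriv) (use nz in simp)
  also have "M * (1 / (V y / U y)^2 * (2 * (V y / U y) *
      ((m y * q y * U y - V y * (m y * p y)) / (U y * U y)))) = 2 * M * m y * (q y / V y - p y / U y)"
    using nz by (simp add: field_simps power2_eq_square)
  also have "\<dots> = m y * a y / schw_h M (\<rho> y)"
    unfolding q p using M h by (simp add: field_simps)
  finally show ?thesis .
qed

text \<open>Inside one region the signs of \<open>U\<close> and \<open>V\<close> are fixed, the
  radius determines \<open>U * V\<close>, and the Killing time determines the absolute value of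
  \<open>V / U\<close>. So radius and time determine the point.\<close>

lemma graph_in_sheet:
  assumes B: "B \<subseteq> J" and Q: "Q \<in> {region_I, region_II, region_I'}"
    and BQ: "\<And>y. y \<in> B \<Longrightarrow> (U y, V y) \<in> Q" and D: "\<rho> ` B = D"
    and f: "\<And>y. y \<in> B \<Longrightarrow> f (\<rho> y) = \<tau> y"
  shows "graph_in M Q D f = sheet B"
proof (intro equalityI subsetI)
  fix x assume "x \<in> sheet B"
  then obtain y \<omega> where y: "y \<in> B" and w: "\<omega> \<in> sphere 0 1" and x: "x = ((U y, V y), \<omega>)"
    using sheet_eq[OF B] by auto
  have "x \<in> kruskal M"
    using prof.tube_subset_kruskal \<open>x \<in> sheet B\<close> B tube_mono[of "V ` B" "V ` J" \<phi>]
    by (auto simp: sheet_def)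
  moreover have "area_radius M (U y) (V y) = \<rho> y"
    using area_radius_unique[OF M \<rho>_pos] UV y B by (metis subsetD)
  ultimately show "x \<in> graph_in M Q D f"
    using BQ[OF y] f[OF y] y D by (auto simp: graph_in_def x \<tau>_def)
next
  fix x assume x: "x \<in> graph_in M Q D f"
  then obtain u v \<omega> where x_eq: "x = ((u, v), \<omega>)" and k: "x \<in> kruskal M" and uvQ: "(u, v) \<in> Q"
    and r: "area_radius M u v \<in> D" and kt: "killing_time M u v = f (area_radius M u v)"
    by (auto simp: graph_in_def)
  obtain y where y: "y \<in> B" "area_radius M u v = \<rho> y"
    using r D by blast
  have "y \<in> J"
    using y B by blast
  have w: "\<omega> \<in> sphere 0 1"
    using k by (auto simp: x_eq kruskal_def)
  have uv: "u * v = U y * V y"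
    using psi_area_radius[OF M, of u v] k y(2) UV[OF \<open>y \<in> J\<close>] by (auto simp: x_eq kruskal_def)
  have sg: "(0 < u \<and> 0 < U y \<or> u < 0 \<and> U y < 0) \<and> (0 < v \<and> 0 < V y \<or> v < 0 \<and> V y < 0)"
    using uvQ BQ[OF y(1)] Q by (auto simp: region_I_def region_II_def region_I'_def)
  have "2 * M * ln \<bar>v / u\<bar> = 2 * M * ln \<bar>V y / U y\<bar>"
    using kt f[OF y(1)] y(2) by (simp add: killing_time_def \<tau>_def)
  then have "ln \<bar>v / u\<bar> = ln \<bar>V y / U y\<bar>"
    using M by simp
  moreover have "\<bar>v / u\<bar> > 0" "\<bar>V y / U y\<bar> > 0"
    using sg by (auto simp: zero_less_divide_iff divide_less_0_iff)
  ultimately have "\<bar>v / u\<bar> = \<bar>V y / U y\<bar>"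
    using ln_inj_iff by blast
  moreover have "v / u * (V y / U y) > 0"
    using sg by (auto simp: zero_less_mult_iff zero_less_divide_iff divide_less_0_iff)
  moreover have "x = z" if "\<bar>x\<bar> = \<bar>z\<bar>" "x * z > 0" for x z :: real
    using that by (auto simp: abs_if zero_less_mult_iff split: if_splits)
  ultimately have "v / u = V y / U y"
    by blast
  then have "v * U y = V y * u"
    using sg by (auto simp: field_simps)
  then have "(v * v) * U y = V y * (u * v)"
    by (simp add: mult_ac)
  also have "\<dots> = (V y * V y) * U y"
    unfolding uv by (simp add: mult_ac)
  finally have "v * v = V y * V y"
    using sg by auto
  then have "v = V y"
    using sg by (auto simp: square_eq_iff)
  moreover from this have "u = U y"
    using uv sg by auto
  ultimately show "x \<in> sheet B"
    using y w by (auto simp: sheet_eq[OF B] x_eq)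
qed

end

section \<open>The height functions as integrals\<close>

text \<open>The common value \<open>dt / dr\<close> for \<open>f1\<close> and \<open>f2s\<close>.\<close>

definition slope :: "real \<Rightarrow> real \<Rightarrow> real \<Rightarrow> real \<Rightarrow> real" where
  "slope M H c x = drift H c x / (schw_h M x * sqrt (schw_h M x + (drift H c x)^2))"

lemma f1_integrand_eq:
  assumes "M > 0" "x > 2 * M"
  shows "l1 M H c x / schw_h M x * (1 / sqrt (1 + (l1 M H c x)^2)) = slope M H c x"
proof -
  have h: "schw_h M x > 0"
    using assms schw_h_pos_iff by simp
  have l1: "l1 M H c x = drift H c x / sqrt (schw_h M x)"
    by (simp add: l1_def drift_def)
  have "1 + (l1 M H c x)^2 = (schw_h M x + (drift H c x)^2) / schw_h M x"
    unfolding l1 using h by (simp add: power_divide field_simps)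
  then have "sqrt (1 + (l1 M H c x)^2) = sqrt (schw_h M x + (drift H c x)^2) / sqrt (schw_h M x)"
    by (simp add: real_sqrt_divide)
  then show ?thesis
    unfolding slope_def using h by (simp add: l1)
qed

text \<open>Both the drift and \<open>h\<close> are negative here: the root of the squared drift is
  its negative, and this sign cancels that of \<open>- h\<close>, giving the same quotient as in
  region I.\<close>

lemma f2_integrand_eq:
  assumes "M > 0" "0 < x" "x < 2 * M" "drift H c x < 0" "schw_h M x + (drift H c x)^2 > 0"
  shows "f2_integrand M H c x = slope M H c x"
proof -
  have h: "schw_h M x < 0"
    using assms schw_h_neg_iff by simp
  have "l2 M H c x = - drift H c x / sqrt (- schw_h M x)"
    by (simp add: l2_def drift_def)
  then have l2: "(l2 M H c x)^2 = (drift H c x)^2 / (- schw_h M x)"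
    using h by (simp add: power_divide)
  have "(l2 M H c x)^2 - 1 = (schw_h M x + (drift H c x)^2) / (- schw_h M x)"
    unfolding l2 using h by (simp add: field_simps)
  then have "(l2 M H c x)^2 / ((l2 M H c x)^2 - 1) = (drift H c x)^2 / (schw_h M x + (drift H c x)^2)"
    unfolding l2 using h by simp
  then have "sqrt ((l2 M H c x)^2 / ((l2 M H c x)^2 - 1)) =
      - drift H c x / sqrt (schw_h M x + (drift H c x)^2)"
    using assms by (simp add: real_sqrt_divide)
  then show ?thesis
    by (simp add: f2_integrand_def slope_def)
qed

lemma isCont_slope:
  assumes "M > 0" "x > 0" "x \<noteq> 2 * M" "schw_h M x + (drift H c x)^2 > 0"
  shows "isCont (slope M H c) x"
proof -
  have "schw_h M x \<noteq> 0"
    using schw_h_zero_iff assms by auto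
  then show ?thesis
    unfolding slope_def using assms
    by (intro continuous_intros DERIV_isCont[OF drift_deriv] DERIV_isCont[OF schw_h_deriv]) auto
qed

lemma interval_integral_cong_real:
  fixes a b :: real
  assumes "\<And>z. min a b < z \<Longrightarrow> z < max a b \<Longrightarrow> f z = g z"
  shows "(LBINT x=a..b. f x) = (LBINT x=a..b. g x)"
  by (rule interval_integral_cong)
     (use assms in \<open>auto simp: einterval_iff min_def max_def split: if_splits\<close>)

lemma slope_outer_integral:
  assumes "M > 0" "r1 > 2 * M" "x > 2 * M"
    and F: "\<And>x. x > 2 * M \<Longrightarrow> (F has_real_derivative slope M H c x) (at x)"
  shows "(LBINT x=r1..x. slope M H c x) = F x - F r1"
proof (rule interval_integral_FTC_finite)
  have gt: "z > 2 * M" if "min r1 x \<le> z" for z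
    using assms that by (auto simp: min_def split: if_splits)
  have "schw_h M z > 0" if "z > 2 * M" for z
    using schw_h_pos_iff assms(1) that by simp
  then have "isCont (slope M H c) z" if "min r1 x \<le> z" for z
    using gt[OF that] assms(1) by (intro isCont_slope add_pos_nonneg) auto
  then show "continuous_on {min r1 x..max r1 x} (slope M H c)"
    by (intro continuous_at_imp_continuous_on) auto
  show "(F has_vector_derivative slope M H c z) (at z within {min r1 x..max r1 x})"
    if "min r1 x \<le> z" for z
    using F[OF gt[OF that]] has_vector_derivative_at_within
    by (auto simp: has_real_derivative_iff_has_vector_derivative)
qed

lemma f1_eq:
  assumes "M > 0" "r1 > 2 * M" "x > 2 * M"
    and F: "\<And>x. x > 2 * M \<Longrightarrow> (F has_real_derivative slope M H c x) (at x)"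
  shows "f1 M H r1 c cb x = F x - F r1 + cb"
proof -
  have "(LBINT x=r1..x. l1 M H c x / schw_h M x * (1 / sqrt (1 + (l1 M H c x)^2))) =
      (LBINT x=r1..x. slope M H c x)"
    by (rule interval_integral_cong_real, rule f1_integrand_eq) (use assms in auto)
  then show ?thesis
    using slope_outer_integral[of M r1 x F H c] assms by (simp add: f1_def)
qed

lemma f3_eq:
  assumes "M > 0" "r3 > 2 * M" "x > 2 * M"
    and F: "\<And>x. x > 2 * M \<Longrightarrow> (F has_real_derivative slope M H c x) (at x)"
  shows "f3 M H r3 c cb x = F r3 - F x + cb"
proof -
  have "(LBINT x=r3..x. l3 M H c x / schw_h M x * (1 / sqrt (1 + (l3 M H c x)^2))) =
      (LBINT x=r3..x. - slope M H c x)"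
    using assms by (intro interval_integral_cong_real) (simp add: l3_def flip: f1_integrand_eq)
  also have "\<dots> = - (F x - F r3)"
    using slope_outer_integral[of M r3 x F H c] assms
    by (simp add: interval_lebesgue_integral_uminus)
  finally show ?thesis
    unfolding f3_def by simp
qed

lemma f2s_eq:
  assumes "M > 0" "lo \<ge> 0" and D: "r2 \<in> {lo<..<2 * M}" "x \<in> {lo<..<2 * M}"
    and pos: "\<And>x. x \<in> {lo<..<2 * M} \<Longrightarrow> drift H c x < 0 \<and> schw_h M x + (drift H c x)^2 > 0"
    and F: "\<And>x. x \<in> {lo<..<2 * M} \<Longrightarrow> (F has_real_derivative slope M H c x) (at x)"
  shows "f2s M H r2 c cb x = F x - F r2 + cb"
proof -
  have in_D: "z \<in> {lo<..<2 * M}" if "min r2 x \<le> z" "z \<le> max r2 x" for z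
    using D that by (auto simp: min_def max_def split: if_splits)
  have "(LBINT x=r2..x. f2_integrand M H c x) = (LBINT x=r2..x. slope M H c x)"
  proof (rule interval_integral_cong_real, rule f2_integrand_eq)
    fix z assume "min r2 x < z" "z < max r2 x"
    then have "z \<in> {lo<..<2 * M}"
      using in_D by simp
    then show "0 < z" "z < 2 * M" "drift H c z < 0" "schw_h M z + (drift H c z)^2 > 0"
      using pos assms(2) by auto
  qed (rule assms)
  also have "\<dots> = F x - F r2"
  proof (rule interval_integral_FTC_finite)
    show "continuous_on {min r2 x..max r2 x} (slope M H c)"
      using in_D pos assms(1,2)
      by (intro continuous_at_imp_continuous_on ballI isCont_slope) (auto dest!: in_D)
    show "(F has_vector_derivative slope M H c z) (at z within {min r2 x..max r2 x})"
      if "min r2 x \<le> z" "z \<le> max r2 x" for z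
      using F[OF in_D[OF that]] has_vector_derivative_at_within
      by (auto simp: has_real_derivative_iff_has_vector_derivative)
  qed
  finally show ?thesis
    by (simp add: f2s_def)
qed

text \<open>The integrand is nonnegative, so the fundamental theorem reaches the singular end point
  \<open>e\<close> from a one-sided limit of the primitive alone, with integrability as part of the
  conclusion.\<close>

lemma f2_integrand_improper:
  assumes "M > 0" "e > 0" "e < x" "x < 2 * M"
    and pos: "\<And>x. x \<in> {e<..<2 * M} \<Longrightarrow> drift H c x < 0 \<and> schw_h M x + (drift H c x)^2 > 0"
    and F: "\<And>x. x \<in> {e<..<2 * M} \<Longrightarrow> (F has_real_derivative slope M H c x) (at x)"
    and lim: "(F \<longlongrightarrow> F0) (at_right e)"
  shows "interval_lebesgue_integrable lborel (ereal x) (ereal e) (f2_integrand M H c)"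
    and "(LBINT x=e..x. f2_integrand M H c x) = F x - F0"
proof -
  have A: "((F \<circ> real_of_ereal) \<longlongrightarrow> F0) (at_right (ereal e))"
    using lim by (simp add: ereal_tendsto_simps1)
  have "isCont F x"
    by (rule DERIV_isCont[OF F]) (use assms in auto)
  then have "(F \<longlongrightarrow> F x) (at_left x)"
    unfolding isCont_def using filterlim_at_split by blast
  then have B: "((F \<circ> real_of_ereal) \<longlongrightarrow> F x) (at_left (ereal x))"
    by (simp add: ereal_tendsto_simps1)
  have neg: "schw_h M z < 0" if "e < z" "z < x" for z
    using schw_h_neg_iff[of M z] assms that by simp
  have sl: "f2_integrand M H c z = slope M H c z" if "e < z" "z < x" for z
    using f2_integrand_eq pos assms that by simp
  have nonneg: "0 \<le> slope M H c z" if "e < z" "z < x" for z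
    unfolding slope_def using neg[OF that] pos[of z] assms that
    by (intro divide_nonpos_neg mult_neg_pos) (auto simp: less_imp_le)
  have D: "isCont (slope M H c) z" "(F has_real_derivative slope M H c z) (at z)"
    if "e < z" "z < x" for z
    using assms that by (auto intro!: isCont_slope F simp: pos)
  have int: "set_integrable lborel (einterval (ereal e) (ereal x)) (slope M H c)"
    and val: "(LBINT x=e..x. slope M H c x) = F x - F0"
    using interval_integral_FTC_nonneg[OF _ _ _ _ A B, of "slope M H c"] nonneg D assms(3) by auto
  have "set_integrable lborel (einterval (ereal e) (ereal x)) (f2_integrand M H c)"
    using int by (subst set_integrable_cong[OF refl refl, of _ _ "slope M H c"]) (auto simp: sl einterval_iff)
  then show "interval_lebesgue_integrable lborel (ereal x) (ereal e) (f2_integrand M H c)"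
    using assms by (simp add: interval_lebesgue_integrable_def)
  show "(LBINT x=e..x. f2_integrand M H c x) = F x - F0"
    unfolding val[symmetric] by (rule interval_integral_cong_real) (use sl assms in auto)
qed

lemma f2_turning_eq:
  assumes "M > 0" "e > 0" "e \<le> x" "x < 2 * M"
    and pos: "\<And>x. x \<in> {e<..<2 * M} \<Longrightarrow> drift H c x < 0 \<and> schw_h M x + (drift H c x)^2 > 0"
    and F: "\<And>x. x \<in> {e<..<2 * M} \<Longrightarrow> (F has_real_derivative slope M H c x) (at x)"
    and lim: "(F \<longlongrightarrow> F e) (at_right e)"
  shows "f2s M H e c cb x = F x - F e + cb" and "f2ss M H e c cb x = F e - F x + cb"
proof -
  have val: "(LBINT x=e..x. f2_integrand M H c x) = F x - F e"
  proof (cases "e = x")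
    case False
    then show ?thesis
      using f2_integrand_improper(2)[OF assms(1,2) _ assms(4) pos F lim] assms by simp
  qed simp
  then show "f2s M H e c cb x = F x - F e + cb"
    by (simp add: f2s_def)
  have "(LBINT x=e..x. 1 / schw_h M x * sqrt ((l2 M H c x)^2 / ((l2 M H c x)^2 - 1))) =
      (LBINT x=e..x. - f2_integrand M H c x)"
    by (rule interval_integral_cong_real) (simp add: f2_integrand_def)
  also have "\<dots> = - (F x - F e)"
    using val by (simp add: interval_lebesgue_integral_uminus)
  finally show "f2ss M H e c cb x = F e - F x + cb"
    by (simp add: f2ss_def)
qed

section \<open>Hypersurfaces along which the radius is monotone\<close>

lemma real_antiderivative:
  fixes f :: "real \<Rightarrow> real" and lo :: real
  assumes "\<And>x. x > lo \<Longrightarrow> isCont f x"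
  obtains F where "\<And>x. x > lo \<Longrightarrow> (F has_real_derivative f x) (at x)"
  using einterval_antiderivative[of "ereal lo" \<infinity> f] assms
  by (auto simp: has_real_derivative_iff_has_vector_derivative)

lemma psi_pos_iff: "psi M y > 0 \<longleftrightarrow> y > 2 * M" and psi_neg_iff: "psi M y < 0 \<longleftrightarrow> y < 2 * M"
  by (auto simp: psi_def zero_less_mult_iff mult_less_0_iff)

text \<open>Outside the horizon \<open>h > 0\<close> makes \<open>w\<close> larger than the absolute
  value of the drift; from the horizon inwards the drift is negative.\<close>

lemma lapse_minus_drift_pos:
  assumes "w > 0" "w^2 = schw_h M r + (drift H c r)^2" and "M > 0" "r > 0"
    and "r \<le> 2 * M \<Longrightarrow> drift H c r < 0"
  shows "w - drift H c r > 0"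
proof (cases "r \<le> 2 * M")
  case True
  then show ?thesis
    using assms by simp
next
  case False
  then have "(drift H c r)^2 < w^2"
    using assms schw_h_pos_iff[of M r] by simp
  then show ?thesis
    using assms(1) by (simp add: abs_less_iff flip: abs_le_square_iff)
       (metis abs_less_iff abs_of_pos power2_less_imp_less linorder_not_le abs_le_square_iff)
qed

text \<open>The radius itself is the parameter, and \<open>w > 0\<close> throughout. As
  \<open>w - drift\<close> never vanishes, one antiderivative for \<open>ln V\<close> covers both
  sides of the horizon.\<close>

lemma transversal_curve:
  assumes M: "M > 0" and lo: "0 \<le> lo" "lo < 2 * M" and r1: "r1 > 2 * M"
    and neg: "\<And>x. lo < x \<Longrightarrow> x \<le> 2 * M \<Longrightarrow> drift H c x < 0"
    and pos: "\<And>x. lo < x \<Longrightarrow> schw_h M x + (drift H c x)^2 > 0"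
  obtains w m U V where "radial_curve M H c {lo<..} (\<lambda>y. y) w m U V"
    "\<And>y. y > lo \<Longrightarrow> V y > 0" "\<And>y. y > lo \<Longrightarrow> w y = sqrt (schw_h M y + (drift H c y)^2)"
    "\<And>y. y > lo \<Longrightarrow> m y = 1 / w y" "killing_time M (U r1) (V r1) = cb"
proof -
  define w where "w y = sqrt (schw_h M y + (drift H c y)^2)" for y
  define m where "m y = 1 / w y" for y
  have w_pos: "w y > 0" "(w y)^2 = schw_h M y + (drift H c y)^2" if "y > lo" for y
    using pos[OF that] by (auto simp: w_def)
  have s_pos: "w y - drift H c y > 0" if "y > lo" for y
    by (rule lapse_minus_drift_pos[where M = M]) (use w_pos[OF that] M lo that neg in auto)
  have dh: "((\<lambda>y. schw_h M y + (drift H c y)^2) has_real_derivative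
      2 * (M / y^2 + drift H c y * (H - 2 * c / y^3))) (at y)" if "y > lo" for y
    using that lo
    by (auto intro!: derivative_eq_intros schw_h_deriv drift_deriv simp: algebra_simps)
  have dw: "(w has_real_derivative m y * (M / y^2 + drift H c y * (H - 2 * c / y^3))) (at y)"
    if "y > lo" for y
  proof -
    define D where "D = M / y^2 + drift H c y * (H - 2 * c / y^3)"
    have "((\<lambda>y. sqrt (schw_h M y + (drift H c y)^2)) has_real_derivative
        (inverse (sqrt (schw_h M y + (drift H c y)^2)) / 2) * (2 * D)) (at y)"
      unfolding D_def by (rule DERIV_chain2[OF DERIV_real_sqrt dh]) (use pos that in auto)
    then show ?thesis
      by (simp add: w_def[abs_def] m_def inverse_eq_divide flip: D_def)
  qed
  define g where "g y = m y / (4 * M * (w y - drift H c y))" for y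
  have "isCont g y" if "y > lo" for y
    unfolding g_def m_def using s_pos[OF that] w_pos[OF that] M that lo
    by (intro continuous_intros DERIV_isCont[OF dw] DERIV_isCont[OF drift_deriv]) auto
  then obtain G0 where G0: "\<And>y. y > lo \<Longrightarrow> (G0 has_real_derivative g y) (at y)"
    using real_antiderivative by blast
  \<comment> \<open>Outside the horizon the Killing time is
    \<open>4 * M * ln V - 2 * M * ln psi\<close>; the constant makes it \<open>cb\<close> at
    \<open>r1\<close>, the value of \<open>f1\<close> at its base point.\<close>
  define k where "k = cb / (4 * M) + ln (psi M r1) / 2 - G0 r1"
  define V where "V y = exp (G0 y + k)" for y
  define U where "U y = psi M y / V y" for y
  have V: "V y > 0" for y
    by (simp add: V_def)
  have dV: "(V has_real_derivative m y * V y / (4 * M * (w y - drift H c y))) (at y)" if "y > lo" for y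
    unfolding V_def
    by (rule derivative_eq_intros G0 that refl)+ (simp add: g_def)
  have "radial_curve M H c {lo<..} (\<lambda>y. y) w m U V"
  proof
    fix y assume "y \<in> {lo<..}"
    then have y: "y > lo"
      by simp
    note wp = w_pos[OF y]
    show "y > 0" "m y > 0" "(w y)^2 = schw_h M y + (drift H c y)^2"
      using y lo wp by (auto simp: m_def)
    show "((\<lambda>y. y) has_real_derivative m y * w y) (at y)"
      using wp by (simp add: m_def)
    show "(w has_real_derivative m y * (M / y^2 + drift H c y * (H - 2 * c / y^3))) (at y)"
      by (rule dw[OF y])
    show "U y * V y = psi M y"
      using V[of y] by (simp add: U_def)
    show "V y > 0 \<and> w y - drift H c y > 0 \<and>
        (V has_real_derivative m y * V y / (4 * M * (w y - drift H c y))) (at y) \<or>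
      U y < 0 \<and> w y + drift H c y < 0 \<and>
        (U has_real_derivative m y * U y / (4 * M * (w y + drift H c y))) (at y)"
      using V s_pos[OF y] dV[OF y] by blast
  qed (use M in auto)
  moreover have "killing_time M (U r1) (V r1) = cb"
  proof -
    have "psi M r1 > 0"
      using r1 by (simp add: psi_def)
    then have "\<bar>V r1 / U r1\<bar> = (V r1)^2 / psi M r1" 
      using V[of r1] by (simp add: U_def power2_eq_square)
    then have "ln \<bar>V r1 / U r1\<bar> = 2 * (G0 r1 + k) - ln (psi M r1)"
      using \<open>psi M r1 > 0\<close> V[of r1] by (simp add: ln_div ln_realpow V_def)
    then show ?thesis
      using M by (simp add: killing_time_def k_def field_simps)
  qed
  ultimately show thesis
    using that[of w m U V] V by (simp add: w_def m_def)
qed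

text \<open>The common conclusion of cases (a) and (b).\<close>

definition complete_pair :: "real \<Rightarrow> real \<Rightarrow> event set \<Rightarrow> event set \<Rightarrow> bool" where
  "complete_pair M H S1 S2 \<longleftrightarrow>
    ss_cmc M H S2 \<and> connects_smoothly M S1 S2 \<and> ss_cmc M H (join M S1 S2) \<and>
    complete_hypersurface M (join M S1 S2) \<and> has_ends (join M S1 S2) 2"

text \<open>Used with \<open>lo = 0\<close> and with \<open>lo\<close> the critical radius. The
  premise \<open>diverge\<close> concerns only the second case, in which the end approaches a
  positive radius and closedness is at stake.\<close>

lemma Sigma1_Sigma2_transversal:
  assumes M: "M > 0" and lo: "0 \<le> lo" "lo < 2 * M" and r1: "r1 > 2 * M" and r2: "r2 \<in> {lo<..<2 * M}"
    and neg: "\<And>x. lo < x \<Longrightarrow> x \<le> 2 * M \<Longrightarrow> drift H c x < 0"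
    and pos: "\<And>x. lo < x \<Longrightarrow> schw_h M x + (drift H c x)^2 > 0"
    and comp: "f2_component M H c = {lo<..<2 * M}" and c: "c \<le> c_min M H"
    and diverge: "lo > 0 \<Longrightarrow> \<exists>\<kappa>>0. \<exists>d>lo. \<forall>x. lo < x \<longrightarrow> x < d \<longrightarrow> slope M H c x \<ge> \<kappa> / (x - lo)"
  shows "\<exists>cb2. complete_pair M H (Sigma1 M H r1 c cb1) (Sigma2 M H r2 c cb2)"
proof -
  obtain w m U V where curve: "radial_curve M H c {lo<..} (\<lambda>y. y) w m U V"
    and V: "\<And>y. y > lo \<Longrightarrow> V y > 0" and w: "\<And>y. y > lo \<Longrightarrow> w y = sqrt (schw_h M y + (drift H c y)^2)"
    and m: "\<And>y. y > lo \<Longrightarrow> m y = 1 / w y" and cb1: "killing_time M (U r1) (V r1) = cb1"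
    using transversal_curve[OF M lo r1 neg pos, where cb = cb1] by blast
  interpret radial_curve M H c "{lo<..}" "\<lambda>y. y" w m U V
    by (rule curve)
  have d\<tau>': "(\<tau> has_real_derivative slope M H c x) (at x)" if "x > lo" "x \<noteq> 2 * M" for x
    using d\<tau>[of x] that m[of x] w[of x] by (simp add: slope_def mult.commute)
  have U_sign: "U y > 0 \<longleftrightarrow> y > 2 * M" "U y < 0 \<longleftrightarrow> y < 2 * M" if "y > lo" for y
  proof -
    have "U y = psi M y / V y"
      using UV[of y] V[OF that] that by (simp add: field_simps)
    then show "U y > 0 \<longleftrightarrow> y > 2 * M" "U y < 0 \<longleftrightarrow> y < 2 * M"
      using V[OF that] psi_pos_iff psi_neg_iff by (auto simp: zero_less_divide_iff divide_less_0_iff)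
  qed
  have S1: "Sigma1 M H r1 c cb1 = sheet {2 * M<..}"
    unfolding Sigma1_def
  proof (rule graph_in_sheet)
    show "f1 M H r1 c cb1 y = \<tau> y" if "y \<in> {2 * M<..}" for y
      using f1_eq[OF M r1, of y \<tau> H c cb1] d\<tau>' that lo cb1 by (simp add: \<tau>_def)
  qed (use lo V U_sign in \<open>auto simp: region_I_def\<close>)
  have S2: "Sigma2 M H r2 c (\<tau> r2) = sheet {lo<..<2 * M}"
    unfolding Sigma2_def comp if_P[OF c]
  proof (rule graph_in_sheet)
    show "f2s M H r2 c (\<tau> r2) y = \<tau> y" if "y \<in> {lo<..<2 * M}" for y
      using f2s_eq[OF M lo(1) r2 that, of H c \<tau>] d\<tau>' neg pos by simp
  qed (use lo V U_sign in \<open>auto simp: region_II_def\<close>)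
  have closed: "closedin (top_of_set (kruskal M)) (sheet {lo<..})"
  proof (rule closed_sheet)
    fix s r0 U0 V0
    assume s: "\<And>n. s n \<in> {lo<..}" "(r0::real) > 0" "s \<longlonglongrightarrow> r0"
      "(\<lambda>n. U (s n)) \<longlonglongrightarrow> U0" "(\<lambda>n. V (s n)) \<longlonglongrightarrow> V0" "U0 * V0 = psi M r0"
    have "r0 \<ge> lo"
      using s(1) by (intro LIMSEQ_le_const[OF s(3)]) (auto intro: less_imp_le)
    \<comment> \<open>The lower bound on the slope drives the Killing time to minus infinity at
      \<open>lo\<close>, whereas at a limit point with \<open>U0 * V0 < 0\<close> it would
      converge.\<close>
    moreover have "r0 \<noteq> lo"
    proof
      assume r0: "r0 = lo"
      then obtain \<kappa> d where d: "\<kappa> > 0" "d > lo" "\<And>x. lo < x \<Longrightarrow> x < d \<Longrightarrow> slope M H c x \<ge> \<kappa> / (x - lo)"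
        using diverge s(2) by blast
      define b where "b = min ((lo + d) / 2) ((lo + 2 * M) / 2)"
      have b: "lo < b" "b < d" "b < 2 * M"
        using d(2) lo by (auto simp: b_def min_def field_simps)
      \<comment> \<open>Subtracting the logarithm, a primitive of the lower bound for the slope,
        leaves a nondecreasing function.\<close>
      have le: "\<tau> x \<le> \<tau> b - \<kappa> * ln (b - lo) + \<kappa> * ln (x - lo)" if "lo < x" "x < b" for x
      proof -
        have "\<tau> x - \<kappa> * ln (x - lo) \<le> \<tau> b - \<kappa> * ln (b - lo)"
        proof (rule DERIV_nonneg_imp_nondecreasing[where f = "\<lambda>x. \<tau> x - \<kappa> * ln (x - lo)"])
          fix z assume z: "x \<le> z" "z \<le> b"
          then have "((\<lambda>x. \<tau> x - \<kappa> * ln (x - lo)) has_real_derivative slope M H c z - \<kappa> / (z - lo)) (at z)"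
            using that b by (auto intro!: derivative_eq_intros d\<tau>')
          then show "\<exists>y. ((\<lambda>x. \<tau> x - \<kappa> * ln (x - lo)) has_real_derivative y) (at z) \<and> 0 \<le> y"
            using d(3)[of z] z that b by force
        qed (use that in simp)
        then show ?thesis by simp
      qed
      have "filterlim (\<lambda>x. \<tau> b - \<kappa> * ln (b - lo) + \<kappa> * ln (x - lo)) at_bot (at_right lo)"
      proof -
        have "filterlim (\<lambda>x. x - lo) (at_right 0) (at_right lo)"
          unfolding filterlim_at
          by (auto intro!: tendsto_eq_intros simp: eventually_at_right_field intro: exI[of _ "lo + 1"])
        then have "filterlim (\<lambda>x. ln (x - lo)) at_bot (at_right lo)"
          by (rule filterlim_compose[OF ln_at_0])
        then have "filterlim (\<lambda>x. \<kappa> * ln (x - lo)) at_bot (at_right lo)"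
          using d(1) filterlim_tendsto_pos_mult_at_bot[OF tendsto_const] by blast
        then have ev: "\<forall>\<^sub>F x in at_right lo. \<kappa> * ln (x - lo) \<le> Z" for Z
          by (simp add: filterlim_at_bot)
        show ?thesis
          unfolding filterlim_at_bot
        proof
          fix Z
          show "\<forall>\<^sub>F x in at_right lo. \<tau> b - \<kappa> * ln (b - lo) + \<kappa> * ln (x - lo) \<le> Z"
            using ev[of "Z - (\<tau> b - \<kappa> * ln (b - lo))"] by eventually_elim simp
        qed
      qed
      moreover have right: "filterlim s (at_right lo) sequentially"
        using s(1,3) r0 by (simp add: filterlim_at order_less_imp_not_eq2)
      ultimately have lim: "filterlim (\<lambda>n. \<tau> b - \<kappa> * ln (b - lo) + \<kappa> * ln (s n - lo)) at_bot sequentially"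
        by (rule filterlim_compose)
      have "\<forall>\<^sub>F n in sequentially. s n < b"
        using order_tendstoD(2)[OF s(3)] r0 b by blast
      then have "\<forall>\<^sub>F n in sequentially. \<tau> (s n) \<le> \<tau> b - \<kappa> * ln (b - lo) + \<kappa> * ln (s n - lo)"
        by eventually_elim (use le s(1) in auto)
      then have bot: "filterlim (\<lambda>n. \<tau> (s n)) at_bot sequentially"
        by (rule filterlim_at_bot_mono[OF lim])
      have "psi M r0 < psi M (2 * M)"
        using psi_strict_mono[OF M] r0 lo by simp
      then have nz: "U0 \<noteq> 0" "V0 \<noteq> 0"
        using s(6) by (auto simp: psi_def)
      have "(\<lambda>n. 2 * M * ln \<bar>V (s n) / U (s n)\<bar>) \<longlonglongrightarrow> 2 * M * ln \<bar>V0 / U0\<bar>"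
        using nz by (intro tendsto_intros s(4,5)) auto
      then have "(\<lambda>n. \<tau> (s n)) \<longlonglongrightarrow> 2 * M * ln \<bar>V0 / U0\<bar>"
        by (simp add: \<tau>_def killing_time_def)
      then show False
        using bot not_tendsto_and_filterlim_at_infinity[OF sequentially_bot]
          filterlim_at_bot_imp_at_infinity by blast
    qed
    ultimately show "\<exists>y\<in>{lo<..}. \<exists>k. strict_mono k \<and> (\<lambda>n. s (k n)) \<longlonglongrightarrow> y"
      using s(3) by (intro bexI[of _ r0] exI[of _ id]) (auto simp: strict_mono_id)
  qed
  have eq: "{2 * M<..} \<union> {lo<..<2 * M} \<union> {2 * M} = {lo<..}"
    using lo by auto
  have pre: "2 * M \<in> {lo<..}" "{2 * M<..} \<subseteq> {y \<in> {lo<..}. 2 * M < y}"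
    "{lo<..<2 * M} \<subseteq> {y \<in> {lo<..}. y < 2 * M}" "open ({2 * M<..} \<union> {lo<..<2 * M} \<union> {2 * M})"
    unfolding eq using lo by auto
  note join = join_sheets[OF closed pre refl, unfolded eq]
  have ss: "ss_cmc M H (sheet {lo<..})" "ss_cmc M H (sheet {lo<..<2 * M})"
    by (auto intro!: ss_cmc_sheet)
  then have "complete_hypersurface M (sheet {lo<..})"
    using closed by (simp add: complete_hypersurface_def ss_cmc_def)
  then show ?thesis
    using ss join has_ends_sheet by (intro exI[of _ "\<tau> r2"]) (simp add: S1 S2 complete_pair_def)
qed

section \<open>Hypersurfaces with a turning sphere\<close>

text \<open>\<open>Q1 x\<close> is the quotient of \<open>x\<^sup>4 (h + drift\<^sup>2)\<close> by its simple factor \<open>x - e\<close>.  The parameter \<open>y\<close> with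
  radius \<open>e + y\<^sup>2\<close> desingularises the turning sphere at \<open>y = 0\<close>; the reflection \<open>y \<mapsto> - y\<close> of the
  hypersurface exchanges \<open>U\<close> and \<open>V\<close> up to a factor.\<close>

locale turning =
  fixes M H c e :: real and Q1 Q1' :: "real \<Rightarrow> real"
  assumes M: "M > 0" and e: "0 < e" "e < 2 * M"
    and dQ1: "\<And>x. x > 0 \<Longrightarrow> (Q1 has_real_derivative Q1' x) (at x)"
    and Q1: "\<And>x. x > 0 \<Longrightarrow> x^4 * (schw_h M x + (drift H c x)^2) = (x - e) * Q1 x"
    and Q1_pos: "\<And>x. e \<le> x \<Longrightarrow> Q1 x > 0"
    and neg: "\<And>x. e \<le> x \<Longrightarrow> x \<le> 2 * M \<Longrightarrow> drift H c x < 0"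
begin

definition \<rho> :: "real \<Rightarrow> real" where "\<rho> y = e + y^2"
text \<open>The square root of \<open>h + drift^2\<close>, taken with the sign of \<open>y\<close>.
  The choice of \<open>m\<close> below makes \<open>m * w = 2 * y\<close>, the derivative of
  \<open>\<rho>\<close>, and keeps \<open>m\<close> positive at the turning sphere.\<close>

definition w :: "real \<Rightarrow> real" where "w y = y * sqrt (Q1 (\<rho> y)) / (\<rho> y)^2"
definition m :: "real \<Rightarrow> real" where "m y = 2 * (\<rho> y)^2 / sqrt (Q1 (\<rho> y))"
definition y0 :: real where "y0 = sqrt (2 * M - e)"

lemma \<rho>_pos: "\<rho> y > 0" and \<rho>_ge: "e \<le> \<rho> y"
  using e by (auto simp: \<rho>_def add_pos_nonneg)

lemma Q_pos: "sqrt (Q1 (\<rho> y)) > 0"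
  using Q1_pos[OF \<rho>_ge] by simp

lemma m_pos: "m y > 0"
  using Q_pos[of y] \<rho>_pos[of y] by (simp add: m_def)

lemma mw: "m y * w y = 2 * y"
  using Q_pos[of y] \<rho>_pos[of y] by (simp add: m_def w_def)

lemma d\<rho>: "(\<rho> has_real_derivative m y * w y) (at y)"
  unfolding mw \<rho>_def by (auto intro!: derivative_eq_intros)

lemma lapse_eq: "x > 0 \<Longrightarrow> schw_h M x + (drift H c x)^2 = (x - e) * Q1 x / x^4"
  using Q1[of x] by (simp add: field_simps)

lemma w2: "(w y)^2 = schw_h M (\<rho> y) + (drift H c (\<rho> y))^2"
proof -
  have "(w y)^2 = (\<rho> y - e) * Q1 (\<rho> y) / (\<rho> y)^4"
    using Q1_pos[OF \<rho>_ge, of y]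
    by (simp add: w_def power_divide power_mult_distrib \<rho>_def flip: power_mult)
  then show ?thesis
    using lapse_eq[OF \<rho>_pos] by simp
qed

text \<open>Differentiating \<open>w^2\<close> and dividing by \<open>w\<close> fails at
  \<open>y = 0\<close>. Instead the explicit formula for \<open>w\<close> is differentiated and
  compared with two expressions for the derivative of \<open>h + drift^2\<close>, the original one
  and the factorised one.\<close>

lemma dw: "(w has_real_derivative
    m y * (M / (\<rho> y)^2 + drift H c (\<rho> y) * (H - 2 * c / (\<rho> y)^3))) (at y)"
proof -
  define S where "S = sqrt (Q1 (\<rho> y))"
  define x where "x = \<rho> y"
  have Sx: "sqrt (Q1 x) = S"
    by (simp add: S_def x_def)
  have S: "S > 0" "Q1 x = S * S"
    using Q_pos[of y] Q1_pos[OF \<rho>_ge, of y] by (auto simp: S_def x_def)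
  have x: "x > 0" "x - e = y * y"
    using \<rho>_pos by (auto simp: x_def \<rho>_def power2_eq_square)
  have "((\<lambda>x. schw_h M x + (drift H c x)^2) has_real_derivative
      2 * (M / x^2 + drift H c x * (H - 2 * c / x^3))) (at x)"
    using x(1) by (auto intro!: derivative_eq_intros schw_h_deriv drift_deriv simp: algebra_simps)
  moreover have "((\<lambda>x. (x - e) * Q1 x / x^4) has_real_derivative
      (Q1 x + y * y * Q1' x) / x^4 - 4 * (y * y) * Q1 x / x^5) (at x)"
  proof (rule DERIV_cong[OF DERIV_divide[OF DERIV_mult[OF _ dQ1[OF x(1)]] DERIV_pow]])
    show "((\<lambda>x. x - e) has_real_derivative 1) (at x)"
      by (auto intro!: derivative_eq_intros)
    show "x^4 \<noteq> 0"
      using x(1) by simp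
    have nz: "x^4 \<noteq> 0" "x^3 \<noteq> 0" and pow: "x^4 * x^4 = x^5 * x^3"
      using x(1) by (auto simp flip: power_add)
    have "((1 * Q1 x + Q1' x * (y * y)) * x^4 - y * y * Q1 x * (4 * x^3)) / (x^4 * x^4) =
        ((Q1 x + y * y * Q1' x) * x^4) / (x^4 * x^4) - (4 * (y * y) * Q1 x * x^3) / (x^4 * x^4)"
      by (simp only: diff_divide_distrib[symmetric]) (simp only: mult_1_left mult_ac)
    also have "\<dots> = ((Q1 x + y * y * Q1' x) * x^4) / (x^4 * x^4) - (4 * (y * y) * Q1 x * x^3) / (x^5 * x^3)"
      by (simp only: pow)
    also have "\<dots> = (Q1 x + y * y * Q1' x) / x^4 - 4 * (y * y) * Q1 x / x^5"
      by (simp only: nonzero_mult_divide_mult_cancel_right[OF nz(1)] nonzero_mult_divide_mult_cancel_right[OF nz(2)])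
    finally show "((1 * Q1 x + Q1' x * (x - e)) * x^4 - (x - e) * Q1 x * (real 4 * x ^ (4 - Suc 0))) / (x^4 * x^4) =
        (Q1 x + y * y * Q1' x) / x^4 - 4 * (y * y) * Q1 x / x^5"
      unfolding x(2) by simp
  qed
  then have "((\<lambda>x. schw_h M x + (drift H c x)^2) has_real_derivative
      (Q1 x + y * y * Q1' x) / x^4 - 4 * (y * y) * Q1 x / x^5) (at x)"
    by (rule has_field_derivative_transform_within_open[of _ _ _ "{0<..}"])
       (use x in \<open>auto simp: lapse_eq\<close>)
  ultimately have F: "M / x^2 + drift H c x * (H - 2 * c / x^3) =
      ((Q1 x + y * y * Q1' x) / x^4 - 4 * (y * y) * Q1 x / x^5) / 2"
    using DERIV_unique by fastforce
  have d\<rho>': "(\<rho> has_real_derivative 2 * y) (at y)"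
    using d\<rho>[of y] by (simp add: mw)
  have "((\<lambda>y. Q1 (\<rho> y)) has_real_derivative Q1' x * (2 * y)) (at y)"
    unfolding x_def by (rule DERIV_chain2[OF dQ1[OF \<rho>_pos] d\<rho>'])
  from DERIV_chain2[OF DERIV_real_sqrt this] Q1_pos[OF \<rho>_ge, of y]
  have dS: "((\<lambda>y. sqrt (Q1 (\<rho> y))) has_real_derivative inverse S / 2 * (Q1' x * (2 * y))) (at y)"
    by (simp add: S_def)
  have "(w has_real_derivative
      ((S + inverse S / 2 * (Q1' x * (2 * y)) * y) * x^2 - y * S * (2 * x * (2 * y))) / (x^2 * x^2)) (at y)"
  proof -
    have "((\<lambda>y. (\<rho> y)^2) has_real_derivative 2 * x * (2 * y)) (at y)"
      by (rule derivative_eq_intros d\<rho>' refl)+ (simp add: x_def)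
    from DERIV_divide[OF DERIV_mult[OF DERIV_ident dS] this] x(1) show ?thesis
      by (simp add: w_def[abs_def] Sx flip: x_def)
  qed
  also have "((S + inverse S / 2 * (Q1' x * (2 * y)) * y) * x^2 - y * S * (2 * x * (2 * y))) / (x^2 * x^2) =
      m y * (M / x^2 + drift H c x * (H - 2 * c / x^3))"
    unfolding F m_def S_def[symmetric] unfolding x_def[symmetric] S(2) using S(1) x(1)
    by (simp add: divide_simps) (simp add: algebra_simps eval_nat_numeral)
  finally show ?thesis
    by (simp add: x_def)
qed

lemma even_odd: "\<rho> (- y) = \<rho> y" "w (- y) = - w y" "m (- y) = m y"
  by (simp_all add: \<rho>_def w_def m_def)

lemma y0: "y0 > 0" "\<rho> y0 = 2 * M"
  using e by (simp_all add: y0_def \<rho>_def)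

lemma \<rho>_less: "\<rho> y < 2 * M \<longleftrightarrow> - y0 < y \<and> y < y0"
proof -
  have "\<rho> y < 2 * M \<longleftrightarrow> y^2 < y0^2"
    using y0 by (auto simp: \<rho>_def)
  also have "\<dots> \<longleftrightarrow> \<bar>y\<bar> < \<bar>y0\<bar>"
    by (metis abs_le_square_iff linorder_not_le)
  finally show ?thesis
    using y0 by auto
qed

lemma \<rho>_eq: "\<rho> y = 2 * M \<longleftrightarrow> y = - y0 \<or> y = y0"
proof -
  have "\<rho> y = 2 * M \<longleftrightarrow> y^2 = y0^2"
    using y0(2) by (auto simp: \<rho>_def)
  then show ?thesis
    by (auto simp: power2_eq_iff)
qed

lemma \<rho>_greater: "\<rho> y > 2 * M \<longleftrightarrow> y < - y0 \<or> y0 < y"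
proof -
  have "\<rho> y > 2 * M \<longleftrightarrow> \<not> \<rho> y < 2 * M \<and> \<rho> y \<noteq> 2 * M"
    by auto
  then show ?thesis
    unfolding \<rho>_eq \<rho>_less using y0(1) by auto
qed

text \<open>In region II \<open>h < 0\<close> gives that \<open>w\<close> is smaller in absolute
  value than the negative drift; beyond it \<open>w\<close> is positive. Since \<open>w\<close> is
  odd, reflection yields \<open>w + drift < 0\<close> for \<open>y < y0\<close>.\<close>

lemma drift_sign: "- y0 < y \<Longrightarrow> w y - drift H c (\<rho> y) > 0"
proof (cases "y < y0")
  case True
  assume "- y0 < y"
  then have "\<rho> y < 2 * M"
    using True \<rho>_less by simp
  then have "(w y)^2 < (drift H c (\<rho> y))^2" "drift H c (\<rho> y) < 0"
    using w2[of y] schw_h_neg_iff[OF M \<rho>_pos] neg[OF \<rho>_ge, of y] by auto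
  then show ?thesis
    using abs_less_iff power2_less_imp_less[of "\<bar>w y\<bar>" "- drift H c (\<rho> y)"] by force
next
  case False
  then have "w y > 0"
    using y0 Q_pos[of y] \<rho>_pos[of y] by (simp add: w_def)
  then show ?thesis
    by (rule lapse_minus_drift_pos[OF _ w2 M \<rho>_pos]) (rule neg[OF \<rho>_ge])
qed

lemma isCont_m: "isCont m y"
  unfolding m_def[abs_def] using Q_pos[of y]
  by (intro continuous_intros DERIV_isCont[OF d\<rho>] isCont_o2[OF DERIV_isCont[OF d\<rho>] DERIV_isCont[OF dQ1[OF \<rho>_pos]]]) auto

lemma isCont_drift: "isCont (\<lambda>y. drift H c (\<rho> y)) y"
  using \<rho>_pos[of y]
  by (intro isCont_o2[OF DERIV_isCont[OF d\<rho>] DERIV_isCont[OF drift_deriv]]) auto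

lemma w_drift_product: "(w y - drift H c (\<rho> y)) * (w y + drift H c (\<rho> y)) = schw_h M (\<rho> y)"
  using w2[of y] by (simp add: power2_eq_square algebra_simps)

text \<open>\<open>ln V\<close> is an antiderivative on \<open>y > - y0\<close>, and its mirror
  image serves for \<open>ln (- U)\<close> on \<open>y < y0\<close>. The two ranges overlap in
  region II, where the product has to be \<open>psi\<close>; the free constant
  \<open>\<kappa>\<close> achieves this.\<close>

lemma turning_curve:
  assumes r1: "r1 > 2 * M"
  obtains U V \<kappa> where "radial_curve M H c UNIV \<rho> w m U V"
    "\<And>y. V y > 0 \<longleftrightarrow> - y0 < y" "\<And>y. U y > 0 \<longleftrightarrow> y0 < y"
    "\<And>y. V y < 0 \<longleftrightarrow> y < - y0" "\<And>y. U y < 0 \<longleftrightarrow> y < y0"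
    "\<kappa> > 0" "\<And>y. U (- y) = - \<kappa> * V y"
    "killing_time M (U (sqrt (r1 - e))) (V (sqrt (r1 - e))) = cb"
proof -
  define g where "g y = m y / (4 * M * (w y - drift H c (\<rho> y)))" for y
  have "isCont g y" if "- y0 < y" for y
    unfolding g_def using drift_sign[OF that] M
    by (intro continuous_intros isCont_m isCont_drift DERIV_isCont[OF dw]) auto
  then obtain G0 where G0: "\<And>y. - y0 < y \<Longrightarrow> (G0 has_real_derivative g y) (at y)"
    using real_antiderivative by blast
  define y1 where "y1 = sqrt (r1 - e)"
  have \<rho>_y1: "\<rho> y1 = r1" and "y1 \<ge> 0"
    using r1 e by (simp_all add: y1_def \<rho>_def)
  then have y1: "y1 > y0"
    using \<rho>_less[of y1] y0 r1 by (metis linorder_not_less linorder_neqE_linordered_idom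
        neg_less_0_iff_less order_less_asym order_less_le_trans)
  define k where "k = cb / (4 * M) + ln (psi M r1) / 2 - G0 y1"
  define G where "G y = G0 y + k" for y
  have dG: "(G has_real_derivative g y) (at y)" if "- y0 < y" for y
    unfolding G_def by (auto intro!: derivative_eq_intros G0 that)
  have dG': "((\<lambda>y. G (- y)) has_real_derivative - g (- y)) (at y)" if "y < y0" for y
    using DERIV_chain2[OF dG, of "uminus" y "-1" UNIV] that DERIV_minus[OF DERIV_ident, of y UNIV] by simp
  have g_neg: "- g (- y) = m y / (4 * M * (w y + drift H c (\<rho> y)))" for y
    unfolding g_def even_odd by (simp add: minus_divide_right algebra_simps)
  \<comment> \<open>Makes the identity \<open>sum\<close> true at \<open>y = 0\<close>; it then
    holds on the whole overlap because both sides have the same derivative.\<close>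
  define K where "K = ln (- psi M (\<rho> 0)) - 2 * G 0"
  have sum: "K + G y + G (- y) = ln (- psi M (\<rho> y))" if y: "- y0 < y" "y < y0" for y
  proof -
    define f where "f y = G y + G (- y) - ln (- psi M (\<rho> y))" for y
    have "(f has_real_derivative 0) (at z)" if z: "z \<in> {- y0<..<y0}" for z
    proof -
      have r: "\<rho> z < 2 * M"
        using z \<rho>_less by simp
      have ps: "psi M (\<rho> z) < 0"
        using r psi_neg_iff by simp
      have hn: "schw_h M (\<rho> z) < 0"
        using r schw_h_neg_iff M \<rho>_pos by simp
      have "((\<lambda>y. - psi M (\<rho> y)) has_real_derivative - (4 * M / conf M (\<rho> z) * (m z * w z))) (at z)"
        by (rule DERIV_minus[OF DERIV_chain2[OF psi_deriv[OF M \<rho>_pos] d\<rho>]])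
      then have "((\<lambda>y. ln (- psi M (\<rho> y))) has_real_derivative
          1 / (- psi M (\<rho> z)) * - (4 * M / conf M (\<rho> z) * (m z * w z))) (at z)"
        using ps by (intro DERIV_chain2[OF DERIV_ln_divide]) auto
      also have "1 / (- psi M (\<rho> z)) * - (4 * M / conf M (\<rho> z) * (m z * w z)) =
          4 * M * (m z * w z) / (conf M (\<rho> z) * psi M (\<rho> z))"
        by simp
      also have "\<dots> = m z * w z / (2 * M * schw_h M (\<rho> z))"
        unfolding conf_psi[OF M \<rho>_pos] using M by (simp add: power2_eq_square)
      finally have dl: "((\<lambda>y. ln (- psi M (\<rho> y))) has_real_derivative
          m z * w z / (2 * M * schw_h M (\<rho> z))) (at z)" .
      have nz: "w z - drift H c (\<rho> z) \<noteq> 0" "w z + drift H c (\<rho> z) \<noteq> 0"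
        using w_drift_product[of z] hn by auto
      have "g z + - g (- z) - m z * w z / (2 * M * schw_h M (\<rho> z)) = 0"
        unfolding g_neg unfolding g_def w_drift_product[symmetric] using nz M
        by (simp add: divide_simps) (simp add: algebra_simps)
      moreover have "(f has_real_derivative g z + - g (- z) - m z * w z / (2 * M * schw_h M (\<rho> z))) (at z)"
        unfolding f_def[abs_def] using z by (intro DERIV_diff DERIV_add dG dG' dl) auto
      ultimately show ?thesis
        by simp
    qed
    then have "f y = f 0"
      using y y0 by (intro DERIV_isconst3[of "- y0" y0]) auto
    then show ?thesis
      by (simp add: f_def K_def)
  qed
  define U where "U y = (if y < y0 then - exp (K + G (- y)) else psi M (\<rho> y) / exp (G y))" for y
  define V where "V y = (if - y0 < y then exp (G y) else psi M (\<rho> y) / U y)" for y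
  have V_pos: "V y = exp (G y)" if "- y0 < y" for y
    using that by (simp add: V_def)
  have U_neg: "U y = - exp (K + G (- y))" if "y < y0" for y
    using that by (simp add: U_def)
  have UV: "U y * V y = psi M (\<rho> y)" for y
  proof -
    consider "- y0 < y \<and> y < y0" | "y \<ge> y0" | "y \<le> - y0"
      by linarith
    then show ?thesis
    proof cases
      case 1
      then have "psi M (\<rho> y) < 0"
        using \<rho>_less psi_neg_iff by simp
      have "U y * V y = - exp (K + G y + G (- y))"
        using 1 U_neg V_pos by (simp add: exp_add)
      also have "\<dots> = psi M (\<rho> y)"
        using sum[of y] 1 \<open>psi M (\<rho> y) < 0\<close> by simp
      finally show ?thesis .
    next
      case 2
      then show ?thesis
        using y0 by (simp add: U_def V_def)
    next
      case 3
      then show ?thesis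
        using y0 by (simp add: U_def V_def)
    qed
  qed
  have psi_outer: "psi M (\<rho> y) > 0 \<longleftrightarrow> y < - y0 \<or> y0 < y" "psi M (\<rho> y) = 0 \<longleftrightarrow> y = - y0 \<or> y = y0" for y
  proof -
    show "psi M (\<rho> y) = 0 \<longleftrightarrow> y = - y0 \<or> y = y0"
      using \<rho>_eq by (simp add: psi_def)
    show "psi M (\<rho> y) > 0 \<longleftrightarrow> y < - y0 \<or> y0 < y"
      using psi_pos_iff \<rho>_greater by simp
  qed
  have signs: "V y > 0 \<longleftrightarrow> - y0 < y" "U y > 0 \<longleftrightarrow> y0 < y" "V y < 0 \<longleftrightarrow> y < - y0" "U y < 0 \<longleftrightarrow> y < y0" for y
  proof -
    consider "- y0 < y \<and> y < y0" | "y > y0" | "y < - y0" | "y = y0" | "y = - y0"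
      by linarith
    then have "(V y > 0 \<longleftrightarrow> - y0 < y) \<and> (U y > 0 \<longleftrightarrow> y0 < y) \<and> (V y < 0 \<longleftrightarrow> y < - y0) \<and> (U y < 0 \<longleftrightarrow> y < y0)"
      by cases (use y0(1) psi_outer[of y] in \<open>auto simp: U_def V_def divide_less_0_iff zero_less_divide_iff\<close>)
    then show "V y > 0 \<longleftrightarrow> - y0 < y" "U y > 0 \<longleftrightarrow> y0 < y" "V y < 0 \<longleftrightarrow> y < - y0" "U y < 0 \<longleftrightarrow> y < y0"
      by auto
  qed
  have "radial_curve M H c UNIV \<rho> w m U V"
  proof
    fix y
    show "V y > 0 \<and> w y - drift H c (\<rho> y) > 0 \<and>
        (V has_real_derivative m y * V y / (4 * M * (w y - drift H c (\<rho> y)))) (at y) \<or>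
      U y < 0 \<and> w y + drift H c (\<rho> y) < 0 \<and>
        (U has_real_derivative m y * U y / (4 * M * (w y + drift H c (\<rho> y)))) (at y)"
    proof (cases "- y0 < y")
      case True
      have "((\<lambda>y. exp (G y)) has_real_derivative m y * V y / (4 * M * (w y - drift H c (\<rho> y)))) (at y)"
        by (rule derivative_eq_intros dG True refl)+ (simp add: g_def V_pos[OF True])
      then have "(V has_real_derivative m y * V y / (4 * M * (w y - drift H c (\<rho> y)))) (at y)"
        by (rule has_field_derivative_transform_within_open[of _ _ _ "{- y0<..}"]) (use True V_pos in auto)
      then show ?thesis
        using True signs drift_sign by blast
    next
      case False
      then have y: "y < y0" "- y0 < - y"
        using y0 by auto
      have "((\<lambda>y. - exp (K + G (- y))) has_real_derivative - (exp (K + G (- y)) * - g (- y))) (at y)"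
        by (rule derivative_eq_intros dG' y refl)+ simp
      then have "(U has_real_derivative - (exp (K + G (- y)) * - g (- y))) (at y)"
        by (rule has_field_derivative_transform_within_open[of _ _ _ "{..<y0}"]) (use y U_neg in auto)
      also have "- (exp (K + G (- y)) * - g (- y)) = m y * U y / (4 * M * (w y + drift H c (\<rho> y)))"
        unfolding g_neg U_neg[OF y(1)] by simp
      finally show ?thesis
        using drift_sign[OF y(2)] signs(4)[of y] y(1) by (simp add: even_odd)
    qed
  qed (use M \<rho>_pos m_pos w2 d\<rho> dw UV in auto)
  moreover have "U (- y) = - exp K * V y" for y
  proof (cases "- y0 < y")
    case True
    then show ?thesis
      using U_neg[of "- y"] V_pos[of y] by (simp add: exp_add)
  next
    case False
    then have "U y = - exp (K + G (- y))" "U (- y) = psi M (\<rho> y) / exp (G (- y))" "V y = psi M (\<rho> y) / U y"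
      using y0 by (auto simp: U_def V_def even_odd)
    then show ?thesis
      by (simp add: exp_add)
  qed
  moreover have "killing_time M (U y1) (V y1) = cb"
  proof -
    have ps: "psi M r1 > 0"
      using r1 psi_pos_iff by simp
    have "V y1 = exp (G y1)" "U y1 = psi M r1 / exp (G y1)"
      using y1 y0 by (auto simp: U_def V_def \<rho>_y1)
    then have "\<bar>V y1 / U y1\<bar> = (exp (G y1))^2 / psi M r1"
      using ps by (simp add: power2_eq_square)
    then have "ln \<bar>V y1 / U y1\<bar> = 2 * G y1 - ln (psi M r1)"
      using ps by (simp add: ln_div ln_realpow)
    then show ?thesis
      using M by (simp add: killing_time_def G_def k_def field_simps)
  qed
  ultimately show thesis
    using that[of U V "exp K"] signs by (simp add: y1_def)
qed

lemma lapse_drift_pos: "x \<in> {e<..<2 * M} \<Longrightarrow> drift H c x < 0 \<and> schw_h M x + (drift H c x)^2 > 0"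
  using neg[of x] lapse_eq[of x] Q1_pos[of x] e by simp

text \<open>On the outgoing half \<open>y > 0\<close> the Killing time, viewed as a function of the
  radius, has derivative \<open>slope\<close>. It stays continuous at the turning sphere because it
  is smooth in \<open>y\<close>, although \<open>slope\<close> is singular there.\<close>

lemma height_primitive:
  assumes curve: "radial_curve M H c UNIV \<rho> w m U V"
  defines "F \<equiv> \<lambda>x. killing_time M (U (sqrt (x - e))) (V (sqrt (x - e)))"
  shows "\<And>x. e < x \<Longrightarrow> x \<noteq> 2 * M \<Longrightarrow> (F has_real_derivative slope M H c x) (at x)"
    and "(F \<longlongrightarrow> F e) (at_right e)"
proof -
  interpret radial_curve M H c UNIV \<rho> w m U V
    by (rule curve)
  have F_def: "F x = \<tau> (sqrt (x - e))" for x
    by (simp add: assms(2) \<tau>_def)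
  show "(F has_real_derivative slope M H c x) (at x)" if x: "e < x" "x \<noteq> 2 * M" for x
  proof -
    define y where "y = sqrt (x - e)"
    have y: "y > 0" "\<rho> y = x"
      using x by (auto simp: y_def \<rho>_def)
    have w: "w y = sqrt (schw_h M x + (drift H c x)^2)" "w y > 0"
      using w2[of y] y Q_pos[of y] \<rho>_pos[of y]
      by (auto simp: w_def real_sqrt_unique[symmetric] real_sqrt_unique)
    have "((\<lambda>x. sqrt (x - e)) has_real_derivative inverse y / 2 * 1) (at x)"
      unfolding y_def using x by (intro DERIV_chain2[OF DERIV_real_sqrt]) (auto intro!: derivative_eq_intros)
    moreover have "(\<tau> has_real_derivative m y * drift H c x / schw_h M x) (at y)"
      using d\<tau>[of y] x(2) by (simp add: y)
    ultimately have "(F has_real_derivative m y * drift H c x / schw_h M x * (inverse y / 2 * 1)) (at x)"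
      unfolding F_def[abs_def] y_def by (intro DERIV_chain2[of \<tau>])
    also have "m y * drift H c x / schw_h M x * (inverse y / 2 * 1) = slope M H c x"
    proof -
      have "m y * (inverse y / 2 * 1) = 1 / w y"
        using mw[of y] y(1) w(2) by (simp add: field_simps)
      then have "m y * drift H c x / schw_h M x * (inverse y / 2 * 1) = drift H c x / schw_h M x * (1 / w y)"
        by (metis (no_types, opaque_lifting) mult.assoc mult.commute times_divide_eq_right)
      then show ?thesis
        by (simp add: slope_def w(1))
    qed
    finally show ?thesis .
  qed
  show "(F \<longlongrightarrow> F e) (at_right e)"
  proof -
    have "isCont \<tau> 0"
      using DERIV_isCont[OF d\<tau>[of 0]] e by (simp add: \<rho>_def)
    \<comment> \<open>The real root is extended to negative arguments as an odd function, hence is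
      continuous at 0 from both sides.\<close>
    moreover have "isCont (\<lambda>x. sqrt (x - e)) e"
      by (intro continuous_intros)
    ultimately have "isCont F e"
      unfolding F_def[abs_def] using isCont_o2[of e "\<lambda>x. sqrt (x - e)" \<tau>] by simp
    then show ?thesis
      unfolding isCont_def filterlim_at_split ..
  qed
qed

lemma Sigma1_Sigma2_Sigma3:
  assumes r1: "r1 > 2 * M" and r3: "r3 > 2 * M" and c: "\<not> c \<le> c_min M H"
    and comp: "f2_component M H c = {e..<2 * M}" and turn: "r_turn M H c = e"
  shows "\<exists>cb2. let S1 = Sigma1 M H r1 c cb1; S2 = Sigma2 M H r2 c cb2 in
    ss_cmc M H S2 \<and> connects_smoothly M S1 S2 \<and>
    (\<exists>cb3. let S3 = Sigma3 M H r3 c cb3; S = join M (join M S1 S2) S3 in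
      ss_cmc M H S3 \<and> connects_smoothly M S2 S3 \<and>
      ss_cmc M H S \<and> complete_hypersurface M S \<and> has_ends S 2)"
proof -
  obtain U V \<kappa> where rc: "radial_curve M H c UNIV \<rho> w m U V"
    and signs: "\<And>y. V y > 0 \<longleftrightarrow> - y0 < y" "\<And>y. U y > 0 \<longleftrightarrow> y0 < y"
      "\<And>y. V y < 0 \<longleftrightarrow> y < - y0" "\<And>y. U y < 0 \<longleftrightarrow> y < y0"
    and \<kappa>: "\<kappa> > 0" "\<And>y. U (- y) = - \<kappa> * V y"
    and cb1: "killing_time M (U (sqrt (r1 - e))) (V (sqrt (r1 - e))) = cb1"
    using turning_curve[OF r1, where cb = cb1] by blast
  interpret radial_curve M H c UNIV \<rho> w m U V
    by (rule rc)
  \<comment> \<open>Exchanging \<open>U\<close> and \<open>V\<close> up to the factor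
    \<open>\<kappa>\<close> reverses the Killing time up to a constant, and evaluation at 0
    eliminates \<open>\<kappa>\<close>.\<close>
  have \<tau>_reflect: "\<tau> (- y) = 2 * \<tau> 0 - \<tau> y" if "y \<noteq> y0" "y \<noteq> - y0" for y
  proof -
    have sym: "\<tau> (- z) = - \<tau> z - 4 * M * ln \<kappa>" if "z \<noteq> y0" "z \<noteq> - y0" for z
    proof -
      have nz: "U z \<noteq> 0" "V z \<noteq> 0"
        using that signs(1,2,3,4)[of z] by (metis linorder_neqE_linordered_idom order_less_irrefl)+
      have "V (- z) = - U z / \<kappa>"
        using \<kappa>(1) \<kappa>(2)[of "- z"] by (simp add: field_simps)
      then have "\<bar>V (- z) / U (- z)\<bar> = \<bar>U z\<bar> / (\<kappa> * \<kappa> * \<bar>V z\<bar>)"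
        using \<kappa> by (simp add: abs_mult)
      then show ?thesis
        using nz \<kappa>(1) by (simp add: \<tau>_def killing_time_def ln_div ln_mult abs_divide algebra_simps)
    qed
    show ?thesis
      using sym[of y] sym[of 0] that y0 by simp
  qed
  define F where "F x = \<tau> (sqrt (x - e))" for x
  have F: "F = (\<lambda>x. killing_time M (U (sqrt (x - e))) (V (sqrt (x - e))))"
    by (simp add: F_def \<tau>_def fun_eq_iff)
  have dF: "(F has_real_derivative slope M H c x) (at x)" if "e < x" "x \<noteq> 2 * M" for x
    using height_primitive(1)[OF rc that] unfolding F .
  have limF: "(F \<longlongrightarrow> F e) (at_right e)"
    using height_primitive(2)[OF rc] unfolding F .
  have F_\<rho>: "F (\<rho> y) = \<tau> \<bar>y\<bar>" for y
    by (simp add: F_def \<rho>_def)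
  have F_e: "F e = \<tau> 0"
    by (simp add: F_def)
  have \<rho>_outer: "\<rho> y > 2 * M" if "y > y0 \<or> y < - y0" for y
    using that \<rho>_greater by blast
  have images: "\<rho> ` {y0<..} = {2 * M<..}" "\<rho> ` {..<- y0} = {2 * M<..}"
    "\<rho> ` {0..<y0} = {e..<2 * M}" "\<rho> ` {- y0<..0} = {e..<2 * M}"
  proof -
    have sq: "\<rho> (sqrt (x - e)) = x" "\<rho> (- sqrt (x - e)) = x" if "x \<ge> e" for x
      using that by (simp_all add: \<rho>_def)
    have out: "sqrt (x - e) > y0" if "x > 2 * M" for x
      using that by (simp add: y0_def)
    have inn: "sqrt (x - e) < y0" if "x < 2 * M" for x
      using that by (simp add: y0_def)
    have img: "\<rho> ` B = D"
      if "\<And>y. y \<in> B \<Longrightarrow> \<rho> y \<in> D" "\<And>x. x \<in> D \<Longrightarrow> g x \<in> B" "\<And>x. x \<in> D \<Longrightarrow> \<rho> (g x) = x" for B D g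
    proof (intro equalityI subsetI)
      fix x assume "x \<in> D"
      then show "x \<in> \<rho> ` B"
        using that(2,3)[of x] by (intro image_eqI[of x \<rho> "g x"]) simp_all
    qed (use that(1) in blast)
    show "\<rho> ` {y0<..} = {2 * M<..}"
      by (rule img[where g = "\<lambda>x. sqrt (x - e)"]) (use \<rho>_outer out sq(1) e in auto)
    show "\<rho> ` {..<- y0} = {2 * M<..}"
      by (rule img[where g = "\<lambda>x. - sqrt (x - e)"]) (use \<rho>_outer out sq(2) e in auto)
    show "\<rho> ` {0..<y0} = {e..<2 * M}"
      by (rule img[where g = "\<lambda>x. sqrt (x - e)"]) (use \<rho>_less \<rho>_ge inn sq(1) e y0 in auto)
    show "\<rho> ` {- y0<..0} = {e..<2 * M}"
      by (rule img[where g = "\<lambda>x. - sqrt (x - e)"]) (use \<rho>_less \<rho>_ge inn sq(2) e y0 in auto)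
  qed
  have S1: "Sigma1 M H r1 c cb1 = sheet {y0<..}"
    unfolding Sigma1_def
  proof (rule graph_in_sheet)
    show "f1 M H r1 c cb1 (\<rho> y) = \<tau> y" if "y \<in> {y0<..}" for y
      using f1_eq[OF M r1, of "\<rho> y" F H c cb1] dF \<rho>_outer[of y] that e y0 cb1
      by (simp add: F_\<rho>) (simp add: F_def \<tau>_def)
  qed (use signs y0 images in \<open>auto simp: region_I_def\<close>)
  \<comment> \<open>Makes \<open>f3\<close> equal to \<open>2 * \<tau> 0 - F\<close>, the Killing
    time at the mirror point.\<close>
  define cb3 where "cb3 = 2 * \<tau> 0 - F r3"
  have S3: "Sigma3 M H r3 c cb3 = sheet {..<- y0}"
    unfolding Sigma3_def
  proof (rule graph_in_sheet)
    show "f3 M H r3 c cb3 (\<rho> y) = \<tau> y" if "y \<in> {..<- y0}" for y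
      using f3_eq[OF M r3, of "\<rho> y" F H c cb3] dF \<rho>_outer[of y] that e y0 \<tau>_reflect[of "- y"]
      by (simp add: F_\<rho> cb3_def)
  qed (use signs y0 images in \<open>auto simp: region_I'_def\<close>)
  \<comment> \<open>The constant is the Killing time of the turning sphere. \<open>f2s\<close>
    covers \<open>y\<close> from 0 upwards and \<open>f2ss\<close> from 0 downwards; both contain
    the turning sphere.\<close>
  have S2: "Sigma2 M H r2 c (\<tau> 0) = sheet {- y0<..<y0}"
  proof -
    have "graph_in M region_II {e..<2 * M} (f2s M H e c (\<tau> 0)) = sheet {0..<y0}"
    proof (rule graph_in_sheet)
      show "f2s M H e c (\<tau> 0) (\<rho> y) = \<tau> y" if "y \<in> {0..<y0}" for y
        using f2_turning_eq(1)[OF M e(1) \<rho>_ge _ lapse_drift_pos dF limF] \<rho>_less[of y] y0 that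
        by (simp add: F_\<rho> F_e)
    qed (use signs y0 images in \<open>auto simp: region_II_def\<close>)
    moreover have "graph_in M region_II {e..<2 * M} (f2ss M H e c (\<tau> 0)) = sheet {- y0<..0}"
    proof (rule graph_in_sheet)
      show "f2ss M H e c (\<tau> 0) (\<rho> y) = \<tau> y" if "y \<in> {- y0<..0}" for y
        using f2_turning_eq(2)[OF M e(1) \<rho>_ge _ lapse_drift_pos dF limF] \<rho>_less[of y] y0 that \<tau>_reflect[of "- y"]
        by (simp add: F_\<rho> F_e)
    qed (use signs y0 images in \<open>auto simp: region_II_def\<close>)
    moreover have "{- y0<..<y0} = {0..<y0} \<union> {- y0<..0}"
      using y0 by auto
    ultimately show ?thesis
      unfolding Sigma2_def if_not_P[OF c] comp turn by (simp add: sheet_Un)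
  qed
  \<comment> \<open>Both ends run to infinite radius: a bound on \<open>e + y^2\<close> bounds the
    parameter, so subsequences converge.\<close>
  have closed: "closedin (top_of_set (kruskal M)) (sheet UNIV)"
  proof (rule closed_sheet)
    fix s :: "nat \<Rightarrow> real" and r0 U0 V0 :: real
    assume "(\<lambda>n. \<rho> (s n)) \<longlonglongrightarrow> r0"
    then have "Bseq (\<lambda>n. \<rho> (s n))"
      using convergent_imp_Bseq convergentI by blast
    then obtain B where B: "\<And>n. \<bar>\<rho> (s n)\<bar> \<le> B"
      unfolding Bseq_def by auto
    have "\<bar>s n\<bar> \<le> B + 1" for n
    proof -
      have "(s n)^2 \<le> B"
        using B[of n] e by (simp add: \<rho>_def)
      moreover have "2 * \<bar>s n\<bar> \<le> (s n)^2 + 1"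
        using zero_le_power2[of "\<bar>s n\<bar> - 1"] by (simp add: power2_eq_square algebra_simps)
      ultimately show ?thesis
        by simp
    qed
    then have "bounded (range s)"
      by (auto simp: bounded_iff)
    then obtain l k where "strict_mono k" "(s \<circ> k) \<longlonglongrightarrow> l"
      using bounded_imp_convergent_subsequence by blast
    then show "\<exists>y\<in>UNIV. \<exists>k. strict_mono k \<and> (\<lambda>n. s (k n)) \<longlonglongrightarrow> y"
      by (auto simp: comp_def)
  qed
  have \<rho>_y0: "\<rho> y0 = 2 * M" "\<rho> (- y0) = 2 * M"
    using y0 by (simp_all add: even_odd)
  have eq: "{y0<..} \<union> {- y0<..<y0} \<union> {y0} = {- y0<..}"
    "{- y0<..} \<union> {..<- y0} \<union> {- y0} = UNIV" "{- y0<..<y0} \<union> {..<- y0} \<union> {- y0} = {..<y0}"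
    using y0 by auto
  have j12: "join M (sheet {y0<..}) (sheet {- y0<..<y0}) = sheet {- y0<..}"
    "connects_smoothly M (sheet {y0<..}) (sheet {- y0<..<y0})"
    using join_sheets[OF closed, of y0 "{y0<..}" "{- y0<..<y0}", unfolded eq] \<rho>_y0 by (auto simp: subset_iff)
  have j23: "connects_smoothly M (sheet {- y0<..<y0}) (sheet {..<- y0})"
    using join_sheets[OF closed, of "- y0" "{- y0<..<y0}" "{..<- y0}", unfolded eq] \<rho>_y0 by (auto simp: subset_iff)
  have j123: "join M (sheet {- y0<..}) (sheet {..<- y0}) = sheet UNIV"
    using join_sheets[OF closed, of "- y0" "{- y0<..}" "{..<- y0}", unfolded eq] \<rho>_y0 by (auto simp: subset_iff)
  have ss: "ss_cmc M H (sheet UNIV)" "ss_cmc M H (sheet {- y0<..<y0})" "ss_cmc M H (sheet {..<- y0})"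
    by (auto intro!: ss_cmc_sheet)
  then have "complete_hypersurface M (sheet UNIV)"
    using closed by (simp add: complete_hypersurface_def ss_cmc_def)
  then show ?thesis
    using ss j12 j23 j123 has_ends_sheet
    by (intro exI[of _ "\<tau> 0"]) (auto simp: S1 S2 Let_def intro!: exI[of _ cb3] simp: S3)
qed

end

section \<open>The function \<open>k_fun\<close>\<close>

text \<open>The increments of \<open>F\<close> over compact subintervals are lower bounds for the
  integral of \<open>g\<close>, which is one fixed number.\<close>

lemma unbounded_primitive_not_integrable:
  fixes f g F :: "real \<Rightarrow> real"
  assumes g: "set_integrable lborel S g"
    and F: "\<And>x. x \<in> S \<Longrightarrow> (F has_real_derivative f x) (at x)"
    and fg: "\<And>x. x \<in> S \<Longrightarrow> 0 \<le> f x" "\<And>x. x \<in> S \<Longrightarrow> f x \<le> g x"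
    and unbounded: "\<And>K. \<exists>a b. a \<le> b \<and> {a..b} \<subseteq> S \<and> F b - F a > K"
  shows False
proof -
  obtain a b where ab: "a \<le> b" "{a..b} \<subseteq> S" "F b - F a > integral S g"
    using unbounded by blast
  have sub: "set_integrable lborel {a..b} g"
    by (rule set_integrable_subset[OF g _ ab(2)]) simp
  note int = set_borel_integral_eq_integral(1)[OF sub] set_borel_integral_eq_integral(1)[OF g]
  have nonneg: "0 \<le> g x" if "x \<in> S" for x
    using fg[OF that] by linarith
  have "(f has_integral F b - F a) {a..b}"
  proof (rule fundamental_theorem_of_calculus[OF ab(1)])
    fix x assume "x \<in> {a..b}"
    then have "(F has_real_derivative f x) (at x)"
      using F ab(2) by blast
    then show "(F has_vector_derivative f x) (at x within {a..b})"
      using has_vector_derivative_at_within has_real_derivative_iff_has_vector_derivative by blast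
  qed
  then have "F b - F a \<le> integral {a..b} g"
    by (rule has_integral_le[OF _ integrable_integral[OF int(1)]]) (use fg(2) ab(2) in blast)
  also have "\<dots> \<le> integral S g"
    by (rule integral_subset_le[OF ab(2) int]) (simp add: nonneg)
  finally show False
    using ab(3) by simp
qed

locale mean_curvature_parameter =
  fixes M H :: real
  assumes M: "M > 0"
begin

text \<open>The substitution \<open>x = sqrt ((2 * M - r) / r)\<close> turns the critical points of \<open>k_fun\<close> into the
  positive zeros of a polynomial.\<close>

definition R :: "real \<Rightarrow> real" where "R x = 2 * M / (1 + x^2)"
definition X :: "real \<Rightarrow> real" where "X r = sqrt ((2 * M - r) / r)"
definition P :: "real \<Rightarrow> real" where "P x = 3 * x^4 + 2 * x^2 - 1 + 12 * M * H * x"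
definition k :: "real \<Rightarrow> real" where "k x = - H * (R x)^3 - (R x)^2 * x"

lemma den_pos: "1 + x^2 > (0::real)"
  by (simp add: add_pos_nonneg)

lemma R_pos: "R x > 0"
  using M den_pos[of x] by (simp add: R_def)

lemma R_less: "x \<noteq> 0 \<Longrightarrow> R x < 2 * M"
  using M den_pos[of x] by (simp add: R_def field_simps)

lemma R_less_iff: "0 \<le> x \<Longrightarrow> 0 \<le> y \<Longrightarrow> R x < R y \<longleftrightarrow> y < x"
  using M den_pos[of x] den_pos[of y] power2_less_imp_less[of y x] power_strict_mono[of y x 2]
  by (auto simp: R_def divide_less_eq_1 frac_less2 field_simps)

lemma X:
  assumes "r \<in> {0<..<2 * M}"
  shows X_pos: "X r > 0" and R_X: "R (X r) = r" and X_square: "(X r)^2 = - schw_h M r"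
  using assms M by (auto simp: X_def R_def schw_h_def field_simps)

lemma X_R: "x > 0 \<Longrightarrow> X (R x) = x"
proof -
  assume x: "x > 0"
  have "(2 * M - R x) / R x = x^2"
  proof -
    have "(2 * M - R x) / R x = 2 * M / R x - 1"
      using R_pos[of x] by (simp add: diff_divide_distrib)
    moreover have "2 * M / R x = 1 + x^2"
      using M by (simp add: R_def)
    ultimately show ?thesis
      by simp
  qed
  then show ?thesis
    using x by (simp add: X_def)
qed

lemma k_fun_R: "x > 0 \<Longrightarrow> k_fun M H (R x) = k x"
proof -
  assume x: "x > 0"
  define r where "r = R x"
  have r: "0 < r" "r < 2 * M"
    using R_pos R_less[of x] x by (auto simp: r_def)
  have "2 * M - r = x^2 * r"
    using den_pos[of x] by (simp add: r_def R_def field_simps)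
  then have "(2 * M - r) powr (1/2) = x * sqrt r"
    using r x by (simp add: powr_half_sqrt real_sqrt_mult)
  moreover have "r powr (3/2) = r * sqrt r"
  proof -
    have "r powr (3/2) = r powr 1 * r powr (1/2)"
      unfolding powr_add[symmetric] by simp
    then show ?thesis
      using r by (simp add: powr_half_sqrt)
  qed
  ultimately have "r powr (3/2) * (2 * M - r) powr (1/2) = r^2 * x"
    using r by (simp add: power2_eq_square)
  then show ?thesis
    by (simp add: k_fun_def k_def flip: r_def)
qed

text \<open>The factor in front of \<open>P\<close> is positive, so the monotonicity of
  \<open>k_fun\<close> is read off from the sign of a polynomial.\<close>

lemma k_deriv: "(k has_real_derivative (R x)^4 / (4 * M^2) * P x) (at x)"
proof -
  define d where "d = 1 + x^2"
  have d: "d > 0"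
    using den_pos by (simp add: d_def)
  have "(R has_real_derivative - (4 * M * x) / d^2) (at x)"
    unfolding R_def[abs_def] d_def
    by (rule derivative_eq_intros refl | use den_pos[of x] in \<open>simp; fail\<close>)+
       (simp add: power2_eq_square)
  then have "(k has_real_derivative - H * (3 * (R x)^2 * (- (4 * M * x) / d^2)) -
      (2 * R x * (- (4 * M * x) / d^2) * x + (R x)^2)) (at x)"
    unfolding k_def[abs_def]
    by (auto intro!: derivative_eq_intros simp: algebra_simps)
  also have "- H * (3 * (R x)^2 * (- (4 * M * x) / d^2)) -
      (2 * R x * (- (4 * M * x) / d^2) * x + (R x)^2) = (R x)^4 / (4 * M^2) * P x"
  proof -
    have R: "R x = 2 * M / d"
      by (simp add: R_def d_def)
    have "P x = 12 * M * H * x + 4 * (x * x) * d - d^2"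
      unfolding P_def d_def by algebra
    moreover have "- H * (3 * (2 * M / d)^2 * (- (4 * M * x) / d^2)) -
      (2 * (2 * M / d) * (- (4 * M * x) / d^2) * x + (2 * M / d)^2) =
      (2 * M / d)^4 / (4 * M^2) * (12 * M * H * x + 4 * (x * x) * d - d^2)"
      using d M by (simp add: divide_simps) (simp add: algebra_simps eval_nat_numeral)
    ultimately show ?thesis
      unfolding R by simp
  qed
  finally show ?thesis .
qed

lemma P_zero: "\<exists>x0>0. P x0 = 0"
proof -
  \<comment> \<open>Large enough that the linear term of \<open>P\<close> is at least
    \<open>z - z^2\<close>, which the other terms outweigh.\<close>
  define z where "z = 1 + 12 * M * \<bar>H\<bar>"
  have z: "z \<ge> 1"
    using M by (simp add: z_def)
  have "P z \<ge> 0"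
  proof -
    have "12 * M * H \<ge> 12 * M * - \<bar>H\<bar>"
      by (rule mult_left_mono) (use M in auto)
    then have "12 * M * H \<ge> - (12 * M * \<bar>H\<bar>)"
      by simp
    then have "12 * M * H * z \<ge> - (12 * M * \<bar>H\<bar>) * z"
      using z by (intro mult_right_mono) auto
    also have "- (12 * M * \<bar>H\<bar>) * z = z - z^2"
      by (simp add: z_def power2_eq_square algebra_simps)
    finally have "P z \<ge> 3 * z^4 + z^2 + z - 1"
      by (simp add: P_def)
    moreover have "3 * z^4 + z^2 \<ge> 0"
      by simp
    ultimately show ?thesis
      using z by linarith
  qed
  moreover have "continuous_on {0..z} P"
    unfolding P_def by (intro continuous_intros)
  moreover have "P 0 \<le> 0"
    by (simp add: P_def)
  ultimately obtain x0 where "0 \<le> x0" "P x0 = 0"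
    using IVT'[of P 0 0 z] z by auto
  moreover have "x0 \<noteq> 0"
    using \<open>P x0 = 0\<close> by (auto simp: P_def)
  ultimately show ?thesis
    by (metis order_le_less)
qed

text \<open>The quotient \<open>P x / x = 3 * x^3 + 2 * x - 1 / x + 12 * M * H\<close> increases
  strictly, and \<open>H\<close> enters only as an additive constant. Hence there is exactly one
  positive zero whatever the sign of \<open>H\<close>.\<close>

lemma P_mono: "0 < x \<Longrightarrow> x < y \<Longrightarrow> P x * y < P y * x"
proof -
  assume xy: "0 < x" "x < y"
  have "P y * x - P x * y = (y - x) * (3 * x * y * (y^2 + x * y + x^2) + 2 * x * y + 1)"
    by (simp add: P_def algebra_simps eval_nat_numeral)
  moreover have "(y - x) * (3 * x * y * (y^2 + x * y + x^2) + 2 * x * y + 1) > 0"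
    using xy by (intro mult_pos_pos add_nonneg_pos add_nonneg_nonneg mult_nonneg_nonneg) auto
  ultimately show ?thesis
    by simp
qed

definition xH :: real where "xH = (SOME x. x > 0 \<and> P x = 0)"

lemma xH: "xH > 0" "P xH = 0"
  using someI_ex[OF P_zero[unfolded Bex_def]] unfolding xH_def by auto

lemma P_sign: "0 \<le> x \<Longrightarrow> x < xH \<Longrightarrow> P x < 0" "xH < x \<Longrightarrow> P x > 0"
proof -
  show "P x < 0" if "0 \<le> x" "x < xH"
  proof (cases "x = 0")
    case False
    then show ?thesis
      using P_mono[of x xH] that xH by (simp add: mult_less_0_iff)
  qed (simp add: P_def)
  show "P x > 0" if "xH < x"
    using P_mono[of xH x] that xH by (simp add: zero_less_mult_iff)
qed

lemma k_strict_antimono: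
  assumes "0 \<le> x" "x < y" "y \<le> xH"
  shows "k y < k x"
proof (rule DERIV_neg_imp_decreasing_open[OF assms(2)])
  show "\<exists>d. (k has_real_derivative d) (at z) \<and> d < 0" if "x < z" "z < y" for z
  proof -
    have "(R z)^4 / (4 * M^2) * P z < 0"
      using P_sign(1)[of z] that assms R_pos[of z] M by (intro mult_pos_neg) auto
    then show ?thesis
      using k_deriv by blast
  qed
  show "continuous_on {x..y} k"
    using DERIV_isCont[OF k_deriv] by (simp add: continuous_at_imp_continuous_on)
qed

lemma k_strict_mono:
  assumes "xH \<le> x" "x < y"
  shows "k x < k y"
proof (rule DERIV_pos_imp_increasing_open[OF assms(2)])
  show "\<exists>d. (k has_real_derivative d) (at z) \<and> d > 0" if "x < z" "z < y" for z
  proof -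
    have "(R z)^4 / (4 * M^2) * P z > 0"
      using P_sign(2)[of z] that assms R_pos[of z] M by (intro mult_pos_pos) auto
    then show ?thesis
      using k_deriv by blast
  qed
  show "continuous_on {x..y} k"
    using DERIV_isCont[OF k_deriv] by (simp add: continuous_at_imp_continuous_on)
qed

lemma k_min: "0 \<le> x \<Longrightarrow> x \<noteq> xH \<Longrightarrow> k xH < k x"
  using k_strict_antimono[of x xH] k_strict_mono[of xH x] by linarith

lemma k_fun_X: "r \<in> {0<..<2 * M} \<Longrightarrow> k_fun M H r = k (X r)"
  using k_fun_R[OF X_pos] R_X by simp

lemma is_arg_min_k_fun: "is_arg_min (k_fun M H) (\<lambda>x. x \<in> {0<..<2 * M}) r \<longleftrightarrow> r = R xH"
proof
  have in_range: "R xH \<in> {0<..<2 * M}"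
    using R_pos R_less xH by simp
  have X_xH: "X r = xH \<Longrightarrow> r = R xH" if "r \<in> {0<..<2 * M}" for r
    using R_X[OF that] by simp
  have less: "k_fun M H (R xH) < k_fun M H r" if "r \<in> {0<..<2 * M}" "r \<noteq> R xH" for r
    using k_min[of "X r"] X_pos[OF that(1)] X_xH[OF that(1)] that k_fun_X[OF that(1)] k_fun_R[OF xH(1)] by auto
  show "r = R xH" if "is_arg_min (k_fun M H) (\<lambda>x. x \<in> {0<..<2 * M}) r"
    using that less in_range unfolding is_arg_min_def by blast
  show "is_arg_min (k_fun M H) (\<lambda>x. x \<in> {0<..<2 * M}) r" if "r = R xH"
    using that less in_range unfolding is_arg_min_def by (metis order_less_asym order_less_irrefl)
qed

lemma r_min: "r_min M H = R xH"
  unfolding r_min_def is_arg_min_k_fun by (rule the_eq_trivial)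

lemma c_min: "c_min M H = k xH"
  by (simp add: c_min_def r_min k_fun_R xH)

lemma k_fun_gt_min:
  assumes "r \<in> {0<..<2 * M}" "r \<noteq> R xH"
  shows "k_fun M H r > c_min M H"
proof -
  have "X r \<noteq> xH"
    using R_X[OF assms(1)] assms(2) by auto
  then show ?thesis
    using k_min[of "X r"] X_pos[OF assms(1)] by (simp add: k_fun_X[OF assms(1)] c_min)
qed

lemma c_min_less: "c_min M H < - 8 * M^3 * H"
proof -
  have "k 0 = - 8 * M^3 * H"
    by (simp add: k_def R_def power3_eq_cube)
  then show ?thesis
    using k_min[of 0] xH by (simp add: c_min)
qed

text \<open>As \<open>X r\<close> is the root of \<open>- h\<close>, comparing \<open>k_fun\<close>
  with \<open>c\<close> amounts to comparing \<open>- drift\<close> with that root: \<open>>\<close>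
  is the condition \<open>l2 > 1\<close>, and equality means that \<open>h + drift^2\<close>
  vanishes with negative drift.\<close>

lemma drift_X:
  assumes "r \<in> {0<..<2 * M}"
  shows "k_fun M H r - c = r^2 * (- drift H c r - X r)"
  using assms unfolding k_fun_X[OF assms] k_def R_X[OF assms] drift_def
  by (simp add: field_simps power2_eq_square power3_eq_cube)

lemma l2_gt_1_iff:
  assumes r: "r \<in> {0<..<2 * M}"
  shows "l2 M H c r > 1 \<longleftrightarrow> k_fun M H r > c"
proof -
  have "sqrt (- schw_h M r) = X r"
    using X_square[OF r, symmetric] X_pos[OF r] by simp
  then have l2: "l2 M H c r = - drift H c r / X r"
    by (simp add: l2_def drift_def)
  have "l2 M H c r > 1 \<longleftrightarrow> 1 * X r < - drift H c r"
    unfolding l2 by (rule pos_less_divide_eq[OF X_pos[OF r]])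
  also have "\<dots> \<longleftrightarrow> - drift H c r - X r > 0"
    by auto
  also have "\<dots> \<longleftrightarrow> k_fun M H r - c > 0"
    unfolding drift_X[OF r] using r by (simp add: zero_less_mult_iff)
  finally show ?thesis
    by simp
qed

lemma k_fun_gt:
  assumes r: "r \<in> {0<..<2 * M}" and k: "k_fun M H r > c"
  shows "drift H c r < 0" "schw_h M r + (drift H c r)^2 > 0"
proof -
  have "r^2 * (- drift H c r - X r) > 0"
    using drift_X[OF r, of c] k by simp
  then have *: "X r < - drift H c r"
    using r by (simp add: zero_less_mult_iff)
  then show "drift H c r < 0"
    using X_pos[OF r] by simp
  have "(X r)^2 < (- drift H c r)^2"
    using * X_pos[OF r] by (intro power_strict_mono) auto
  then show "schw_h M r + (drift H c r)^2 > 0"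
    using X_square[OF r] by simp
qed

lemma k_fun_eq:
  assumes r: "r \<in> {0<..<2 * M}" and k: "k_fun M H r = c"
  shows "drift H c r = - X r"
  using drift_X[OF r, of c] k r by auto

lemma drift_horizon: "c < - 8 * M^3 * H \<Longrightarrow> drift H c (2 * M) < 0"
  using M by (simp add: drift_def field_simps power2_eq_square power3_eq_cube)

lemma outer_pos:
  assumes "c < - 8 * M^3 * H" "x \<ge> 2 * M"
  shows "schw_h M x + (drift H c x)^2 > 0"
proof (cases "x = 2 * M")
  case True
  then show ?thesis
    using drift_horizon[OF assms(1)] M schw_h_zero_iff[of M x] by simp
next
  case False
  then show ?thesis
    using schw_h_pos_iff[of M x] assms(2) M by (simp add: add_pos_nonneg)
qed

lemma f2_domain_iff:
  "k_fun M H r \<noteq> c \<Longrightarrow> r \<in> f2_domain M H c \<longleftrightarrow> r \<in> {0<..<2 * M} \<and> k_fun M H r > c"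
  by (auto simp: f2_domain_def l2_gt_1_iff)

subsection \<open>Expansion at a zero of the denominator\<close>

text \<open>The divided difference between \<open>x\<close> and \<open>e\<close> of the polynomial
  \<open>(H * x^3 + c)^2 + x^4 - 2 * M * x^3\<close>, which is
  \<open>x^4 * (h + drift^2)\<close>.\<close>

definition Q1 :: "real \<Rightarrow> real \<Rightarrow> real \<Rightarrow> real" where
  "Q1 c e x = H^2 * (x^5 + x^4 * e + x^3 * e^2 + x^2 * e^3 + x * e^4 + e^5) +
    (2 * H * c - 2 * M) * (x^2 + x * e + e^2) + (x^3 + x^2 * e + x * e^2 + e^3)"

text \<open>The divided difference of \<open>Q1 c e\<close> between \<open>x\<close> and
  \<open>e\<close>; it becomes the cofactor when the zero at \<open>e\<close> is double.\<close>

definition Q2 :: "real \<Rightarrow> real \<Rightarrow> real \<Rightarrow> real" where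
  "Q2 c e x = H^2 * (x^4 + 2 * e * x^3 + 3 * e^2 * x^2 + 4 * e^3 * x + 5 * e^4) +
    (2 * H * c - 2 * M) * (x + 2 * e) + (x^2 + 2 * e * x + 3 * e^2)"

lemma lapse_factor:
  assumes e: "e \<in> {0<..<2 * M}" "k_fun M H e = c" and x: "x > 0"
  shows "x^4 * (schw_h M x + (drift H c x)^2) = (x - e) * Q1 c e x"
proof -
  have ex: "x^4 * (schw_h M x + (drift H c x)^2) = (H * x^3 + c)^2 + x^4 - 2 * M * x^3" if "x > 0" for x
    using that unfolding schw_h_def drift_def
    by (simp add: field_simps) (simp add: algebra_simps eval_nat_numeral)
  have "schw_h M e + (drift H c e)^2 = 0"
    using k_fun_eq[OF e] X_square[OF e(1)] by simp
  then have "(H * e^3 + c)^2 + e^4 - 2 * M * e^3 = 0"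
    using ex[of e] e by simp
  then have "x^4 * (schw_h M x + (drift H c x)^2) =
      ((H * x^3 + c)^2 + x^4 - 2 * M * x^3) - ((H * e^3 + c)^2 + e^4 - 2 * M * e^3)"
    using ex[OF x] by simp
  also have "\<dots> = (x - e) * Q1 c e x"
    unfolding Q1_def by algebra
  finally show ?thesis .
qed

lemma Q1_eq: "Q1 c e x = Q1 c e e + (x - e) * Q2 c e x"
  unfolding Q1_def Q2_def by algebra

text \<open>\<open>Q1 c e e\<close> is the derivative of the polynomial at its zero
  \<open>e\<close>. So \<open>P\<close> decides the order: the zero is simple for \<open>e\<close>
  above the critical radius, where \<open>P < 0\<close>, and at least double at it, where
  \<open>P = 0\<close>.\<close>

lemma Q1_self:
  assumes e: "e \<in> {0<..<2 * M}" "k_fun M H e = c"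
  shows "Q1 c e e * (1 + (X e)^2) = - (e^3) * P (X e)"
proof -
  define y where "y = X e"
  have Me: "2 * M = e * (1 + y^2)"
    using R_X[OF e(1)] den_pos[of y] by (simp add: R_def y_def field_simps)
  have c: "c = - (e^2) * y - H * e^3"
    using k_fun_X[OF e(1)] e(2) R_X[OF e(1)] by (simp add: k_def y_def)
  have "Q1 c e e = 6 * H^2 * e^5 + 3 * (2 * H * c - e * (1 + y^2)) * e^2 + 4 * e^3"
    unfolding Q1_def Me by algebra
  moreover have "P y = 3 * y^4 + 2 * y^2 - 1 + 6 * H * (e * (1 + y^2)) * y"
    unfolding P_def Me[symmetric] by simp
  ultimately show ?thesis
    unfolding y_def[symmetric] c by algebra
qed

section \<open>Divergence of the height at the critical radius\<close>

lemma isCont_Q2: "isCont (Q2 c e) x"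
  unfolding Q2_def by (intro continuous_intros)

text \<open>At the zero of order at least two the root in the denominator of \<open>slope\<close>
  contains the factor \<open>\<bar>x - e\<bar>\<close>. The bound serves twice: it excludes
  \<open>e\<close> from the domain of \<open>f2s\<close>, and it gives closedness of the critical
  hypersurface.\<close>

lemma critical_slope_bound:
  fixes e c :: real
  defines "e \<equiv> R xH" and "c \<equiv> c_min M H"
  obtains \<kappa> d where "\<kappa> > 0" "d > 0" "{e - d..e + d} \<subseteq> {0<..<2 * M}"
    "\<And>x. x \<noteq> e \<Longrightarrow> \<bar>x - e\<bar> < d \<Longrightarrow> slope M H c x \<ge> \<kappa> / \<bar>x - e\<bar>"
proof -
  have e: "e \<in> {0<..<2 * M}" "k_fun M H e = c" "X e = xH"
    using R_pos R_less xH by (auto simp: e_def c_def c_min k_fun_R X_R)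
  have k_gt: "k_fun M H x > c" if "x \<in> {0<..<2 * M}" "x \<noteq> e" for x
    using k_fun_gt_min that by (simp add: c_def e_def)
  have "Q1 c e e = 0"
    using Q1_self[OF e(1,2)] xH(2) e(3) den_pos[of xH] by auto
  then have factor: "x^4 * (schw_h M x + (drift H c x)^2) = (x - e)^2 * Q2 c e x" if "x > 0" for x
    using lapse_factor[OF e(1,2) that] Q1_eq[of c e x] by (simp add: power2_eq_square)
  \<comment> \<open>The reciprocal of \<open>\<bar>x - e\<bar> * slope\<close>. An upper bound near
    \<open>e\<close>, from continuity, yields \<open>\<kappa>\<close>.\<close>
  define \<eta> where "\<eta> x = - schw_h M x * sqrt (Q2 c e x) / (- drift H c x * x^2)" for x
  have drift_e: "drift H c e < 0"
    using k_fun_eq[OF e(1,2)] X_pos[OF e(1)] by simp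
  have "isCont \<eta> e"
    unfolding \<eta>_def using e drift_e
    by (intro continuous_intros isCont_Q2 DERIV_isCont[OF schw_h_deriv] DERIV_isCont[OF drift_deriv]) auto
  then have "\<forall>\<^sub>F x in nhds e. \<eta> x < \<bar>\<eta> e\<bar> + 1"
    using order_tendstoD(2)[of \<eta> "\<eta> e" "nhds e" "\<bar>\<eta> e\<bar> + 1"] by (simp add: isCont_def tendsto_at_iff_tendsto_nhds)
  then obtain d1 where d1: "d1 > 0" "\<And>x. \<bar>x - e\<bar> < d1 \<Longrightarrow> \<eta> x < \<bar>\<eta> e\<bar> + 1"
    unfolding eventually_nhds_metric dist_real_def by blast
  define d where "d = min d1 (min e (2 * M - e)) / 2"
  have d: "d > 0" "d < d1" "d < e" "d < 2 * M - e"
    using d1(1) e(1) by (auto simp: d_def min_def)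
  define \<kappa> where "\<kappa> = 1 / (\<bar>\<eta> e\<bar> + 1)"
  have bound: "slope M H c x \<ge> \<kappa> / \<bar>x - e\<bar>" if x: "x \<noteq> e" "\<bar>x - e\<bar> < d" for x
  proof -
    have xr: "x \<in> {0<..<2 * M}"
      using x d by (auto simp: abs_if split: if_splits)
    note k = k_fun_gt[OF xr k_gt[OF xr x(1)]]
    have h: "schw_h M x < 0"
      using schw_h_neg_iff[of M x] xr M by simp
    have x0: "x > 0"
      using xr by simp
    have "(x - e)^2 * Q2 c e x > 0"
      unfolding factor[OF x0, symmetric] using k(2) x0 by simp
    then have Q2: "Q2 c e x > 0"
      using x(1) by (simp add: zero_less_mult_iff)
    have "sqrt (x^4 * (schw_h M x + (drift H c x)^2)) = \<bar>x - e\<bar> * sqrt (Q2 c e x)"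
      unfolding factor[OF x0] by (simp add: real_sqrt_mult)
    moreover have "sqrt (x^4 * (schw_h M x + (drift H c x)^2)) = x^2 * sqrt (schw_h M x + (drift H c x)^2)"
    proof -
      have "x^4 = (x^2)^2"
        by simp
      then show ?thesis
        by (simp only: real_sqrt_mult real_sqrt_abs) simp
    qed
    ultimately have w: "sqrt (schw_h M x + (drift H c x)^2) = \<bar>x - e\<bar> * sqrt (Q2 c e x) / x^2"
      using x0 by (simp add: field_simps)
    have "\<eta> x > 0"
      unfolding \<eta>_def using h Q2 k(1) x0 by (intro divide_pos_pos mult_pos_pos) auto
    have "slope M H c x = 1 / (\<eta> x * \<bar>x - e\<bar>)"
      unfolding slope_def w \<eta>_def using h Q2 k(1) x0 x(1) by (simp add: field_simps)
    also have "\<dots> \<ge> 1 / ((\<bar>\<eta> e\<bar> + 1) * \<bar>x - e\<bar>)"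
      using \<open>\<eta> x > 0\<close> d1(2)[of x] x d by (intro divide_left_mono mult_right_mono mult_pos_pos) auto
    finally show ?thesis
      by (simp add: \<kappa>_def)
  qed
  show thesis
    by (rule that[of \<kappa> d]) (use d bound in \<open>auto simp: \<kappa>_def\<close>)
qed

text \<open>Here \<open>k_fun\<close> equals \<open>c\<close>, so membership would need a finite
  integral from one side. On either side the integrand dominates a multiple of the reciprocal
  distance, whose logarithmic primitive is unbounded.\<close>

lemma critical_not_in_domain: "R xH \<notin> f2_domain M H (c_min M H)"
proof
  define e where "e = R xH"
  define c where "c = c_min M H"
  obtain \<kappa> d where d: "\<kappa> > 0" "d > 0" "{e - d..e + d} \<subseteq> {0<..<2 * M}"
    and bound: "\<And>x. x \<noteq> e \<Longrightarrow> \<bar>x - e\<bar> < d \<Longrightarrow> slope M H c x \<ge> \<kappa> / \<bar>x - e\<bar>"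
    using critical_slope_bound unfolding e_def c_def by blast
  have e: "e \<in> {0<..<2 * M}" "k_fun M H e = c"
    using R_pos R_less xH by (auto simp: e_def c_def c_min k_fun_R)
  have k_gt: "k_fun M H x > c" if "x \<in> {0<..<2 * M}" "x \<noteq> e" for x
    using k_fun_gt_min that by (simp add: c_def e_def)
  have f2: "f2_integrand M H c x \<ge> \<kappa> / \<bar>x - e\<bar>" if "x \<noteq> e" "\<bar>x - e\<bar> < d" for x
  proof -
    have x: "x \<in> {0<..<2 * M}"
      using d(3) that by (auto simp: abs_if subset_iff split: if_splits)
    show ?thesis
      using f2_integrand_eq[of M x H c] k_fun_gt[OF x k_gt[OF x that(1)]] x M bound[OF that] by simp
  qed
  assume "R xH \<in> f2_domain M H (c_min M H)"
  moreover have "\<not> l2 M H c e > 1"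
    using l2_gt_1_iff[OF e(1)] e(2) by simp
  ultimately obtain y where y: "y \<in> {0<..<2 * M}" "y \<noteq> e"
    and int: "interval_lebesgue_integrable lborel (ereal y) (ereal e) (f2_integrand M H c)"
    by (auto simp: f2_domain_def e_def c_def)
  \<comment> \<open>The witness is \<open>t\<close> times an exponential chosen so that the
    difference is exactly \<open>\<bar>K\<bar> + 1\<close>.\<close>
  have log_gap: "\<exists>u. 0 < u \<and> u \<le> t \<and> \<kappa> * ln t - \<kappa> * ln u > K" if "t > 0" for t K
  proof (intro exI conjI)
    let ?x = "(\<bar>K\<bar> + 1) / \<kappa>"
    have "?x \<ge> 0"
      using d by (intro divide_nonneg_pos) auto
    then show "t * exp (- ?x) \<le> t"
      using that mult_left_mono[of "exp (- ?x)" 1 t] by simp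
    have "\<kappa> * ?x = \<bar>K\<bar> + 1"
      using d by simp
    then show "\<kappa> * ln t - \<kappa> * ln (t * exp (- ?x)) > K"
      using that by (simp add: ln_mult algebra_simps)
  qed (use that in simp)
  show False
  proof (cases "y < e")
    case True
    define l where "l = max y (e - d)"
    have l: "l < e" "y \<le> l" "e - d \<le> l"
      using True d(2) by (auto simp: l_def)
    have "set_integrable lborel {y<..<e} (f2_integrand M H c)"
      using int True by (simp add: interval_lebesgue_integrable_def)
    then have "set_integrable lborel {l<..<e} (f2_integrand M H c)"
      by (rule set_integrable_subset) (use l in auto)
    then show False
    proof (rule unbounded_primitive_not_integrable[where F = "\<lambda>x. - \<kappa> * ln (e - x)" and f = "\<lambda>x. \<kappa> / \<bar>x - e\<bar>"])
      fix x assume x: "x \<in> {l<..<e}"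
      then show "((\<lambda>x. - \<kappa> * ln (e - x)) has_real_derivative \<kappa> / \<bar>x - e\<bar>) (at x)"
        by (auto intro!: derivative_eq_intros simp: field_simps)
      show "0 \<le> \<kappa> / \<bar>x - e\<bar>"
        using d by simp
      show "\<kappa> / \<bar>x - e\<bar> \<le> f2_integrand M H c x"
        using x l by (intro f2) auto
    next
      fix K
      define t where "t = (e - l) / 2"
      have t: "t > 0" "l + t = e - t"
        using l(1) by (auto simp: t_def field_simps)
      obtain u where u: "0 < u" "u \<le> t" "\<kappa> * ln t - \<kappa> * ln u > K"
        using log_gap[OF t(1)] by blast
      have "{e - t..e - u} \<subseteq> {l<..<e}"
        using t u(1) by (intro subsetI) (simp only: atLeastAtMost_iff greaterThanLessThan_iff, linarith)
      then show "\<exists>a b. a \<le> b \<and> {a..b} \<subseteq> {l<..<e} \<and> - \<kappa> * ln (e - b) - - \<kappa> * ln (e - a) > K"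
        using u by (intro exI[of _ "e - t"] exI[of _ "e - u"]) simp
    qed
  next
    case False
    define u where "u = min y (e + d)"
    have u: "e < u" "u \<le> y" "u \<le> e + d"
      using False y(2) d(2) by (auto simp: u_def)
    have "set_integrable lborel {e<..<y} (f2_integrand M H c)"
      using int False y(2) by (simp add: interval_lebesgue_integrable_def)
    then have "set_integrable lborel {e<..<u} (f2_integrand M H c)"
      by (rule set_integrable_subset) (use u in auto)
    then show False
    proof (rule unbounded_primitive_not_integrable[where F = "\<lambda>x. \<kappa> * ln (x - e)" and f = "\<lambda>x. \<kappa> / \<bar>x - e\<bar>"])
      fix x assume x: "x \<in> {e<..<u}"
      then show "((\<lambda>x. \<kappa> * ln (x - e)) has_real_derivative \<kappa> / \<bar>x - e\<bar>) (at x)"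
        by (auto intro!: derivative_eq_intros simp: field_simps)
      show "0 \<le> \<kappa> / \<bar>x - e\<bar>"
        using d by simp
      show "\<kappa> / \<bar>x - e\<bar> \<le> f2_integrand M H c x"
        using x u by (intro f2) auto
    next
      fix K
      define t where "t = (u - e) / 2"
      have t: "t > 0" "e + t = u - t"
        using u(1) by (auto simp: t_def field_simps)
      obtain v where v: "0 < v" "v \<le> t" "\<kappa> * ln t - \<kappa> * ln v > K"
        using log_gap[OF t(1)] by blast
      have "{e + v..e + t} \<subseteq> {e<..<u}"
        using t v(1) by (intro subsetI) (simp only: atLeastAtMost_iff greaterThanLessThan_iff, linarith)
      then show "\<exists>a b. a \<le> b \<and> {a..b} \<subseteq> {e<..<u} \<and> \<kappa> * ln (b - e) - \<kappa> * ln (a - e) > K"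
        using v by (intro exI[of _ "e + v"] exI[of _ "e + t"]) simp
    qed
  qed
qed

end

section \<open>Convergence of the height integral at a turning radius\<close>

context turning
begin

lemma f2_integrand_integrable:
  assumes "e < x" "x < 2 * M"
  shows "interval_lebesgue_integrable lborel (ereal x) (ereal e) (f2_integrand M H c)"
proof -
  \<comment> \<open>The value \<open>3 * M\<close> is an arbitrary radius outside the horizon; any
    curve provides the primitive.\<close>
  obtain U V where curve: "radial_curve M H c UNIV \<rho> w m U V"
    using turning_curve[of "3 * M"] M by force
  show ?thesis
    by (rule f2_integrand_improper(1)[OF M e(1) assms lapse_drift_pos
        height_primitive(1)[OF curve] height_primitive(2)[OF curve]]) auto
qed

end

section \<open>The three ranges of the parameter c\<close>

context mean_curvature_parameter
begin

lemma f2_domain_range: "r \<in> f2_domain M H c \<Longrightarrow> r \<in> {0<..<2 * M}"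
  by (simp add: f2_domain_def)

lemma f2_component_subcritical:
  assumes "c < c_min M H"
  shows "f2_component M H c = {0<..<2 * M}"
proof -
  have "k_fun M H r > c" if "r \<in> {0<..<2 * M}" for r
    using k_fun_gt_min[OF that] assms k_fun_R[OF xH(1)] by (cases "r = R xH") (auto simp: c_min)
  then have dom: "r \<in> f2_domain M H c \<longleftrightarrow> r \<in> {0<..<2 * M}" for r
    using \<open>r \<in> {0<..<2 * M} \<Longrightarrow> c < k_fun M H r\<close> f2_domain_iff[of r c] f2_domain_range[of r c]
    by (metis order_less_irrefl)
  have "{r..<2 * M} \<subseteq> f2_domain M H c" if "r \<in> {0<..<2 * M}" for r
    using that by (intro subsetI) (simp add: dom)
  then show ?thesis
    unfolding f2_component_def using dom by blast
qed

lemma f2_component_critical: "f2_component M H (c_min M H) = {R xH<..<2 * M}"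
proof -
  have "r \<in> f2_domain M H (c_min M H) \<longleftrightarrow> r \<in> {0<..<2 * M} \<and> r \<noteq> R xH" for r
  proof (cases "r \<in> {0<..<2 * M} \<and> r \<noteq> R xH")
    case True
    then show ?thesis
      using f2_domain_iff[of r "c_min M H"] k_fun_gt_min[of r] by auto
  next
    case False
    then show ?thesis
      using critical_not_in_domain f2_domain_range[of r "c_min M H"] by auto
  qed
  note dom = this
  show ?thesis
  proof (intro equalityI subsetI)
    fix r assume "r \<in> f2_component M H (c_min M H)"
    then have "r < 2 * M" "R xH \<notin> {r..<2 * M}"
      using dom[of r] dom[of "R xH"] by (auto simp: f2_component_def)
    then show "r \<in> {R xH<..<2 * M}"
      using R_less[of xH] xH(1) by auto
  next
    fix r assume r: "r \<in> {R xH<..<2 * M}"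
    have "s \<in> f2_domain M H (c_min M H)" if "s \<in> {r..<2 * M}" for s
      using that r R_pos[of xH] dom[of s] by simp
    then show "r \<in> f2_component M H (c_min M H)"
      using r by (simp add: f2_component_def subset_iff)
  qed
qed

text \<open>\<open>k\<close> decreases from \<open>- 8 * M^3 * H\<close> at 0 to its minimum at
  \<open>xH\<close>, so it takes the value \<open>c\<close> in between. The corresponding radius
  \<open>e\<close> exceeds the critical one, and \<open>k_fun\<close> stays above \<open>c\<close>
  from \<open>e\<close> to the horizon.\<close>

lemma supercritical_turning:
  assumes c: "c_min M H < c" "c < - 8 * M^3 * H"
  obtains e Q1' where "turning M H c e (Q1 c e) Q1'"
    "f2_component M H c = {e..<2 * M}" "r_turn M H c = e"
proof -
  have "k 0 = - 8 * M^3 * H"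
    by (simp add: k_def R_def power3_eq_cube)
  then have "\<exists>x. 0 \<le> x \<and> x \<le> xH \<and> k x = c"
    using c xH by (intro IVT2') (auto simp: c_min intro!: continuous_at_imp_continuous_on DERIV_isCont[OF k_deriv])
  then obtain x where x: "0 \<le> x" "x \<le> xH" "k x = c"
    by blast
  have "x \<noteq> 0" "x \<noteq> xH"
    using x c \<open>k 0 = _\<close> by (auto simp: c_min)
  then have x: "0 < x" "x < xH" "k x = c"
    using x by auto
  define e where "e = R x"
  have e: "e \<in> {0<..<2 * M}" "k_fun M H e = c" "X e = x"
    using R_pos R_less x by (auto simp: e_def k_fun_R X_R)
  have X_less: "X r < x \<longleftrightarrow> e < r" "x < X r \<longleftrightarrow> r < e" if "r \<in> {0<..<2 * M}" for r
    using R_less_iff[of x "X r"] R_less_iff[of "X r" x] x X_pos[OF that] R_X[OF that] by (auto simp: e_def)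
  have k_gt: "k_fun M H r > c" if "r \<in> {e<..<2 * M}" for r
  proof -
    have "r \<in> {0<..<2 * M}"
      using that e(1) by auto
    then show ?thesis
      using k_strict_antimono[of "X r" x] X_less[of r] X_pos[of r] x that by (simp add: k_fun_X)
  qed
  define Q1' where "Q1' z = H^2 * (5 * z^4 + 4 * z^3 * e + 3 * z^2 * e^2 + 2 * z * e^3 + e^4) +
    (2 * H * c - 2 * M) * (2 * z + e) + (3 * z^2 + 2 * z * e + e^2)" for z
  have neg: "drift H c z < 0" if z: "e \<le> z" "z \<le> 2 * M" for z
  proof -
    consider "z = e" | "z \<in> {e<..<2 * M}" | "z = 2 * M"
      using z by fastforce
    then show ?thesis
    proof cases
      case 1
      then show ?thesis
        using k_fun_eq[OF e(1,2)] X_pos[OF e(1)] by simp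
    next
      case 2
      then show ?thesis
        using k_fun_gt(1)[OF _ k_gt] e(1) by auto
    next
      case 3
      then show ?thesis
        using drift_horizon[OF c(2)] by simp
    qed
  qed
  have pos: "schw_h M z + (drift H c z)^2 > 0" if "e < z" for z
    using that k_fun_gt(2)[OF _ k_gt, of z] outer_pos[OF c(2), of z] e(1) by (cases "z < 2 * M") auto
  have turn: "turning M H c e (Q1 c e) Q1'"
  proof
    show "M > 0" "0 < e" "e < 2 * M"
      using M e(1) by auto
    show "(Q1 c e has_real_derivative Q1' z) (at z)" for z
      unfolding Q1_def Q1'_def by (auto intro!: derivative_eq_intros simp: algebra_simps)
    show "z^4 * (schw_h M z + (drift H c z)^2) = (z - e) * Q1 c e z" if "z > 0" for z
      by (rule lapse_factor[OF e(1,2) that])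
    show "Q1 c e z > 0" if "e \<le> z" for z
    proof (cases "z = e")
      case True
      have "Q1 c e e * (1 + (X e)^2) = e^3 * - P (X e)"
        using Q1_self[OF e(1,2)] by simp
      also have "\<dots> > 0"
        using e P_sign(1)[of x] x by (intro mult_pos_pos) auto
      finally show ?thesis
        using True den_pos[of "X e"] by (simp add: zero_less_mult_iff)
    next
      case False
      then have "z > e" "z > 0"
        using that e(1) by auto
      then have "(z - e) * Q1 c e z > 0"
        unfolding lapse_factor[OF e(1,2) \<open>z > 0\<close>, symmetric] using pos by (intro mult_pos_pos) auto
      then show ?thesis
        using \<open>z > e\<close> by (simp add: zero_less_mult_iff)
    qed
  qed (use neg in auto)
  have dom_gt: "r \<in> f2_domain M H c" if "r \<in> {e<..<2 * M}" for r
    using that e(1) l2_gt_1_iff[of r c] k_gt by (auto simp: f2_domain_def)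
  have e_dom: "e \<in> f2_domain M H c"
  proof -
    define y where "y = (e + 2 * M) / 2"
    have y: "e < y" "y < 2 * M"
      using e(1) by (auto simp: y_def)
    have "l2 M H c z > 1" if "z \<in> open_segment y e" for z
      using that y e(1) l2_gt_1_iff[of z c] k_gt[of z] by (auto simp: open_segment_eq_real_ivl)
    then show ?thesis
      using e y turning.f2_integrand_integrable[OF turn y] by (auto simp: f2_domain_def intro!: bexI[of _ y])
  qed
  have comp: "f2_component M H c = {e..<2 * M}"
  proof (intro equalityI subsetI)
    fix r assume r: "r \<in> {e..<2 * M}"
    have "z \<in> f2_domain M H c" if "z \<in> {r..<2 * M}" for z
      using that r dom_gt[of z] e_dom by (cases "z = e") auto
    then show "r \<in> f2_component M H c"
      using r by (simp add: f2_component_def subset_iff)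
  next
    fix r assume r: "r \<in> f2_component M H c"
    then have rd: "r \<in> f2_domain M H c" "{r..<2 * M} \<subseteq> f2_domain M H c" "r \<in> {0<..<2 * M}"
      by (auto simp: f2_component_def f2_domain_def)
    have "e \<le> r"
    proof (rule ccontr)
      assume "\<not> e \<le> r"
      \<comment> \<open>A radius between the critical one and \<open>e\<close>, hence with
        \<open>k_fun\<close> below \<open>c\<close>: a gap of the domain that
        \<open>{r..<2 * M}\<close> would have to contain.\<close>
      define z where "z = max r (R xH)"
      have "R xH < e"
        using R_less_iff[of xH x] xH x by (simp add: e_def)
      then have z: "z < e" "z \<in> {0<..<2 * M}" "R xH \<le> z" "r \<le> z"
        using \<open>\<not> e \<le> r\<close> rd(3) e(1) R_pos[of xH] by (auto simp: z_def)
      have "X z \<le> xH"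
        using R_less_iff[of "X z" xH] R_X[OF z(2)] X_pos[OF z(2)] xH z(3)
        by (metis less_eq_real_def linorder_not_less)
      then have "k_fun M H z < c"
        using k_strict_antimono[of x "X z"] X_less(2)[OF z(2)] z(1) x by (simp add: k_fun_X[OF z(2)])
      then have "z \<notin> f2_domain M H c"
        using f2_domain_iff[of z c] by simp
      then show False
        using rd(2) z by auto
    qed
    then show "r \<in> {e..<2 * M}"
      using rd(3) by simp
  qed
  have "r_turn M H c = e"
    unfolding r_turn_def
  proof (rule the_equality)
    show "k_fun M H e = c \<and> f2_component M H c = {e..<2 * M}"
      using e comp by simp
    show "r = e" if "k_fun M H r = c \<and> f2_component M H c = {r..<2 * M}" for r
    proof -
      have "{r..<2 * M} = {e..<2 * M}" "e < 2 * M"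
        using that comp e(1) by auto
      then show ?thesis
        by (metis atLeastLessThan_iff atLeastLessThan_empty_iff2 order_antisym order_refl linorder_not_less)
    qed
  qed
  then show thesis
    using that turn comp by blast
qed

lemma subcritical_hypersurface:
  assumes c: "c < c_min M H" and r: "r1 > 2 * M" "r2 \<in> {0<..<2 * M}"
  shows "\<exists>cb2. complete_pair M H (Sigma1 M H r1 c cb1) (Sigma2 M H r2 c cb2)"
proof (rule Sigma1_Sigma2_transversal[where lo = 0])
  have c': "c < - 8 * M^3 * H"
    using c c_min_less by simp
  have k: "k_fun M H x > c" if "x \<in> {0<..<2 * M}" for x
    using that f2_component_subcritical[OF c] k_fun_gt_min[OF that] c k_fun_R[OF xH(1)]
    by (cases "x = R xH") (auto simp: c_min)
  show "drift H c x < 0" if "0 < x" "x \<le> 2 * M" for x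
    using that k_fun_gt(1)[OF _ k, of x] drift_horizon[OF c'] by (cases "x = 2 * M") auto
  show "schw_h M x + (drift H c x)^2 > 0" if "0 < x" for x
    using that k_fun_gt(2)[OF _ k, of x] outer_pos[OF c', of x] by (cases "x < 2 * M") auto
qed (use c r M f2_component_subcritical in auto)

lemma critical_hypersurface:
  assumes r: "r1 > 2 * M" "r2 \<in> {R xH<..<2 * M}"
  defines "c \<equiv> c_min M H"
  shows "\<exists>cb2. complete_pair M H (Sigma1 M H r1 c cb1) (Sigma2 M H r2 c cb2)"
proof (rule Sigma1_Sigma2_transversal[where lo = "R xH"])
  have c': "c < - 8 * M^3 * H"
    using c_min_less by (simp add: c_def)
  have k: "k_fun M H x > c" if "x \<in> {R xH<..<2 * M}" for x
    using k_fun_gt_min[of x] that R_pos[of xH] by (simp add: c_def)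
  show "drift H c x < 0" if "R xH < x" "x \<le> 2 * M" for x
    using that k_fun_gt(1)[OF _ k, of x] drift_horizon[OF c'] R_pos[of xH] by (cases "x = 2 * M") auto
  show "schw_h M x + (drift H c x)^2 > 0" if "R xH < x" for x
    using that k_fun_gt(2)[OF _ k, of x] outer_pos[OF c', of x] R_pos[of xH] by (cases "x < 2 * M") auto
  obtain \<kappa> d where d: "\<kappa> > 0" "d > 0"
    "\<And>x. x \<noteq> R xH \<Longrightarrow> \<bar>x - R xH\<bar> < d \<Longrightarrow> slope M H c x \<ge> \<kappa> / \<bar>x - R xH\<bar>"
    using critical_slope_bound unfolding c_def by metis
  have "slope M H c x \<ge> \<kappa> / (x - R xH)" if "R xH < x" "x < R xH + d" for x
    using d(3)[of x] that by simp
  then show "\<exists>\<kappa>>0. \<exists>d>R xH. \<forall>x. R xH < x \<longrightarrow> x < d \<longrightarrow> slope M H c x \<ge> \<kappa> / (x - R xH)"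
    using d(1,2) by (intro exI[of _ \<kappa>] conjI exI[of _ "R xH + d"]) auto
  show "f2_component M H c = {R xH<..<2 * M}"
    unfolding c_def by (rule f2_component_critical)
qed (use r M R_pos[of xH] R_less[of xH] xH in \<open>auto simp: c_def\<close>)

end

theorem theorem1:
  fixes M H c1 cb1 r1 r2 r3 :: real
  assumes "M > 0"
    and "r1 > 2 * M" and "r3 > 2 * M"
    and "r2 \<in> f2_component M H c1"
    and "c1 < - 8 * M^3 * H"
  shows "(\<exists>!r. is_arg_min (k_fun M H) (\<lambda>x. x \<in> {0<..<2 * M}) r) \<and>
    c_min M H < - 8 * M^3 * H \<and>
    (\<exists>cb2.
      let S1 = Sigma1 M H r1 c1 cb1; S2 = Sigma2 M H r2 c1 cb2 in
        ss_cmc M H S2 \<and> connects_smoothly M S1 S2 \<and>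
        (c1 < c_min M H \<longrightarrow>
          f2_component M H c1 = {0<..<2 * M} \<and>
          ss_cmc M H (join M S1 S2) \<and> complete_hypersurface M (join M S1 S2) \<and>
          has_ends (join M S1 S2) 2) \<and>
        (c1 = c_min M H \<longrightarrow>
          f2_component M H c1 = {r_min M H<..<2 * M} \<and>
          ss_cmc M H (join M S1 S2) \<and> complete_hypersurface M (join M S1 S2) \<and>
          has_ends (join M S1 S2) 2) \<and>
        (c_min M H < c1 \<and> c1 < - 8 * M^3 * H \<longrightarrow>
          (\<exists>cb3.
            let S3 = Sigma3 M H r3 c1 cb3; S = join M (join M S1 S2) S3 in
              ss_cmc M H S3 \<and> connects_smoothly M S2 S3 \<and>
              ss_cmc M H S \<and> complete_hypersurface M S \<and> has_ends S 2)))"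
    (is "?unique \<and> ?less \<and> ?main")
proof (intro conjI)
  interpret mean_curvature_parameter M H
    by unfold_locales (rule assms)
  show ?unique
    unfolding is_arg_min_k_fun by simp
  show ?less
    by (rule c_min_less)
  consider "c1 < c_min M H" | "c1 = c_min M H" | "c1 > c_min M H"
    by linarith
  then show ?main
  proof cases
    case 1
    note comp = f2_component_subcritical[OF 1]
    obtain cb2 where "complete_pair M H (Sigma1 M H r1 c1 cb1) (Sigma2 M H r2 c1 cb2)"
      using subcritical_hypersurface[OF 1 assms(2)] assms(4) comp by blast
    then show ?thesis
      using 1 comp by (intro exI[of _ cb2]) (simp add: Let_def complete_pair_def)
  next
    case 2
    note comp = f2_component_critical[folded 2]
    obtain cb2 where "complete_pair M H (Sigma1 M H r1 c1 cb1) (Sigma2 M H r2 c1 cb2)"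
      using critical_hypersurface[OF assms(2), folded 2] assms(4) comp by blast
    then show ?thesis
      using 2 comp by (intro exI[of _ cb2]) (simp add: Let_def r_min complete_pair_def)
  next
    case 3
    obtain e Q1' where "turning M H c1 e (Q1 c1 e) Q1'" "f2_component M H c1 = {e..<2 * M}" "r_turn M H c1 = e"
      using supercritical_turning[OF 3 assms(5)] .
    from turning.Sigma1_Sigma2_Sigma3[OF this(1) assms(2,3) _ this(2,3)] 3
    obtain cb2 cb3 where "let S1 = Sigma1 M H r1 c1 cb1; S2 = Sigma2 M H r2 c1 cb2;
        S3 = Sigma3 M H r3 c1 cb3; S = join M (join M S1 S2) S3 in
      ss_cmc M H S2 \<and> connects_smoothly M S1 S2 \<and> ss_cmc M H S3 \<and> connects_smoothly M S2 S3 \<and>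
      ss_cmc M H S \<and> complete_hypersurface M S \<and> has_ends S 2"
      by (metis (no_types, lifting) linorder_not_le)
    then show ?thesis
      using 3 by (intro exI[of _ cb2]) (auto simp: Let_def)
  qed
qed

end
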